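(* There exist irreducible $S\in|\mathcal{O}_{\mathbb{F}}(1,2)|$ containing exactly $4$ twistor fibers, and for any such $S$ and $A\in\mathcal{T}(4)$ with $A\subset S$, there exists a curve $L$ of bidegree $(1,0)$ intersecting each connected component of $A$. Furthermore, $h^0(\mathcal{I}_A(1,2))=2$ and each element of $|\mathcal{I}_A(1,2)|$ is singular along $L$.
   Context: Work over $\mathbb{C}$. For $p,\ell\in\mathbb{P}^2$ write $p\ell=p_0\ell_0+p_1\ell_1+p_2\ell_2$. The flag threefold is $\mathbb{F}=\{(p,\ell)\in\mathbb{P}^2\times\mathbb{P}^2 : p\ell=0\}$, with projections $\pi_1(p,\ell)=p$, $\pi_2(p,\ell)=\ell$, and $\mathcal{O}_{\mathbb{F}}(a,b)$ is the restriction of $\mathcal{O}_{\mathbb{P}^2\times\mathbb{P}^2}(a,b)$. For a closed subscheme $A\subset\mathbb{F}$ with ideal sheaf $\mathcal{I}_A$, $\mathcal{I}_A(a,b)=\mathcal{I}_A\otimes\mathcal{O}_{\mathbb{F}}(a,b)$, $h^i$ denotes $\dim_{\mathbb{C}} H^i(\mathbb{F},\cdot)$, and $|\mathcal{I}_A(a,b)|$ is the linear system of members of $|\mathcal{O}_{\mathbb{F}}(a,b)|$ containing $A$. Curves of bidegree $(1,0)$ are the fibers of $\pi_2$. A twistor fiber is a curve $\{(p,\ell)\in\mathbb{F} : p\bar q=0,\ q\ell=0\}$ with $q\in\mathbb{P}^2$ (bar is complex conjugation of coordinates); equivalently, a fiber of $\pi:\mathbb{F}\to\mathbb{P}^2$,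 $\pi(p,\ell)=\bar p\times\ell$ (formal cross product). $\mathcal{T}(n)$ denotes the set of all unions of $n$ pairwise disjoint twistor fibers. *)

theory Defs
  imports "HOL-Analysis.Analysis" "HOL-Library.Function_Algebras"
begin

section \<open>The projective plane and the flag threefold\<close>

type_synonym cvec = "complex ^ 3"

quotient_type cp2 = "cvec" / partial:
  "\<lambda>v w :: cvec. v \<noteq> 0 \<and> (\<exists>c. c \<noteq> 0 \<and> w = c *s v)"
proof (rule part_equivpI)
  show "\<exists>v :: cvec. v \<noteq> 0 \<and> (\<exists>c. c \<noteq> 0 \<and> v = c *s v)"
    by (intro exI[of _ "axis 1 1"] conjI exI[of _ "1 :: complex"]) (auto simp: axis_eq_0_iff)
  show "symp (\<lambda>v w :: cvec. v \<noteq> 0 \<and> (\<exists>c. c \<noteq> 0 \<and> w = c *s v))"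
  proof (rule sympI, elim conjE exE, intro conjI)
    fix v w :: "cvec" and c
    assume "v \<noteq> 0" "c \<noteq> 0" "w = c *s v"
    then show "w \<noteq> 0" "\<exists>c. c \<noteq> 0 \<and> v = c *s w"
      by (auto intro!: exI[of _ "inverse c"])
  qed
  show "transp (\<lambda>v w :: cvec. v \<noteq> 0 \<and> (\<exists>c. c \<noteq> 0 \<and> w = c *s v))"
    by (rule transpI) (metis mult_eq_0_iff vector_smult_assoc)
qed

abbreviation pt :: "cvec \<Rightarrow> cp2" where
  "pt \<equiv> abs_cp2"

text \<open>The pairing is bilinear, not Hermitian.\<close>

definition pairing :: "cvec \<Rightarrow> cvec \<Rightarrow> complex" where
  "pairing p l = (\<Sum>i\<in>UNIV. p $ i * l $ i)"

definition cnj_vec :: "cvec \<Rightarrow> cvec" where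
  "cnj_vec q = (\<chi> i. cnj (q $ i))"

definition flag_cone :: "(cvec \<times> cvec) set" where
  "flag_cone = {(p, l). p \<noteq> 0 \<and> l \<noteq> 0 \<and> pairing p l = 0}"

definition flag :: "(cp2 \<times> cp2) set" where
  "flag = {(pt p, pt l) | p l. (p, l) \<in> flag_cone}"


section \<open>Bihomogeneous polynomials and the Zariski topology\<close>

interpretation cfun: vector_space "\<lambda>(c::complex) (f :: 'a \<Rightarrow> complex) x. c * f x"
  by unfold_locales (auto simp: fun_eq_iff algebra_simps)

text \<open>Over the infinite field of complex numbers polynomials may be identified with polynomial
  functions.\<close>

definition bihom :: "nat \<Rightarrow> nat \<Rightarrow> (cvec \<times> cvec \<Rightarrow> complex) set" where
  "bihom a b = cfun.span
     {\<lambda>(p, l). (\<Prod>i\<in>UNIV. (p $ i) ^ m i) * (\<Prod>i\<in>UNIV. (l $ i) ^ n i) | m n :: 3 \<Rightarrow> nat.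
        (\<Sum>i\<in>UNIV. m i) = a \<and> (\<Sum>i\<in>UNIV. n i) = b}"

definition zariski :: "(cp2 \<times> cp2) topology" where
  "zariski = topology_generated_by
     {{(pt p, pt l) | p l. p \<noteq> 0 \<and> l \<noteq> 0 \<and> P (p, l) \<noteq> 0} | P a b. P \<in> bihom a b}"

definition irreducible_in :: "'a topology \<Rightarrow> 'a set \<Rightarrow> bool" where
  "irreducible_in X S \<longleftrightarrow> S \<subseteq> topspace X \<and> S \<noteq> {} \<and>
     (\<forall>C D. closedin X C \<and> closedin X D \<and> S \<subseteq> C \<union> D \<longrightarrow> S \<subseteq> C \<or> S \<subseteq> D)"


section \<open>Line bundles on the flag threefold, divisors\<close>

text \<open>A global section of \<open>\<O>(a, b)\<close> on the flag threefold is regarded as a function on the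
  punctured bicone over it which locally, in the Zariski topology, is a quotient of bihomogeneous
  polynomials whose bidegrees differ by \<open>(a, b)\<close>. It is extended by 0 outside
  the bicone, so that equality of sections is equality of functions.\<close>

definition sections :: "nat \<Rightarrow> nat \<Rightarrow> (cvec \<times> cvec \<Rightarrow> complex) set" where
  "sections a b = {s.
     (\<forall>x. x \<notin> flag_cone \<longrightarrow> s x = 0) \<and>
     (\<forall>x\<in>flag_cone. \<exists>c d. \<exists>P\<in>bihom (a + c) (b + d). \<exists>Q\<in>bihom c d.
        Q x \<noteq> 0 \<and> (\<forall>y\<in>flag_cone. Q y \<noteq> 0 \<longrightarrow> s y = P y / Q y))}"

definition zero_locus :: "(cvec \<times> cvec \<Rightarrow> complex) \<Rightarrow> (cp2 \<times> cp2) set" where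
  "zero_locus s = {(pt p, pt l) | p l. (p, l) \<in> flag_cone \<and> s (p, l) = 0}"

text \<open>\<open>H\<^sup>0(\<I>\<^sub>A(a, b))\<close> for a subset \<open>A\<close> with its reduced scheme structure.\<close>

definition ideal_sections ::
  "(cp2 \<times> cp2) set \<Rightarrow> nat \<Rightarrow> nat \<Rightarrow> (cvec \<times> cvec \<Rightarrow> complex) set" where
  "ideal_sections A a b = {s \<in> sections a b. A \<subseteq> zero_locus s}"

definition h0_ideal :: "(cp2 \<times> cp2) set \<Rightarrow> nat \<Rightarrow> nat \<Rightarrow> nat" where
  "h0_ideal A a b = cfun.dim (ideal_sections A a b)"

text \<open>Members of a linear system are represented by nonzero sections. Two of these
  give the same divisor iff they are proportional; everything stated below about a divisor
  is invariant under rescaling the section.\<close>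

definition linear_system :: "nat \<Rightarrow> nat \<Rightarrow> (cvec \<times> cvec \<Rightarrow> complex) set" where
  "linear_system a b = sections a b - {0}"

definition linear_system_containing ::
  "(cp2 \<times> cp2) set \<Rightarrow> nat \<Rightarrow> nat \<Rightarrow> (cvec \<times> cvec \<Rightarrow> complex) set" where
  "linear_system_containing A a b = ideal_sections A a b - {0}"

text \<open>Points at which a local equation of the divisor of \<open>s\<close> vanishes together with its
  differential on the tangent space of the flag threefold. The bicone is smooth, and at a
  zero of the bihomogeneous function \<open>s\<close> the derivative along the directions \<open>(p, 0)\<close> and
  \<open>(0, l)\<close> vanishes automatically, so the condition can be tested on the bicone.\<close>

definition singular_locus ::
  "(cvec \<times> cvec \<Rightarrow> complex) \<Rightarrow> (cp2 \<times> cp2) set" where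
  "singular_locus s = {(pt p, pt l) | p l. (p, l) \<in> flag_cone \<and> s (p, l) = 0 \<and>
     (s has_derivative (\<lambda>_. 0)) (at (p, l) within flag_cone)}"


section \<open>Curves of bidegree (1,0) and twistor fibers\<close>

definition curves_1_0 :: "(cp2 \<times> cp2) set set" where
  "curves_1_0 = {{x \<in> flag. snd x = m} | m. True}"

definition twistor_fiber :: "cvec \<Rightarrow> (cp2 \<times> cp2) set" where
  "twistor_fiber q = {(pt p, pt l) | p l. (p, l) \<in> flag_cone \<and>
     pairing p (cnj_vec q) = 0 \<and> pairing q l = 0}"

definition twistor_fibers :: "(cp2 \<times> cp2) set set" where
  "twistor_fibers = {twistor_fiber q | q. q \<noteq> 0}"

definition disjoint_twistor_unions :: "nat \<Rightarrow> (cp2 \<times> cp2) set set" where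
  "disjoint_twistor_unions n =
     {\<Union>\<F> | \<F>. \<F> \<subseteq> twistor_fibers \<and> finite \<F> \<and> card \<F> = n \<and> pairwise disjnt \<F>}"

definition irreducible_with_four_fibers :: "(cvec \<times> cvec \<Rightarrow> complex) \<Rightarrow> bool" where
  "irreducible_with_four_fibers s \<longleftrightarrow>
     s \<in> linear_system 1 2 \<and> irreducible_in zariski (zero_locus s) \<and>
     card {T \<in> twistor_fibers. T \<subseteq> zero_locus s} = 4"

end

theory Submission
  imports Defs "HOL-Complex_Analysis.Cauchy_Integral_Formula"
begin

text \<open>The surfaces in \<open>|\<O>(1, 2)|\<close> are \<open>p \<bullet> B(l) = 0\<close> with \<open>B\<close> a vector of three quadratic forms, unique up to
multiples of \<open>l\<close>. That every section has this shape, although sections are only given as local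
quotients, follows from Liouville's theorem in the chart \<open>l\<^sub>3 = 1\<close> (\<open>regular_normal_form\<close>). The
twistor fiber of \<open>q\<close> consists of the points \<open>(l \<times> cnj q, l)\<close> with \<open>q \<bullet> l = 0\<close>, and a unitary change of
coordinates permutes the fibers, so all conditions can be computed in a frame adapted to the points
\<open>q\<^sub>1, \<dots>, q\<^sub>4\<close> whose fibers lie in the surface \<open>S\<close>.

First, these points are collinear (\<open>four_fibers_over_collinear_points\<close>). Otherwise one of them, \<open>q\<close>, is
joined to the others by three different lines. Over the line \<open>q \<bullet> l = 0\<close> a section that vanishes
on the fiber of \<open>q\<close> is \<open>(p \<bullet> cnj q) \<sigma>(l)\<close> with \<open>\<sigma>\<close> quadratic, and the other three fibers give
three zeros of \<open>\<sigma>\<close>. Hence \<open>S\<close> contains the whole preimage of that line; its equation is then divisible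
by \<open>q \<bullet> l\<close>, and \<open>S\<close> is not irreducible.

Now let the points lie on a line and choose the frame such that they are \<open>(1, 0, 0)\<close> and \<open>(t, 1, 0)\<close> with
\<open>t \<in> {a, b, c}\<close>. The curve \<open>L\<close> is the fiber of the second projection over \<open>(0, 0, 1)\<close>. The fiber of
\<open>(t, 1, 0)\<close> imposes two equations (\<open>collinear_normal_form\<close>), namely \<open>\<alpha> t + \<beta> cnj t = \<gamma>\<close> for the part of the
section of degree 1 in \<open>l\<^sub>1, l\<^sub>2\<close>, and \<open>f(t) = cnj t \<cdot> g(t)\<close> with \<open>f\<close> quadratic and \<open>g\<close> affine linear
for the part of degree 2. If \<open>a, b, c\<close> lie on a real line, that is, if the four points lie on a circle of
the projective line, then \<open>cnj t\<close> is an affine function of \<open>t\<close> there. Both equations become polynomial of degree at most 2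
with three solutions, so they hold along the circle, and \<open>S\<close> contains infinitely many fibers
(\<open>fibers_along_circle\<close>). If \<open>S\<close> contains exactly four, then \<open>1, t, cnj t\<close> are linearly independent on
\<open>{a, b, c}\<close>, which kills the part of degree 1. In the part of degree 2 the form \<open>g\<close> is arbitrary and \<open>f\<close> is
found by Lagrange interpolation: this gives dimension 2, and since all terms are of degree 2 in
\<open>l\<^sub>1, l\<^sub>2\<close> every member is singular along \<open>L\<close>.

Existence is shown by \<open>p\<^sub>1 (l\<^sub>1\<^sup>2 / 4 + l\<^sub>2\<^sup>2) + p\<^sub>2 l\<^sub>1\<^sup>2\<close>. Its fibers correspond to
\<open>(1, 0, 0)\<close> and the solutions of \<open>cnj t = t\<^sup>2 + 1/4\<close>. The constant is special: for real \<open>\<epsilon>\<close> near \<open>1/4\<close>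
the equation \<open>cnj t = t\<^sup>2 + \<epsilon>\<close> has two or four solutions, and at \<open>1/4\<close> two real ones have merged, which leaves three.
Irreducibility holds because the image of an affine space under a polynomial map is dense in the cone over this surface (\<open>param_dense\<close>).\<close>

section \<open>Bihomogeneous polynomials\<close>

lemma pairing3: "pairing p l = p$1*l$1+p$2*l$2+p$3*l$3"
  by (simp add: pairing_def sum_3)

lemma cvec_eq_iff: "p = q \<longleftrightarrow> p$1 = q$1 \<and> p$2 = q$2 \<and> p$3 = q$3" for p q :: cvec
  by (simp add: vec_eq_iff forall_3)

lemma cnj_vec_nth [simp]: "cnj_vec q $ i = cnj (q $ i)"
  by (simp add: cnj_vec_def)

lemma bihom_add: "P \<in> bihom a b \<Longrightarrow> Q \<in> bihom a b \<Longrightarrow> (\<lambda>z. P z + Q z) \<in> bihom a b"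
  using cfun.span_add[of P _ Q] by (simp add: bihom_def plus_fun_def)

lemma bihom_scale: "P \<in> bihom a b \<Longrightarrow> (\<lambda>z. c * P z) \<in> bihom a b"
  using cfun.span_scale[of P _ c] by (simp add: bihom_def)

lemma bihom_zero: "(\<lambda>z. 0) \<in> bihom a b"
  using cfun.span_zero by (simp add: bihom_def zero_fun_def)

definition monomial :: "(3 \<Rightarrow> nat) \<Rightarrow> (3 \<Rightarrow> nat) \<Rightarrow> cvec \<times> cvec \<Rightarrow> complex" where
  "monomial m n = (\<lambda>(p, l). (\<Prod>i\<in>UNIV. (p $ i) ^ m i) * (\<Prod>i\<in>UNIV. (l $ i) ^ n i))"

lemma bihom_monomial:
  "sum m UNIV = a \<Longrightarrow> sum n UNIV = b \<Longrightarrow> monomial m n \<in> bihom a b"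
  unfolding bihom_def monomial_def by (rule cfun.span_base) blast

text \<open>The span that defines \<open>bihom\<close> carries the pointwise structure of functions; this rule hides the
  translation between the two.\<close>

lemma bihom_induct [consumes 1, case_names zero monomial add scale]:
  assumes "P \<in> bihom a b"
    and "X (\<lambda>z. 0)"
    and "\<And>m n. sum m UNIV = a \<Longrightarrow> sum n UNIV = b \<Longrightarrow> X (monomial m n)"
    and "\<And>P Q. P \<in> bihom a b \<Longrightarrow> Q \<in> bihom a b \<Longrightarrow> X P \<Longrightarrow> X Q \<Longrightarrow> X (\<lambda>z. P z + Q z)"
    and "\<And>P c. P \<in> bihom a b \<Longrightarrow> X P \<Longrightarrow> X (\<lambda>z. c * P z)"
  shows "X P"
proof -
  have "P \<in> bihom a b \<and> X P"
    using assms(1) unfolding bihom_def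
  proof (induction rule: cfun.span_induct_alt)
    case base
    then show ?case using assms(2) bihom_zero by (simp add: zero_fun_def bihom_def)
  next
    case (step c x y)
    then have x: "x \<in> bihom a b" "X x"
      using assms(3) bihom_monomial by (auto simp: monomial_def)
    have y: "y \<in> bihom a b" "X y" using step by (auto simp: bihom_def)
    have "X (\<lambda>z. c * x z + y z)"
      using assms(4)[of "\<lambda>z. c * x z" y] assms(5)[of x c] x y bihom_scale by blast
    moreover have "(\<lambda>z. c * x z + y z) \<in> bihom a b" 
      using x y by (intro bihom_add bihom_scale)
    ultimately show ?case by (simp add: plus_fun_def bihom_def)
  qed
  then show ?thesis by blast
qed

lemma bihom_mult:
  assumes "P \<in> bihom a b" "Q \<in> bihom c d"
  shows "(\<lambda>z. P z * Q z) \<in> bihom (a + c) (b + d)"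
  using assms(1)
proof (induction rule: bihom_induct)
  case zero
  then show ?case by (simp add: bihom_zero)
next
  case (add P Q)
  then show ?case by (simp add: distrib_right bihom_add)
next
  case (scale P k)
  then show ?case by (simp add: mult.assoc bihom_scale)
next
  case (monomial m n)
  note mn = this
  show ?case using assms(2)
  proof (induction rule: bihom_induct)
    case zero
    then show ?case by (simp add: bihom_zero)
  next
    case (add P Q)
    then show ?case by (simp add: distrib_left bihom_add)
  next
    case (scale P k)
    then show ?case by (simp add: mult.left_commute bihom_scale)
  next
    case (monomial m' n')
    have "(\<lambda>z. monomial m n z * monomial m' n' z) = monomial (\<lambda>i. m i + m' i) (\<lambda>i. n i + n' i)"
      by (auto simp: monomial_def power_add prod.distrib fun_eq_iff)
    then show ?case using mn monomial by (auto intro!: bihom_monomial simp: sum.distrib)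
  qed
qed

lemma bihom_const: "(\<lambda>z. c) \<in> bihom 0 0"
  using bihom_scale[OF bihom_monomial[of "\<lambda>_. 0" 0 "\<lambda>_. 0" 0], of c] by (simp add: monomial_def case_prod_beta)

lemma bihom_fst: "(\<lambda>z. fst z $ i) \<in> bihom 1 0"
  using bihom_monomial[of "\<lambda>j. if j = i then 1 else 0" 1 "\<lambda>_. 0" 0]
  by (simp add: monomial_def case_prod_unfold if_distrib prod.delta cong: if_cong)

lemma bihom_snd: "(\<lambda>z. snd z $ i) \<in> bihom 0 1"
  using bihom_monomial[of "\<lambda>_. 0" 0 "\<lambda>j. if j = i then 1 else 0" 1]
  by (simp add: monomial_def case_prod_unfold if_distrib prod.delta cong: if_cong)

lemma bihom_sum: "finite I \<Longrightarrow> (\<And>i. i \<in> I \<Longrightarrow> P i \<in> bihom a b) \<Longrightarrow> (\<lambda>z. \<Sum>i\<in>I. P i z) \<in> bihom a b"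
  by (induction I rule: finite_induct) (auto intro: bihom_add bihom_zero)

lemma bihom_fst_linear: "(\<lambda>z. (M *v fst z) $ i) \<in> bihom 1 0"
  unfolding matrix_vector_mult_def by (simp, intro bihom_sum bihom_scale bihom_fst[unfolded One_nat_def], simp)

lemma bihom_snd_linear: "(\<lambda>z. (M *v snd z) $ i) \<in> bihom 0 1"
  unfolding matrix_vector_mult_def by (simp, intro bihom_sum bihom_scale bihom_snd[unfolded One_nat_def], simp)

lemma bihom_scaling:
  assumes "P \<in> bihom a b"
  shows "P (\<alpha> *s p, \<beta> *s l) = \<alpha> ^ a * \<beta> ^ b * P (p, l)"
  using assms
proof (induction rule: bihom_induct)
  case (monomial m n)
  then show ?case
    by (auto simp: monomial_def power_mult_distrib prod.distrib power_sum [symmetric])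
qed (auto simp: algebra_simps)

lemma bihom_continuous:
  assumes "P \<in> bihom a b"
  shows "continuous_on S P"
  using assms
proof (induction rule: bihom_induct)
  case (monomial m n)
  then show ?case
    by (auto simp: monomial_def case_prod_beta intro!: continuous_intros)
qed (auto intro!: continuous_intros)

lemma bihom_holomorphic:
  assumes "P \<in> bihom a b" "\<And>i. (\<lambda>t. p t $ i) holomorphic_on D" "\<And>i. (\<lambda>t. l t $ i) holomorphic_on D"
  shows "(\<lambda>t. P (p t, l t)) holomorphic_on D"
  using assms(1)
proof (induction rule: bihom_induct)
  case (monomial m n)
  then show ?case
    by (auto simp: monomial_def intro!: holomorphic_intros assms(2-))
qed (auto intro!: holomorphic_intros)

text \<open>Restrictions of bihomogeneous polynomials to parametrized curves. Irreducibility is tested on such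
  curves, because in one variable a nonzero polynomial has only finitely many zeros.\<close>

definition polynomial_fun :: "(complex \<Rightarrow> complex) \<Rightarrow> bool" where
  "polynomial_fun f \<longleftrightarrow> (\<exists>P. f = poly P)"

lemma polynomial_fun_const [intro]: "polynomial_fun (\<lambda>t. c)"
  unfolding polynomial_fun_def by (rule exI[of _ "[:c:]"]) auto

lemma polynomial_fun_ident [intro]: "polynomial_fun (\<lambda>t. t)"
  unfolding polynomial_fun_def by (rule exI[of _ "[:0, 1:]"]) auto

lemma polynomial_fun_add [intro]: "polynomial_fun f \<Longrightarrow> polynomial_fun g \<Longrightarrow> polynomial_fun (\<lambda>t. f t + g t)"
  unfolding polynomial_fun_def
  by (elim exE) (rule_tac x = "P + Pa" in exI, auto)

lemma polynomial_fun_diff [intro]: "polynomial_fun f \<Longrightarrow> polynomial_fun g \<Longrightarrow> polynomial_fun (\<lambda>t. f t - g t)"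
  unfolding polynomial_fun_def
  by (elim exE) (rule_tac x = "P - Pa" in exI, auto)

lemma polynomial_fun_mult [intro]: "polynomial_fun f \<Longrightarrow> polynomial_fun g \<Longrightarrow> polynomial_fun (\<lambda>t. f t * g t)"
  unfolding polynomial_fun_def
  by (elim exE) (rule_tac x = "P * Pa" in exI, auto)

lemma polynomial_fun_uminus [intro]: "polynomial_fun f \<Longrightarrow> polynomial_fun (\<lambda>t. - f t)"
  unfolding polynomial_fun_def
  by (elim exE) (rule_tac x = "- P" in exI, auto)

lemma polynomial_fun_power [intro]: "polynomial_fun f \<Longrightarrow> polynomial_fun (\<lambda>t. f t ^ n)"
  by (induction n) auto

lemma polynomial_fun_prod: "finite I \<Longrightarrow> (\<And>i. i \<in> I \<Longrightarrow> polynomial_fun (f i)) \<Longrightarrow> polynomial_fun (\<lambda>t. \<Prod>i\<in>I. f i t)"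
  by (induction I rule: finite_induct) auto

lemma polynomial_fun_finite_zeros:
  assumes "polynomial_fun f" "f t0 \<noteq> 0"
  shows "finite {t. f t = 0}"
proof -
  obtain P where "f = poly P" using assms(1) by (auto simp: polynomial_fun_def)
  then show ?thesis using assms(2) poly_roots_finite[of P] by (cases "P = 0") auto
qed

lemma polynomial_fun_bihom:
  assumes "P \<in> bihom a b" "\<And>i. polynomial_fun (\<lambda>t. p t $ i)" "\<And>i. polynomial_fun (\<lambda>t. l t $ i)"
  shows "polynomial_fun (\<lambda>t. P (p t, l t))"
  using assms(1)
proof (induction rule: bihom_induct)
  case (monomial m n)
  then show ?case
    by (auto simp: monomial_def intro!: assms(2-) polynomial_fun_prod)
qed auto

section \<open>Regular functions on the bicone\<close>

text \<open>The reason for using conjugates: \<open>q \<bullet> cnj q\<close> does not vanish, whereas \<open>q \<bullet> q\<close> may.\<close>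

lemma hermitian_norm_nonzero:
  fixes a b :: complex
  assumes "a \<noteq> 0 \<or> b \<noteq> 0"
  shows "a * cnj a + b * cnj b \<noteq> 0"
proof -
  have "a * cnj a + b * cnj b = complex_of_real ((cmod a)\<^sup>2 + (cmod b)\<^sup>2)"
    by (simp add: complex_norm_square del: of_real_power)
  moreover have "(cmod a)\<^sup>2 + (cmod b)\<^sup>2 \<noteq> 0"
    using assms by (simp add: sum_power2_eq_zero_iff)
  ultimately show ?thesis by (simp del: of_real_add)
qed

definition vec3 :: "complex \<Rightarrow> complex \<Rightarrow> complex \<Rightarrow> cvec" where
  "vec3 a b c = (\<chi> i. if i = 1 then a else if i = 2 then b else c)"

lemma vec3_nth [simp]: "vec3 a b c $ 1 = a" "vec3 a b c $ 2 = b" "vec3 a b c $ 3 = c"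
  by (auto simp: vec3_def)

lemma vec3_eta: "vec3 (p $ 1) (p $ 2) (p $ 3) = p"
  by (simp add: cvec_eq_iff)

lemma scale_vec3: "c *s vec3 x y z = vec3 (c * x) (c * y) (c * z)"
  by (simp add: cvec_eq_iff)

lemma vec3_eq_0_iff: "vec3 a b c = 0 \<longleftrightarrow> a = 0 \<and> b = 0 \<and> c = 0"
  by (simp add: cvec_eq_iff)

lemma flag_cone_iff:
  "(p, l) \<in> flag_cone \<longleftrightarrow> p \<noteq> 0 \<and> l \<noteq> 0 \<and> p$1*l$1+p$2*l$2+p$3*l$3 = 0"
  by (simp add: flag_cone_def pairing3)

lemma flag_cone_scale:
  "(p, l) \<in> flag_cone \<Longrightarrow> \<alpha> \<noteq> 0 \<Longrightarrow> \<beta> \<noteq> 0 \<Longrightarrow> (\<alpha> *s p, \<beta> *s l) \<in> flag_cone"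
  by (auto simp: flag_cone_def pairing_def mult.assoc mult.left_commute simp flip: sum_distrib_left)

text \<open>The two properties of a section of \<open>\<O>(1, 2)\<close> from which its normal form is derived. In contrast to the
  definition by local quotients they are evidently preserved by linear changes of coordinates.\<close>

definition regular_on_cone :: "(cvec \<times> cvec \<Rightarrow> complex) \<Rightarrow> bool" where
  "regular_on_cone s \<longleftrightarrow>
     (\<forall>p l \<alpha> \<beta>. (p, l) \<in> flag_cone \<longrightarrow> \<alpha> \<noteq> 0 \<longrightarrow> \<beta> \<noteq> 0 \<longrightarrow> s (\<alpha> *s p, \<beta> *s l) = \<alpha> * \<beta>\<^sup>2 * s (p, l)) \<and>
     (\<forall>D p l. open D \<longrightarrow> (\<forall>i. (\<lambda>t. p t $ i) holomorphic_on D) \<longrightarrow> (\<forall>i. (\<lambda>t. l t $ i) holomorphic_on D) \<longrightarrow>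
        (\<forall>t\<in>D. (p t, l t) \<in> flag_cone) \<longrightarrow> (\<lambda>t. s (p t, l t)) holomorphic_on D)"

lemma regular_scale:
  "regular_on_cone s \<Longrightarrow> (p, l) \<in> flag_cone \<Longrightarrow> \<alpha> \<noteq> 0 \<Longrightarrow> \<beta> \<noteq> 0 \<Longrightarrow>
    s (\<alpha> *s p, \<beta> *s l) = \<alpha> * \<beta>\<^sup>2 * s (p, l)"
  unfolding regular_on_cone_def by blast

lemma regular_scale':
  "regular_on_cone s \<Longrightarrow> (p, l) \<in> flag_cone \<Longrightarrow> \<alpha> \<noteq> 0 \<Longrightarrow> \<beta> \<noteq> 0 \<Longrightarrow>
    p' = \<alpha> *s p \<Longrightarrow> l' = \<beta> *s l \<Longrightarrow> s (p', l') = \<alpha> * \<beta>\<^sup>2 * s (p, l)"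
  using regular_scale by blast

lemma regular_holomorphic:
  assumes "regular_on_cone s" "open D"
    "p1 holomorphic_on D" "p2 holomorphic_on D" "p3 holomorphic_on D"
    "l1 holomorphic_on D" "l2 holomorphic_on D" "l3 holomorphic_on D"
    "\<And>t. t \<in> D \<Longrightarrow> (vec3 (p1 t) (p2 t) (p3 t), vec3 (l1 t) (l2 t) (l3 t)) \<in> flag_cone"
  shows "(\<lambda>t. s (vec3 (p1 t) (p2 t) (p3 t), vec3 (l1 t) (l2 t) (l3 t))) holomorphic_on D"
proof -
  have "\<forall>i. (\<lambda>t. vec3 (p1 t) (p2 t) (p3 t) $ i) holomorphic_on D"
       "\<forall>i. (\<lambda>t. vec3 (l1 t) (l2 t) (l3 t) $ i) holomorphic_on D"
    using assms by (auto simp: forall_3)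
  then show ?thesis
    using assms(1)[unfolded regular_on_cone_def, THEN conjunct2, rule_format, of D
      "\<lambda>t. vec3 (p1 t) (p2 t) (p3 t)" "\<lambda>t. vec3 (l1 t) (l2 t) (l3 t)"] assms(2,9) by simp
qed

text \<open>Hence whether a section vanishes at a point can be tested on any representative.\<close>

lemma sections_scale:
  assumes "s \<in> sections a b" "(p, l) \<in> flag_cone" "\<alpha> \<noteq> 0" "\<beta> \<noteq> 0"
  shows "s (\<alpha> *s p, \<beta> *s l) = \<alpha> ^ a * \<beta> ^ b * s (p, l)"
proof -
  obtain c d P Q where PQ: "P \<in> bihom (a + c) (b + d)" "Q \<in> bihom c d" "Q (p, l) \<noteq> 0"
     "\<And>y. y \<in> flag_cone \<Longrightarrow> Q y \<noteq> 0 \<Longrightarrow> s y = P y / Q y"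
    using assms(1,2) unfolding sections_def by blast
  have "Q (\<alpha> *s p, \<beta> *s l) \<noteq> 0"
    using assms PQ by (simp add: bihom_scaling[OF PQ(2)])
  then have "s (\<alpha> *s p, \<beta> *s l) = P (\<alpha> *s p, \<beta> *s l) / Q (\<alpha> *s p, \<beta> *s l)"
    using PQ assms flag_cone_scale by blast
  also have "\<dots> = \<alpha> ^ a * \<beta> ^ b * (P (p, l) / Q (p, l))"
    using assms by (simp add: bihom_scaling[OF PQ(2)] bihom_scaling[OF PQ(1)] power_add)
  finally show ?thesis using PQ assms by simp
qed

lemma sections_regular:
  assumes "s \<in> sections 1 2"
  shows "regular_on_cone s"
  unfolding regular_on_cone_def
proof (intro conjI allI impI)
  fix p l and \<alpha> \<beta> :: complex
  assume "(p, l) \<in> flag_cone" "\<alpha> \<noteq> 0" "\<beta> \<noteq> 0"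
  then show "s (\<alpha> *s p, \<beta> *s l) = \<alpha> * \<beta>\<^sup>2 * s (p, l)"
    using sections_scale[OF assms] by simp
next
  fix D and p l :: "complex \<Rightarrow> cvec"
  assume D: "open D" "\<forall>i. (\<lambda>t. p t $ i) holomorphic_on D" "\<forall>i. (\<lambda>t. l t $ i) holomorphic_on D"
    "\<forall>t\<in>D. (p t, l t) \<in> flag_cone"
  show "(\<lambda>t. s (p t, l t)) holomorphic_on D"
    unfolding holomorphic_on_open[OF D(1)]
  proof
    fix t assume t: "t \<in> D"
    obtain c d P Q where PQ: "P \<in> bihom (1 + c) (2 + d)" "Q \<in> bihom c d" "Q (p t, l t) \<noteq> 0"
       "\<And>y. y \<in> flag_cone \<Longrightarrow> Q y \<noteq> 0 \<Longrightarrow> s y = P y / Q y"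
      using assms D(4) t unfolding sections_def by blast
    have hP: "(\<lambda>t. P (p t, l t)) holomorphic_on D" and hQ: "(\<lambda>t. Q (p t, l t)) holomorphic_on D"
      using PQ D by (auto intro: bihom_holomorphic)
    define U where "U = D \<inter> (\<lambda>t. Q (p t, l t)) -` (- {0})"
    have U: "open U" "t \<in> U" "U \<subseteq> D"
      using continuous_open_preimage[OF holomorphic_on_imp_continuous_on[OF hQ] D(1), of "- {0}"] t PQ(3)
      by (auto simp: U_def)
    have "(\<lambda>t. P (p t, l t) / Q (p t, l t)) holomorphic_on U"
      using hP hQ U by (intro holomorphic_on_divide) (auto intro: holomorphic_on_subset simp: U_def)
    then have "(\<lambda>t. s (p t, l t)) holomorphic_on U"
      by (rule holomorphic_transform) (use PQ(4) D(4) in \<open>auto simp: U_def\<close>)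
    then show "\<exists>f'. ((\<lambda>t. s (p t, l t)) has_field_derivative f') (at t)"
      using U holomorphic_on_open by blast
  qed
qed

text \<open>A global section of \<open>\<O>(n)\<close> on the projective line, given by its entire expressions \<open>f\<close> and \<open>h\<close> in the
  two standard charts: boundedness of \<open>h\<close> near 0 means polynomial growth of \<open>f\<close>, and Liouville's theorem applies.\<close>

lemma two_chart_polynomial:
  assumes f: "f holomorphic_on UNIV" and h: "h holomorphic_on UNIV"
    and fh: "\<And>t. t \<noteq> 0 \<Longrightarrow> f t = t ^ n * h (1 / t)"
  shows "\<exists>c. \<forall>t. f t = (\<Sum>i\<le>n. c i * t ^ i)"
proof -
  have "compact (h ` cball 0 1)"
    by (intro compact_continuous_image holomorphic_on_imp_continuous_on holomorphic_on_subset[OF h]) auto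
  then obtain B where B: "\<And>z. norm z \<le> 1 \<Longrightarrow> norm (h z) \<le> B"
    using compact_imp_bounded bounded_iff by (metis imageI mem_cball_0)
  have "norm (f z) \<le> B * norm z ^ n" if "1 \<le> norm z" for z
  proof -
    have "norm (f z) = norm z ^ n * norm (h (1 / z))"
      using that fh[of z] by (cases "z = 0") (auto simp: norm_mult norm_power)
    also have "\<dots> \<le> norm z ^ n * B"
      using that by (intro mult_left_mono B) (auto simp: norm_divide divide_simps)
    finally show ?thesis by (simp add: mult.commute)
  qed
  then show ?thesis
    using Liouville_polynomial[OF f, of 1 B n]
    by (intro exI[of _ "\<lambda>k. (deriv ^^ k) f 0 / fact k"]) blast
qed

lemma eq_at_puncture:
  fixes f g :: "complex \<Rightarrow> complex"
  assumes "continuous_on U f" "continuous_on U g" "open U" "z \<in> U"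
    "\<And>w. w \<in> U \<Longrightarrow> w \<noteq> z \<Longrightarrow> f w = g w"
  shows "f z = g z"
proof (rule tendsto_unique)
  show "(f \<longlongrightarrow> f z) (at z)" 
    using assms continuous_on_eq_continuous_at isCont_def by blast
  have "(g \<longlongrightarrow> g z) (at z)" 
    using assms continuous_on_eq_continuous_at isCont_def by blast
  moreover have "eventually (\<lambda>w. g w = f w) (at z)"
    using assms by (auto simp: eventually_at_topological)
  ultimately show "(f \<longlongrightarrow> g z) (at z)"
    using tendsto_cong by force
qed auto

text \<open>A function that is a polynomial on sufficiently many lines is a polynomial. Interpolation in \<open>b\<close> at
  \<open>0, 1, -1\<close> bounds both partial degrees, and the lines through the origin bound the total degree by 3. The
  partial degree 2 in \<open>b\<close> makes the cubic part divisible by \<open>a\<close>.\<close>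

lemma bivariate_cubic:
  fixes f :: "complex \<Rightarrow> complex \<Rightarrow> complex"
  assumes b: "\<And>a. \<exists>c. \<forall>b. f a b = (\<Sum>i\<le>2. c i * b ^ i)"
    and a: "\<And>b. \<exists>c. \<forall>a. f a b = (\<Sum>i\<le>3. c i * a ^ i)"
    and r: "\<And>a b. a \<noteq> 0 \<Longrightarrow> \<exists>c. \<forall>u. f (u * a) (u * b) = (\<Sum>i\<le>3. c i * u ^ i)"
  shows "\<exists>A0 A1 A2 A3 A4 A5 C0 C1 C2. \<forall>a b. f a b =
     A0 + A1 * a + A2 * b + A3 * a\<^sup>2 + A4 * a * b + A5 * b\<^sup>2 + a * (C0 * a\<^sup>2 + C1 * a * b + C2 * b\<^sup>2)"
proof -
  have interpolate: "f a b = f a 0 + (f a 1 - f a (-1)) / 2 * b + ((f a 1 + f a (-1)) / 2 - f a 0) * b\<^sup>2" for a b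
  proof -
    obtain c where c: "\<And>b. f a b = (\<Sum>i\<le>2. c i * b ^ i)" using b[of a] by blast
    have c': "f a b = c 0 + c 1 * b + c 2 * b^2" for b
      unfolding c by (simp add: eval_nat_numeral)
    show ?thesis unfolding c' by (simp add: add_divide_distrib)
  qed
  have a': "\<exists>c :: nat \<Rightarrow> complex. \<forall>a. f a b = c 0 + c 1 * a + c 2 * a^2 + c 3 * a^3" for b
    using a[of b] by (simp add: numeral_3_eq_3 numeral_2_eq_2 add.assoc)
  obtain c :: "nat \<Rightarrow> complex" where c: "\<And>a. f a 0 = c 0 + c 1 * a + c 2 * a^2 + c 3 * a^3" using a'[of 0] by blast
  obtain d :: "nat \<Rightarrow> complex" where d: "\<And>a. f a 1 = d 0 + d 1 * a + d 2 * a^2 + d 3 * a^3" using a'[of 1] by blast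
  obtain e :: "nat \<Rightarrow> complex" where e: "\<And>a. f a (-1) = e 0 + e 1 * a + e 2 * a^2 + e 3 * a^3" using a'[of "-1"] by blast
  define g :: "nat \<Rightarrow> complex" where "g i = (d i - e i) / 2" for i
  define h :: "nat \<Rightarrow> complex" where "h i = (d i + e i) / 2 - c i" for i
  have f: "f a b = (c 0 + c 1 * a + c 2 * a^2 + c 3 * a^3) + (g 0 + g 1 * a + g 2 * a^2 + g 3 * a^3) * b
     + (h 0 + h 1 * a + h 2 * a^2 + h 3 * a^3) * b\<^sup>2" for a b
    unfolding interpolate[of a b] unfolding c d e g_def h_def by algebra
  have top: "h 3 * (a^3 * b^2) = 0 \<and> g 3 * (a^3 * b) + h 2 * (a^2 * b^2) = 0" if "a \<noteq> 0" for a b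
  proof -
    obtain k where k: "\<And>u. f (u * a) (u * b) = (\<Sum>i\<le>3. k i * u ^ i)" using r \<open>a \<noteq> 0\<close> by blast
    define k' where "k' i = (if i \<le> 3 then k i else 0)" for i
    define m where "m = (\<lambda>i. [c 0, c 1 * a + g 0 * b, c 2 * a^2 + g 1 * a * b + h 0 * b^2,
       c 3 * a^3 + g 2 * a^2 * b + h 1 * a * b^2, g 3 * (a^3 * b) + h 2 * (a^2 * b^2), h 3 * (a^3 * b^2)] ! i)"
    have sum5: "(\<Sum>i\<le>5. n i * u ^ i) = n 0 + n 1 * u + n 2 * u^2 + n 3 * u^3 + n 4 * u^4 + n 5 * u^5" for n :: "nat \<Rightarrow> complex" and u
      by (simp add: numeral_eq_Suc)
    have m: "m 0 = c 0" "m 1 = c 1 * a + g 0 * b" "m 2 = c 2 * a^2 + g 1 * a * b + h 0 * b^2"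
       "m 3 = c 3 * a^3 + g 2 * a^2 * b + h 1 * a * b^2" "m 4 = g 3 * (a^3 * b) + h 2 * (a^2 * b^2)" 
       "m 5 = h 3 * (a^3 * b^2)"
      by (simp_all add: m_def)
    have "(\<Sum>i\<le>5. m i * u ^ i) = (\<Sum>i\<le>5. k' i * u ^ i)" for u
    proof -
      have "(\<Sum>i\<le>5. m i * u ^ i) = f (u * a) (u * b)"
        unfolding f sum5 m by algebra
      also have "\<dots> = (\<Sum>i\<le>5. k' i * u ^ i)"
        unfolding k k'_def sum5 by (simp add: numeral_eq_Suc)
      finally show ?thesis .
    qed
    then have "\<forall>i\<le>5. m i = k' i"
      using polyfun_eq_coeffs[of m 5 k'] by blast
    then have "m 4 = k' 4" "m 5 = k' 5" by auto
    then show ?thesis unfolding m k'_def by auto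
  qed
  have "h 3 = 0" using top[of 1 1] by simp
  moreover have "g 3 + h 2 = 0" using top[of 1 1] by simp
  moreover have "h 2 - g 3 = 0" using top[of "1" "-1"] by simp
  ultimately have "h 3 = 0" "g 3 = 0" "h 2 = 0" by (auto simp: add_eq_0_iff)
  then have "f a b = c 0 + c 1 * a + g 0 * b + c 2 * a\<^sup>2 + g 1 * a * b + h 0 * b\<^sup>2 + 
       a * (c 3 * a\<^sup>2 + g 2 * a * b + h 1 * b\<^sup>2)" for a b
    unfolding f by algebra
  then show ?thesis by blast
qed

section \<open>The normal form of a section\<close>

text \<open>The form \<open>p \<bullet> (X, Y, Z)\<close> with quadratic forms \<open>X, Y, Z\<close> in \<open>l\<close>. As \<open>p \<bullet> l = 0\<close>, adding a linear multiple of \<open>l\<close>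
  to \<open>(X, Y, Z)\<close> changes nothing; this freedom is used to make \<open>Z\<close> free of \<open>l\<^sub>3\<close>. The 15 coefficients that remain are
  as many as \<open>h\<^sup>0(\<O>(1, 2))\<close>.\<close>

definition normal_form ::
  "(nat \<Rightarrow> complex) \<Rightarrow> (nat \<Rightarrow> complex) \<Rightarrow> (nat \<Rightarrow> complex) \<Rightarrow> cvec \<times> cvec \<Rightarrow> complex" where
  "normal_form A B C = (\<lambda>(p, l).
     p$1 * (A 0 * (l$3)\<^sup>2 + A 1 * l$1 * l$3 + A 2 * l$2 * l$3 + A 3 * (l$1)\<^sup>2 + A 4 * l$1 * l$2 + A 5 * (l$2)\<^sup>2)
   + p$2 * (B 0 * (l$3)\<^sup>2 + B 1 * l$1 * l$3 + B 2 * l$2 * l$3 + B 3 * (l$1)\<^sup>2 + B 4 * l$1 * l$2 + B 5 * (l$2)\<^sup>2)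
   + p$3 * (C 0 * (l$1)\<^sup>2 + C 1 * l$1 * l$2 + C 2 * (l$2)\<^sup>2))"

lemma holomorphic_normal_form:
  assumes "p1 holomorphic_on D" "p2 holomorphic_on D" "p3 holomorphic_on D"
    "l1 holomorphic_on D" "l2 holomorphic_on D" "l3 holomorphic_on D"
  shows "(\<lambda>t. normal_form A B C (vec3 (p1 t) (p2 t) (p3 t), vec3 (l1 t) (l2 t) (l3 t))) holomorphic_on D"
  unfolding normal_form_def by (simp, intro holomorphic_intros assms)

text \<open>The restriction to a fiber of the second projection is a section of \<open>\<O>(1)\<close> on a projective line, hence linear.\<close>

lemma regular_chart_linear:
  assumes s: "regular_on_cone s" and "p1 \<noteq> 0 \<or> p2 \<noteq> 0"
  shows "s (vec3 p1 p2 (- (p1 * a + p2 * b)), vec3 a b 1) =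
     p1 * s (vec3 1 0 (- a), vec3 a b 1) + p2 * s (vec3 0 1 (- b), vec3 a b 1)"
proof (cases "p1 = 0")
  case True
  then show ?thesis
    using assms(2) regular_scale'[OF s, of "vec3 0 1 (- b)" "vec3 a b 1" p2 1 "vec3 p1 p2 (- (p1 * a + p2 * b))" "vec3 a b 1"]
    by (simp add: flag_cone_iff vec3_eq_0_iff scale_vec3)
next
  case False
  define f where "f t = s (vec3 1 t (- (a + t * b)), vec3 a b 1)" for t
  define h where "h e = s (vec3 e 1 (- (e * a + b)), vec3 a b 1)" for e
  have "f holomorphic_on UNIV" unfolding f_def
    by (rule regular_holomorphic[OF s]) (auto intro!: holomorphic_intros simp: flag_cone_iff vec3_eq_0_iff)
  moreover have h: "h holomorphic_on UNIV" unfolding h_def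
    by (rule regular_holomorphic[OF s]) (auto intro!: holomorphic_intros simp: flag_cone_iff vec3_eq_0_iff)
  moreover have fh: "f t = t ^ 1 * h (1 / t)" if "t \<noteq> 0" for t
    unfolding f_def h_def
    using regular_scale'[OF s, of "vec3 (1 / t) 1 (- ((1 / t) * a + b))" "vec3 a b 1" t 1 "vec3 1 t (- (a + t * b))" "vec3 a b 1"] that
    by (simp add: flag_cone_iff vec3_eq_0_iff scale_vec3 distrib_left right_diff_distrib)
  ultimately obtain c where "\<And>t. f t = (\<Sum>i\<le>1. c i * t ^ i)" 
    using two_chart_polynomial[of f h 1] by blast
  then have c: "f t = c 0 + c 1 * t" for t by simp
  have "h 0 = c 0 * 0 + c 1"
  proof (rule eq_at_puncture[of UNIV h "\<lambda>e. c 0 * e + c 1"])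
    show "h w = c 0 * w + c 1" if "w \<noteq> 0" for w
      using fh[of "1 / w"] that by (simp add: c field_simps)
  qed (use h holomorphic_on_imp_continuous_on in \<open>auto intro!: continuous_intros\<close>)
  then have "h 0 = c 1" by simp
  then have f: "f t = s (vec3 1 0 (- a), vec3 a b 1) + t * s (vec3 0 1 (- b), vec3 a b 1)" for t
    using c[of 0] c[of t] by (simp add: f_def h_def)
  have eq: "vec3 p1 p2 (- (p1 * a + p2 * b)) = p1 *s vec3 1 (p2 / p1) (- (a + (p2 / p1) * b))"
    using False by (simp add: cvec_eq_iff field_simps)
  have "s (vec3 p1 p2 (- (p1 * a + p2 * b)), vec3 a b 1) = p1 * f (p2 / p1)"
    unfolding f_def eq
    using regular_scale[OF s, of "vec3 1 (p2 / p1) (- (a + (p2 / p1) * b))" "vec3 a b 1" p1 1] False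
    by (simp add: flag_cone_iff vec3_eq_0_iff)
  then show ?thesis using False by (simp add: f distrib_left)
qed

text \<open>The three degree bounds come from following the section to \<open>l\<^sub>3 = 0\<close> along curves on which \<open>(p, l)\<close>
  stays in the bicone. In the direction of \<open>a\<close> one power of \<open>p\<close> is lost, since \<open>(1, 0, -a)\<close> is unbounded; this is why the degree
  is 3 there and 2 in the direction of \<open>b\<close>.\<close>

lemma regular_chart_cubic:
  assumes s: "regular_on_cone s"
    and x_def: "\<And>a b. x a b = s (vec3 1 0 (- a), vec3 a b 1)"
  shows "\<exists>A0 A1 A2 A3 A4 A5 C0 C1 C2. \<forall>a b. x a b =
     A0 + A1 * a + A2 * b + A3 * a\<^sup>2 + A4 * a * b + A5 * b\<^sup>2 + a * (C0 * a\<^sup>2 + C1 * a * b + C2 * b\<^sup>2)"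
proof (rule bivariate_cubic)
  fix a
  define h where "h e = s (vec3 1 0 (- a), vec3 (a * e) 1 e)" for e
  show "\<exists>c. \<forall>b. x a b = (\<Sum>i\<le>2. c i * b ^ i)"
  proof (rule two_chart_polynomial)
    show "x a holomorphic_on UNIV" unfolding x_def
      by (rule regular_holomorphic[OF s]) (auto intro!: holomorphic_intros simp: flag_cone_iff vec3_eq_0_iff)
    show "h holomorphic_on UNIV" unfolding h_def
      by (rule regular_holomorphic[OF s]) (auto intro!: holomorphic_intros simp: flag_cone_iff vec3_eq_0_iff)
    show "x a t = t\<^sup>2 * h (1 / t)" if "t \<noteq> 0" for t
      unfolding x_def h_def
      using regular_scale'[OF s, of "vec3 1 0 (- a)" "vec3 (a * (1 / t)) 1 (1 / t)" 1 t "vec3 1 0 (- a)" "vec3 a t 1"] that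
      by (simp add: flag_cone_iff vec3_eq_0_iff scale_vec3)
  qed
next
  fix b
  define h where "h e = s (vec3 e 0 (- 1), vec3 1 (b * e) e)" for e
  show "\<exists>c. \<forall>a. x a b = (\<Sum>i\<le>3. c i * a ^ i)"
  proof (rule two_chart_polynomial)
    show "(\<lambda>a. x a b) holomorphic_on UNIV" unfolding x_def
      by (rule regular_holomorphic[OF s]) (auto intro!: holomorphic_intros simp: flag_cone_iff vec3_eq_0_iff)
    show "h holomorphic_on UNIV" unfolding h_def
      by (rule regular_holomorphic[OF s]) (auto intro!: holomorphic_intros simp: flag_cone_iff vec3_eq_0_iff)
    show "x t b = t ^ 3 * h (1 / t)" if "t \<noteq> 0" for t
      unfolding x_def h_def
      using regular_scale'[OF s, of "vec3 (1 / t) 0 (- 1)" "vec3 1 (b * (1 / t)) (1 / t)" t t "vec3 1 0 (- t)" "vec3 t b 1"] that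
      by (simp add: flag_cone_iff vec3_eq_0_iff scale_vec3 power3_eq_cube power2_eq_square)
  qed
next
  fix a b :: complex assume "a \<noteq> 0"
  define h where "h e = s (vec3 e 0 (- a), vec3 a b e)" for e
  show "\<exists>c. \<forall>u. x (u * a) (u * b) = (\<Sum>i\<le>3. c i * u ^ i)"
  proof (rule two_chart_polynomial)
    show "(\<lambda>u. x (u * a) (u * b)) holomorphic_on UNIV" unfolding x_def
      by (rule regular_holomorphic[OF s]) (auto intro!: holomorphic_intros simp: flag_cone_iff vec3_eq_0_iff)
    show "h holomorphic_on UNIV" unfolding h_def using \<open>a \<noteq> 0\<close>
      by (intro regular_holomorphic[OF s]) (auto intro!: holomorphic_intros simp: flag_cone_iff vec3_eq_0_iff)
    show "x (t * a) (t * b) = t ^ 3 * h (1 / t)" if "t \<noteq> 0" for t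
      unfolding x_def h_def
      using regular_scale'[OF s, of "vec3 (1 / t) 0 (- a)" "vec3 a b (1 / t)" t t "vec3 1 0 (- (t * a))" "vec3 (t * a) (t * b) 1"] that \<open>a \<noteq> 0\<close>
      by (simp add: flag_cone_iff vec3_eq_0_iff scale_vec3 power3_eq_cube power2_eq_square)
  qed
qed

text \<open>Linear changes of coordinates that preserve the incidence relation act on regular functions.\<close>

lemma regular_matrix:
  fixes M N :: "complex ^ 3 ^ 3"
  assumes s: "regular_on_cone s"
    and cone: "\<And>p l. (p, l) \<in> flag_cone \<Longrightarrow> (M *v p, N *v l) \<in> flag_cone"
  shows "regular_on_cone (\<lambda>(p, l). s (M *v p, N *v l))"
  unfolding regular_on_cone_def
proof (intro conjI allI impI)
  fix p l and \<alpha> \<beta> :: complex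
  assume "(p, l) \<in> flag_cone" "\<alpha> \<noteq> 0" "\<beta> \<noteq> 0"
  then show "(case (\<alpha> *s p, \<beta> *s l) of (p, l) \<Rightarrow> s (M *v p, N *v l)) =
      \<alpha> * \<beta>\<^sup>2 * (case (p, l) of (p, l) \<Rightarrow> s (M *v p, N *v l))"
    using regular_scale[OF s cone, of p l \<alpha> \<beta>] by (simp add: vector_scalar_commute)
next
  fix D and p l :: "complex \<Rightarrow> cvec"
  assume D: "open D" "\<forall>i. (\<lambda>t. p t $ i) holomorphic_on D" "\<forall>i. (\<lambda>t. l t $ i) holomorphic_on D"
    "\<forall>t\<in>D. (p t, l t) \<in> flag_cone"
  have "\<forall>i. (\<lambda>t. (M *v p t) $ i) holomorphic_on D" "\<forall>i. (\<lambda>t. (N *v l t) $ i) holomorphic_on D"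
    unfolding matrix_vector_mult_def using D(2,3) by (auto intro!: holomorphic_intros)
  then show "(\<lambda>t. case (p t, l t) of (p, l) \<Rightarrow> s (M *v p, N *v l)) holomorphic_on D"
    using s[unfolded regular_on_cone_def, THEN conjunct2, rule_format, of D "\<lambda>t. M *v p t" "\<lambda>t. N *v l t"]
      D(1,4) cone by simp
qed

text \<open>Exchanging the first two coordinates reduces statements about the second component of a section in the chart to the first.\<close>

definition swap12 :: "complex ^ 3 ^ 3" where
  "swap12 = (\<chi> i. if i = 1 then vec3 0 1 0 else if i = 2 then vec3 1 0 0 else vec3 0 0 1)"

lemma swap12_mult: "swap12 *v p = vec3 (p $ 2) (p $ 1) (p $ 3)"
  by (simp add: cvec_eq_iff matrix_vector_mult_def swap12_def sum_3)

lemma regular_swap12: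
  "regular_on_cone s \<Longrightarrow> regular_on_cone (\<lambda>(p, l). s (swap12 *v p, swap12 *v l))"
  by (rule regular_matrix)
    (auto simp: flag_cone_iff swap12_mult vec3_eq_0_iff cvec_eq_iff algebra_simps)

text \<open>The cubic parts of the components \<open>x\<close> and \<open>y\<close> must be \<open>a Z(a, b)\<close> and \<open>b Z(a, b)\<close> with the same \<open>Z\<close>, up to sign the
  third quadratic form: the combination \<open>b x - a y\<close> is the section at the bounded point \<open>p = (b, -a, 0)\<close>, so its terms of
  degree 4 cancel.\<close>

lemma regular_chart_normal_form:
  assumes s: "regular_on_cone s"
  shows "\<exists>A B C. \<forall>p1 p2 a b. p1 \<noteq> 0 \<or> p2 \<noteq> 0 \<longrightarrow>
     s (vec3 p1 p2 (- (p1 * a + p2 * b)), vec3 a b 1) = 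
     normal_form A B C (vec3 p1 p2 (- (p1 * a + p2 * b)), vec3 a b 1)"
proof -
  define x where "x a b = s (vec3 1 0 (- a), vec3 a b 1)" for a b
  define y where "y a b = s (vec3 0 1 (- b), vec3 a b 1)" for a b
  obtain A0 A1 A2 A3 A4 A5 C0 C1 C2 where x: "\<And>a b. x a b =
     A0 + A1 * a + A2 * b + A3 * a\<^sup>2 + A4 * a * b + A5 * b\<^sup>2 + a * (C0 * a\<^sup>2 + C1 * a * b + C2 * b\<^sup>2)"
    using regular_chart_cubic[OF s x_def] by blast
  have y_def': "y b a = (\<lambda>(p, l). s (swap12 *v p, swap12 *v l)) (vec3 1 0 (- a), vec3 a b 1)" for a b
    by (simp add: y_def swap12_mult)
  obtain B0 B1 B2 B3 B4 B5 D0 D1 D2 where y: "\<And>a b. y b a =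
     B0 + B1 * a + B2 * b + B3 * a\<^sup>2 + B4 * a * b + B5 * b\<^sup>2 + a * (D0 * a\<^sup>2 + D1 * a * b + D2 * b\<^sup>2)"
    using regular_chart_cubic[OF regular_swap12[OF s], of "\<lambda>a b. y b a", OF y_def'] by blast
  have chart: "s (vec3 p1 p2 (- (p1 * a + p2 * b)), vec3 a b 1) = p1 * x a b + p2 * y a b" 
    if "p1 \<noteq> 0 \<or> p2 \<noteq> 0" for p1 p2 a b
    using regular_chart_linear[OF s that] by (simp add: x_def y_def)
  \<comment> \<open>The lines \<open>u \<mapsto> (u, u b)\<close> through the origin suffice to compare the two cubic parts.\<close>
  have top: "b * (C0 + C1 * b + C2 * b\<^sup>2) = b * (D0 * b\<^sup>2 + D1 * b + D2)" for b
  proof -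
    define f where "f u = u * b * x u (u * b) - u * y u (u * b)" for u
    define h where "h e = s (vec3 b (- 1) 0, vec3 1 b e)" for e
    have "\<exists>c. \<forall>u. f u = (\<Sum>i\<le>3. c i * u ^ i)"
    proof (rule two_chart_polynomial)
      show "f holomorphic_on UNIV"
        unfolding f_def x y by (intro holomorphic_intros)
      show "h holomorphic_on UNIV" unfolding h_def 
        by (intro regular_holomorphic[OF s]) (auto intro!: holomorphic_intros simp: flag_cone_iff vec3_eq_0_iff)
      show "f t = t ^ 3 * h (1 / t)" if "t \<noteq> 0" for t
      proof -
        have "f t = s (vec3 (t * b) (- t) 0, vec3 t (t * b) 1)"
          using chart[of "t * b" "- t" t "t * b"] that by (simp add: f_def algebra_simps)
        also have "\<dots> = t ^ 3 * h (1 / t)"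
          unfolding h_def
          using regular_scale'[OF s, of "vec3 b (- 1) 0" "vec3 1 b (1 / t)" t t "vec3 (t * b) (- t) 0" "vec3 t (t * b) 1"] that
          by (simp add: flag_cone_iff vec3_eq_0_iff scale_vec3 power3_eq_cube power2_eq_square)
        finally show ?thesis .
      qed
    qed
    then obtain k where k: "\<And>u. f u = (\<Sum>i\<le>3. k i * u ^ i)" by blast
    define k' where "k' i = (if i \<le> 3 then k i else 0)" for i
    define m where "m = (\<lambda>i. [0, b * A0 - B0, b * (A1 + A2 * b) - (B1 * b + B2),
       b * (A3 + A4 * b + A5 * b\<^sup>2) - (B3 * b\<^sup>2 + B4 * b + B5),
       b * (C0 + C1 * b + C2 * b\<^sup>2) - b * (D0 * b\<^sup>2 + D1 * b + D2)] ! i)"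
    have sum4: "(\<Sum>i\<le>4. n i * u ^ i) = n 0 + n 1 * u + n 2 * u^2 + n 3 * u^3 + n 4 * u^4" for n :: "nat \<Rightarrow> complex" and u
      by (simp add: numeral_eq_Suc)
    have m: "m 0 = 0" "m 1 = b * A0 - B0" "m 2 = b * (A1 + A2 * b) - (B1 * b + B2)"
       "m 3 = b * (A3 + A4 * b + A5 * b\<^sup>2) - (B3 * b\<^sup>2 + B4 * b + B5)"
       "m 4 = b * (C0 + C1 * b + C2 * b\<^sup>2) - b * (D0 * b\<^sup>2 + D1 * b + D2)"
      by (simp_all add: m_def)
    have "(\<Sum>i\<le>4. m i * u ^ i) = (\<Sum>i\<le>4. k' i * u ^ i)" for u
    proof -
      have "(\<Sum>i\<le>4. m i * u ^ i) = f u"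
        unfolding f_def x y sum4 m by algebra
      also have "\<dots> = (\<Sum>i\<le>4. k' i * u ^ i)"
        unfolding k k'_def sum4 by (simp add: numeral_eq_Suc)
      finally show ?thesis .
    qed
    then have "\<forall>i\<le>4. m i = k' i"
      using polyfun_eq_coeffs[of m 4 k'] by blast
    then have "m 4 = k' 4" by auto
    then show ?thesis unfolding m k'_def by auto
  qed
  have D: "D2 = C0" "D1 = C1" "D0 = C2"
  proof -
    have "C0 + C1 + C2 = D0 + D1 + D2" "C0 - C1 + C2 = D0 - D1 + D2" "2 * (C0 + C1 * 2 + C2 * 4) = 2 * (D0 * 4 + D1 * 2 + D2)"
      using top[of 1] top[of "-1"] top[of 2] by (auto simp: power2_eq_square algebra_simps)
    then show "D2 = C0" "D1 = C1" "D0 = C2" by algebra+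
  qed
  define A where "A = (\<lambda>i. [A0, A1, A2, A3, A4, A5] ! i)"
  define B where "B = (\<lambda>i. [B0, B2, B1, B5, B4, B3] ! i)"
  define C where "C = (\<lambda>i. [- C0, - C1, - C2] ! i)"
  have co: "A 0 = A0" "A 1 = A1" "A 2 = A2" "A 3 = A3" "A 4 = A4" "A 5 = A5"
       "B 0 = B0" "B 1 = B2" "B 2 = B1" "B 3 = B5" "B 4 = B4" "B 5 = B3"
       "C 0 = - C0" "C 1 = - C1" "C 2 = - C2"
    by (simp_all add: A_def B_def C_def)
  have "s (vec3 p1 p2 (- (p1 * a + p2 * b)), vec3 a b 1) = 
     normal_form A B C (vec3 p1 p2 (- (p1 * a + p2 * b)), vec3 a b 1)" if "p1 \<noteq> 0 \<or> p2 \<noteq> 0" for p1 p2 a b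
    unfolding chart[OF that] x y D normal_form_def prod.case vec3_nth co
    by (simp add: power2_eq_square algebra_simps)
  then show ?thesis by blast
qed

text \<open>For \<open>l\<^sub>3 \<noteq> 0\<close> the chart applies; the points with \<open>l\<^sub>3 = 0\<close> are limits of such points inside the bicone.\<close>

lemma regular_normal_form:
  assumes s: "regular_on_cone s"
  shows "\<exists>A B C. \<forall>z\<in>flag_cone. s z = normal_form A B C z"
proof -
  obtain A B C where chart: "\<And>p1 p2 a b. p1 \<noteq> 0 \<or> p2 \<noteq> 0 \<Longrightarrow>
     s (vec3 p1 p2 (- (p1 * a + p2 * b)), vec3 a b 1) = 
     normal_form A B C (vec3 p1 p2 (- (p1 * a + p2 * b)), vec3 a b 1)"
    using regular_chart_normal_form[OF s] by blast
  have generic: "s (p, l) = normal_form A B C (p, l)" if "(p, l) \<in> flag_cone" "l $ 3 \<noteq> 0" for p l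
  proof -
    have p3: "p $ 3 = - (p $ 1 * (l $ 1 / l $ 3) + p $ 2 * (l $ 2 / l $ 3))"
      using that by (simp add: flag_cone_iff field_simps add_eq_0_iff)
    have nz: "p $ 1 \<noteq> 0 \<or> p $ 2 \<noteq> 0"
      using that p3 by (auto simp: flag_cone_iff cvec_eq_iff)
    have p: "p = vec3 (p $ 1) (p $ 2) (- (p $ 1 * (l $ 1 / l $ 3) + p $ 2 * (l $ 2 / l $ 3)))"
      using p3 by (simp add: cvec_eq_iff)
    define l' where "l' = vec3 (l $ 1 / l $ 3) (l $ 2 / l $ 3) 1"
    have l: "l = (l $ 3) *s l'"
      using that by (simp add: cvec_eq_iff l'_def)
    have "(p, l') \<in> flag_cone"
      using that p3 by (simp add: flag_cone_iff l'_def vec3_eq_0_iff)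
    then have "s (p, l) = (l $ 3)\<^sup>2 * s (p, l')"
      using regular_scale'[OF s, of p l' 1 "l $ 3" p l] l that by simp
    also have "s (p, l') = normal_form A B C (p, l')"
      using chart[OF nz, of "l $ 1 / l $ 3" "l $ 2 / l $ 3"] p by (simp add: l'_def)
    also have "(l $ 3)\<^sup>2 * normal_form A B C (p, l') = normal_form A B C (p, (l $ 3) *s l')"
      unfolding normal_form_def by (simp add: power2_eq_square algebra_simps)
    finally show ?thesis using l by simp
  qed
  have "s (p, l) = normal_form A B C (p, l)" if z: "(p, l) \<in> flag_cone" for p l
  proof (cases "l $ 3 = 0")
    case False
    then show ?thesis using generic z by blast
  next
    case True
    \<comment> \<open>The vector \<open>w\<close> satisfies \<open>w \<bullet> l = 1\<close>. Moving \<open>l\<^sub>3\<close> to \<open>e\<close> and \<open>p\<close> to \<open>p - e p\<^sub>3 w\<close> keeps \<open>p \<bullet> l = 0\<close>.\<close>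
    define w1 where "w1 = (if l $ 1 = 0 then 0 else 1 / l $ 1)"
    define w2 where "w2 = (if l $ 1 = 0 then 1 / l $ 2 else 0)"
    have w: "w1 * l $ 1 + w2 * l $ 2 = 1"
      using True z by (auto simp: w1_def w2_def flag_cone_iff cvec_eq_iff)
    define P where "P e = vec3 (p $ 1 - e * p $ 3 * w1) (p $ 2 - e * p $ 3 * w2) (p $ 3)" for e
    define Q where "Q e = vec3 (l $ 1) (l $ 2) e" for e
    define D where "D = {e. P e \<noteq> 0}"
    have PQ0: "P 0 = p" "Q 0 = l" using True by (auto simp: P_def Q_def cvec_eq_iff)
    have "\<forall>i. continuous_on UNIV (\<lambda>e. P e $ i)"
      by (simp add: forall_3 P_def) (intro conjI continuous_intros)
    then have "open {e. P e $ i \<noteq> 0}" for i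
      by (intro open_Collect_neq) auto
    moreover have "D = (\<Union>i. {e. P e $ i \<noteq> 0})"
      by (auto simp: D_def vec_eq_iff)
    ultimately have D: "open D" "0 \<in> D" using z PQ0 by (auto simp: D_def flag_cone_iff)
    have cone: "(P e, Q e) \<in> flag_cone" if "e \<in> D" for e
    proof -
      have "l $ 1 \<noteq> 0 \<or> l $ 2 \<noteq> 0" using w by auto
      moreover have "p $ 1 * l $ 1 + p $ 2 * l $ 2 = 0" using z True by (simp add: flag_cone_iff)
      then have "(p $ 1 - e * p $ 3 * w1) * l $ 1 + (p $ 2 - e * p $ 3 * w2) * l $ 2 + p $ 3 * e = 0"
        using w by algebra
      ultimately show ?thesis
        using that by (auto simp: D_def flag_cone_iff P_def Q_def vec3_eq_0_iff)
    qed
    have "s (P 0, Q 0) = normal_form A B C (P 0, Q 0)"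
    proof (rule eq_at_puncture[OF _ _ D])
      show "continuous_on D (\<lambda>e. s (P e, Q e))" 
        unfolding P_def Q_def
        by (intro holomorphic_on_imp_continuous_on regular_holomorphic[OF s] D holomorphic_intros
          cone[unfolded P_def Q_def])
      show "continuous_on D (\<lambda>e. normal_form A B C (P e, Q e))" 
        unfolding P_def Q_def
        by (intro holomorphic_on_imp_continuous_on holomorphic_normal_form holomorphic_intros)
      show "s (P e, Q e) = normal_form A B C (P e, Q e)" if "e \<in> D" "e \<noteq> 0" for e
        using generic[OF cone[OF that(1)]] that by (simp add: Q_def)
    qed
    then show ?thesis by (simp add: PQ0)
  qed
  then show ?thesis by fast
qed

section \<open>Unitary frames\<close>

definition conj_mat :: "complex ^ 3 ^ 3 \<Rightarrow> complex ^ 3 ^ 3" where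
  "conj_mat U = (\<chi> i j. cnj (U $ i $ j))"

text \<open>The columns of \<open>U\<close> are orthonormal for the Hermitian form \<open>pairing u (cnj_vec v)\<close>.\<close>

definition unitary :: "complex ^ 3 ^ 3 \<Rightarrow> bool" where
  "unitary U \<longleftrightarrow> transpose U ** conj_mat U = mat 1"

lemma conj_mat_mult: "conj_mat (A ** B) = conj_mat A ** conj_mat B"
  by (simp add: conj_mat_def matrix_matrix_mult_def vec_eq_iff)

lemma conj_mat_transpose: "conj_mat (transpose A) = transpose (conj_mat A)"
  by (simp add: conj_mat_def transpose_def)

lemma conj_mat_mat_1 [simp]: "conj_mat (mat 1) = mat 1"
  by (simp add: conj_mat_def mat_def vec_eq_iff)

lemma conj_mat_conj_mat [simp]: "conj_mat (conj_mat A) = A"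
  by (simp add: conj_mat_def vec_eq_iff)

lemma cnj_vec_mult: "cnj_vec (U *v a) = conj_mat U *v cnj_vec a"
  by (simp add: cnj_vec_def conj_mat_def matrix_vector_mult_def vec_eq_iff)

lemma pairing_mult: "pairing (A *v v) w = pairing v (transpose A *v w)"
  by (simp add: pairing3 matrix_vector_mult_def transpose_def sum_3 algebra_simps)

lemma unitary_pairing: "unitary U \<Longrightarrow> pairing (U *v y) (conj_mat U *v x) = pairing y x"
  by (simp add: pairing_mult unitary_def matrix_vector_mul_assoc)

lemma unitary_inverse:
  assumes "unitary U"
  shows "U *v (transpose (conj_mat U) *v p) = p" "conj_mat U *v (transpose U *v p) = p"
    "transpose U *v (conj_mat U *v p) = p" "transpose (conj_mat U) *v (U *v p) = p"
proof -
  have 1: "transpose U ** conj_mat U = mat 1" "conj_mat U ** transpose U = mat 1"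
    using assms by (auto simp: unitary_def matrix_left_right_inverse)
  have "transpose (conj_mat U) ** U = mat 1" "U ** transpose (conj_mat U) = mat 1"
    using arg_cong[OF 1(1), of conj_mat] arg_cong[OF 1(2), of conj_mat]
    by (simp_all add: conj_mat_mult conj_mat_transpose)
  with 1 show "U *v (transpose (conj_mat U) *v p) = p" "conj_mat U *v (transpose U *v p) = p"
    "transpose U *v (conj_mat U *v p) = p" "transpose (conj_mat U) *v (U *v p) = p"
    by (simp_all add: matrix_vector_mul_assoc del: transpose_matrix_vector)
qed

lemma unitary_mult_eq_0:
  assumes "unitary U"
  shows "U *v y = 0 \<longleftrightarrow> y = 0" "conj_mat U *v x = 0 \<longleftrightarrow> x = 0"
  using unitary_inverse[OF assms] by (metis matrix_vector_mult_0_right)+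

lemma unitary_flag_cone:
  assumes "unitary U"
  shows "(U *v y, conj_mat U *v x) \<in> flag_cone \<longleftrightarrow> (y, x) \<in> flag_cone"
  using unitary_pairing[OF assms] unitary_mult_eq_0[OF assms] by (simp add: flag_cone_def)

text \<open>As \<open>pairing\<close> is bilinear, the second factor has to be acted on by the conjugate matrix. Among the changes of coordinates
  of the flag threefold, the unitary ones respect the condition \<open>pairing p (cnj_vec q) = 0\<close>.\<close>

definition rot :: "complex ^ 3 ^ 3 \<Rightarrow> cvec \<times> cvec \<Rightarrow> cvec \<times> cvec" where
  "rot U = (\<lambda>(y, x). (U *v y, conj_mat U *v x))"

definition unrot :: "complex ^ 3 ^ 3 \<Rightarrow> cvec \<times> cvec \<Rightarrow> cvec \<times> cvec" where
  "unrot U = (\<lambda>(p, l). (transpose (conj_mat U) *v p, transpose U *v l))"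

lemma rot_unrot [simp]: "unitary U \<Longrightarrow> rot U (unrot U z) = z" "unitary U \<Longrightarrow> unrot U (rot U z) = z"
  by (auto simp: rot_def unrot_def case_prod_unfold unitary_inverse simp del: transpose_matrix_vector)

lemma rot_flag_cone [simp]: "unitary U \<Longrightarrow> rot U z \<in> flag_cone \<longleftrightarrow> z \<in> flag_cone"
  by (auto simp: rot_def case_prod_unfold unitary_flag_cone)

lemma unrot_flag_cone [simp]: "unitary U \<Longrightarrow> unrot U z \<in> flag_cone \<longleftrightarrow> z \<in> flag_cone"
  by (metis rot_flag_cone rot_unrot(1))

lemma regular_rot: "regular_on_cone s \<Longrightarrow> unitary U \<Longrightarrow> regular_on_cone (\<lambda>z. s (rot U z))"
  using regular_matrix[of s U "conj_mat U"] by (simp add: rot_def unitary_flag_cone case_prod_unfold)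

definition vanishes_on_fiber :: "(cvec \<times> cvec \<Rightarrow> complex) \<Rightarrow> cvec \<Rightarrow> bool" where
  "vanishes_on_fiber s q \<longleftrightarrow> (\<forall>p l. (p, l) \<in> flag_cone \<longrightarrow> pairing p (cnj_vec q) = 0 \<longrightarrow>
     pairing q l = 0 \<longrightarrow> s (p, l) = 0)"

text \<open>Twistor fibers are permuted by unitary matrices in the way their points \<open>q\<close> are.\<close>

lemma vanishes_on_fiber_rot:
  assumes "unitary U"
  shows "vanishes_on_fiber s (U *v a) \<longleftrightarrow> vanishes_on_fiber (\<lambda>z. s (rot U z)) a"
proof
  assume L: "vanishes_on_fiber s (U *v a)"
  show "vanishes_on_fiber (\<lambda>z. s (rot U z)) a"
    using L unitary_flag_cone[OF assms] unitary_pairing[OF assms]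
    unfolding vanishes_on_fiber_def rot_def cnj_vec_mult by auto
next
  assume R: "vanishes_on_fiber (\<lambda>z. s (rot U z)) a"
  show "vanishes_on_fiber s (U *v a)"
    unfolding vanishes_on_fiber_def
  proof (intro allI impI)
    fix p l assume pl: "(p, l) \<in> flag_cone" "pairing p (cnj_vec (U *v a)) = 0" "pairing (U *v a) l = 0"
    define y where "y = transpose (conj_mat U) *v p"
    define x where "x = transpose U *v l"
    have p: "p = U *v y" and l: "l = conj_mat U *v x"
      using unitary_inverse[OF assms] by (simp_all add: y_def x_def)
    show "s (p, l) = 0"
      using R pl unitary_flag_cone[OF assms] unitary_pairing[OF assms]
      unfolding vanishes_on_fiber_def p l cnj_vec_mult rot_def by auto
  qed
qed

lemma vanishes_on_fiber_scale:
  assumes "c \<noteq> 0"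
  shows "vanishes_on_fiber s (c *s q) \<longleftrightarrow> vanishes_on_fiber s q"
proof -
  have "pairing p (cnj_vec (c *s q)) = cnj c * pairing p (cnj_vec q)" "pairing (c *s q) l = c * pairing q l" for p l
    by (simp_all add: pairing3 algebra_simps)
  then show ?thesis using assms by (simp add: vanishes_on_fiber_def)
qed

definition from_columns :: "cvec \<Rightarrow> cvec \<Rightarrow> cvec \<Rightarrow> complex ^ 3 ^ 3" where
  "from_columns e1 e2 e3 = (\<chi> i. vec3 (e1 $ i) (e2 $ i) (e3 $ i))"

lemma from_columns_mult: "from_columns e1 e2 e3 *v y = y$1 *s e1 + y$2 *s e2 + y$3 *s e3"
  by (simp add: from_columns_def matrix_vector_mult_def cvec_eq_iff sum_3 mult.commute)

lemma from_columns_nth: "from_columns e1 e2 e3 $ i $ 1 = e1 $ i" "from_columns e1 e2 e3 $ i $ 2 = e2 $ i"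
  "from_columns e1 e2 e3 $ i $ 3 = e3 $ i"
  by (simp_all add: from_columns_def)

lemma pairing_cnj_commute: "pairing v (cnj_vec u) = cnj (pairing u (cnj_vec v))"
  by (simp add: pairing3 mult.commute)

lemma unitary_from_columns:
  assumes "pairing e1 (cnj_vec e1) = 1" "pairing e2 (cnj_vec e2) = 1" "pairing e3 (cnj_vec e3) = 1"
    "pairing e1 (cnj_vec e2) = 0" "pairing e1 (cnj_vec e3) = 0" "pairing e2 (cnj_vec e3) = 0"
  shows "unitary (from_columns e1 e2 e3)"
proof -
  have sym: "pairing e2 (cnj_vec e1) = 0" "pairing e3 (cnj_vec e1) = 0" "pairing e3 (cnj_vec e2) = 0"
    using assms pairing_cnj_commute[of e2 e1] pairing_cnj_commute[of e3 e1] pairing_cnj_commute[of e3 e2] by auto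
  show ?thesis
    using assms sym
    by (simp add: unitary_def vec_eq_iff forall_3 matrix_matrix_mult_def transpose_def conj_mat_def mat_def
        sum_3 from_columns_nth pairing3)
qed

lemma unit_multiple:
  assumes "u \<noteq> 0"
  obtains r where "r \<noteq> 0" "pairing (r *s u) (cnj_vec (r *s u)) = 1"
proof -
  define N where "N = (cmod (u$1))\<^sup>2 + (cmod (u$2))\<^sup>2 + (cmod (u$3))\<^sup>2"
  have N: "pairing u (cnj_vec u) = complex_of_real N"
    by (simp add: pairing3 N_def complex_norm_square del: of_real_power)
  have "u$1 \<noteq> 0 \<or> u$2 \<noteq> 0 \<or> u$3 \<noteq> 0" using assms by (simp add: cvec_eq_iff)
  then have "N > 0" unfolding N_def
    by (elim disjE) (simp_all add: add_pos_nonneg add_nonneg_pos)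
  define r where "r = complex_of_real (1 / sqrt N)"
  have "pairing (r *s u) (cnj_vec (r *s u)) = r * r * pairing u (cnj_vec u)"
    by (simp add: pairing3 r_def algebra_simps)
  also have "r * r = complex_of_real (1 / N)"
    using \<open>N > 0\<close> unfolding r_def of_real_mult[symmetric] by (simp add: field_simps)
  finally have "pairing (r *s u) (cnj_vec (r *s u)) = 1" using N \<open>N > 0\<close> by simp
  moreover have "r \<noteq> 0" using \<open>N > 0\<close> by (simp add: r_def)
  ultimately show ?thesis using that by blast
qed

text \<open>Gram--Schmidt for \<open>u\<close> and \<open>v\<close>; the third vector is the conjugate of the cross product of the first two.\<close>

lemma orthonormal_triple:
  assumes u: "u \<noteq> 0" and v: "\<And>c. v \<noteq> c *s u"
  obtains e1 e2 e3 a b c where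
    "pairing e1 (cnj_vec e1) = 1" "pairing e2 (cnj_vec e2) = 1" "pairing e3 (cnj_vec e3) = 1"
    "pairing e1 (cnj_vec e2) = 0" "pairing e1 (cnj_vec e3) = 0" "pairing e2 (cnj_vec e3) = 0"
    "a \<noteq> 0" "c \<noteq> 0" "u = a *s e1" "v = b *s e1 + c *s e2"
proof -
  obtain r where r: "r \<noteq> 0" "pairing (r *s u) (cnj_vec (r *s u)) = 1" using unit_multiple[OF u] .
  define e1 where "e1 = r *s u"
  define b where "b = pairing v (cnj_vec e1)"
  define w where "w = v - b *s e1"
  have "w \<noteq> 0" using v[of "b * r"] by (auto simp: w_def e1_def vector_smult_assoc)
  then obtain r' where r': "r' \<noteq> 0" "pairing (r' *s w) (cnj_vec (r' *s w)) = 1" using unit_multiple by blast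
  define e2 where "e2 = r' *s w"
  have 1: "pairing e1 (cnj_vec e1) = 1" "pairing e2 (cnj_vec e2) = 1" using r r' by (simp_all add: e1_def e2_def)
  have "pairing w (cnj_vec e1) = b - b * pairing e1 (cnj_vec e1)"
    by (simp add: w_def pairing3 algebra_simps b_def)
  then have "pairing w (cnj_vec e1) = 0" using 1 by simp
  moreover have "pairing e2 (cnj_vec e1) = r' * pairing w (cnj_vec e1)"
    by (simp add: e2_def pairing3 algebra_simps)
  ultimately have "pairing e2 (cnj_vec e1) = 0" by simp
  then have 2: "pairing e1 (cnj_vec e2) = 0" using pairing_cnj_commute[of e1 e2] by simp
  define e3 where "e3 = cnj_vec (vec3 (e1$2 * e2$3 - e1$3 * e2$2) (e1$3 * e2$1 - e1$1 * e2$3) (e1$1 * e2$2 - e1$2 * e2$1))"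
  have 3: "pairing e1 (cnj_vec e3) = 0" "pairing e2 (cnj_vec e3) = 0"
    by (simp_all add: e3_def pairing3 algebra_simps)
  have "pairing e3 (cnj_vec e3) = pairing e1 (cnj_vec e1) * pairing e2 (cnj_vec e2) 
      - pairing e1 (cnj_vec e2) * cnj (pairing e1 (cnj_vec e2))"
    by (simp add: e3_def pairing3 algebra_simps)
  then have 4: "pairing e3 (cnj_vec e3) = 1" using 1 2 by simp
  have "u = (1 / r) *s e1" "v = b *s e1 + (1 / r') *s e2"
    using r r' by (simp_all add: e1_def e2_def vector_smult_assoc w_def)
  then show ?thesis using that[OF 1 4 2 3, of "1 / r" "1 / r'" b] r r' by simp
qed

lemma unitary_frame_plane:
  assumes "u \<noteq> 0" "\<And>c. v \<noteq> c *s u"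
  obtains U a b c where "unitary U" "a \<noteq> 0" "c \<noteq> 0" "u = U *v vec3 a 0 0" "v = U *v vec3 b c 0"
proof -
  obtain e1 e2 e3 a b c where e: "pairing e1 (cnj_vec e1) = 1" "pairing e2 (cnj_vec e2) = 1" "pairing e3 (cnj_vec e3) = 1"
    "pairing e1 (cnj_vec e2) = 0" "pairing e1 (cnj_vec e3) = 0" "pairing e2 (cnj_vec e3) = 0"
    "a \<noteq> 0" "c \<noteq> 0" "u = a *s e1" "v = b *s e1 + c *s e2" using orthonormal_triple[OF assms] .
  show ?thesis
    using that[OF unitary_from_columns[OF e(1-6)], of a c b] e by (simp add: from_columns_mult)
qed

lemma unitary_frame_point:
  assumes "u \<noteq> 0"
  obtains U a where "unitary U" "a \<noteq> 0" "u = U *v vec3 0 0 a"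
proof -
  obtain v where v: "\<And>c. v \<noteq> c *s u"
  proof (cases "u $ 1 = 0")
    case True
    then show ?thesis using that[of "vec3 1 0 0"] by (auto simp: cvec_eq_iff)
  next
    case False
    show ?thesis
      by (rule that[of "if u $ 2 = 0 then vec3 0 1 0 else vec3 (u $ 1) 0 0"])
        (use False in \<open>auto simp: cvec_eq_iff\<close>)
  qed
  obtain e1 e2 e3 a b c where e: "pairing e1 (cnj_vec e1) = 1" "pairing e2 (cnj_vec e2) = 1" "pairing e3 (cnj_vec e3) = 1"
    "pairing e1 (cnj_vec e2) = 0" "pairing e1 (cnj_vec e3) = 0" "pairing e2 (cnj_vec e3) = 0"
    "a \<noteq> 0" "c \<noteq> 0" "u = a *s e1" "v = b *s e1 + c *s e2" using orthonormal_triple[OF assms v] .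
  have "unitary (from_columns e2 e3 e1)"
    using e pairing_cnj_commute[of e2 e1] pairing_cnj_commute[of e3 e1] by (intro unitary_from_columns) auto
  then show ?thesis using that[of "from_columns e2 e3 e1" a] e by (simp add: from_columns_mult)
qed

section \<open>Points, closed sets and irreducibility\<close>

lemma pt_eq_iff:
  assumes "p \<noteq> 0" "p' \<noteq> 0"
  shows "pt p = pt p' \<longleftrightarrow> (\<exists>c. c \<noteq> 0 \<and> p' = c *s p)"
proof -
  have refl: "v \<noteq> 0 \<and> (\<exists>c. c \<noteq> 0 \<and> v = c *s v)" if "v \<noteq> 0" for v :: cvec
    using that by (auto intro!: exI[of _ 1])
  show ?thesis
    using Quotient3_rel[OF Quotient3_cp2, of p p'] refl[OF assms(1)] refl[OF assms(2)] assms by blast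
qed

lemma pt_cases:
  obtains p where "p \<noteq> 0" "x = pt p"
  using Quotient3_abs_rep[OF Quotient3_cp2, of x] Quotient3_rep_reflp[OF Quotient3_cp2, of x] by metis

lemma bihom_zero_well_defined:
  assumes "P \<in> bihom a b" "p \<noteq> 0" "l \<noteq> 0" "p' \<noteq> 0" "l' \<noteq> 0" "pt p = pt p'" "pt l = pt l'"
  shows "P (p, l) = 0 \<longleftrightarrow> P (p', l') = 0"
proof -
  obtain \<alpha> \<beta> where "\<alpha> \<noteq> 0" "p' = \<alpha> *s p" "\<beta> \<noteq> 0" "l' = \<beta> *s l"
    using assms(2-) pt_eq_iff by metis
  then show ?thesis using bihom_scaling[OF assms(1)] by simp
qed

definition basic_open :: "(cvec \<times> cvec \<Rightarrow> complex) \<Rightarrow> (cp2 \<times> cp2) set" where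
  "basic_open P = {(pt p, pt l) | p l. p \<noteq> 0 \<and> l \<noteq> 0 \<and> P (p, l) \<noteq> 0}"

lemma mem_basic_open:
  assumes "P \<in> bihom a b" "p \<noteq> 0" "l \<noteq> 0"
  shows "(pt p, pt l) \<in> basic_open P \<longleftrightarrow> P (p, l) \<noteq> 0"
proof
  assume "(pt p, pt l) \<in> basic_open P"
  then obtain p' l' where "pt p = pt p'" "pt l = pt l'" "p' \<noteq> 0" "l' \<noteq> 0" "P (p', l') \<noteq> 0"
    unfolding basic_open_def by blast
  then show "P (p, l) \<noteq> 0"
    using bihom_zero_well_defined[OF assms, of p' l'] by simp
qed (use assms in \<open>auto simp: basic_open_def\<close>)

definition vanishing_set :: "(cvec \<times> cvec \<Rightarrow> complex) \<Rightarrow> (cp2 \<times> cp2) set" where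
  "vanishing_set P = {(pt p, pt l) | p l. p \<noteq> 0 \<and> l \<noteq> 0 \<and> P (p, l) = 0}"

lemma mem_vanishing_set:
  assumes "P \<in> bihom a b" "p \<noteq> 0" "l \<noteq> 0"
  shows "(pt p, pt l) \<in> vanishing_set P \<longleftrightarrow> P (p, l) = 0"
proof
  assume "(pt p, pt l) \<in> vanishing_set P"
  then obtain p' l' where "pt p = pt p'" "pt l = pt l'" "p' \<noteq> 0" "l' \<noteq> 0" "P (p', l') = 0"
    unfolding vanishing_set_def by blast
  then show "P (p, l) = 0"
    using bihom_zero_well_defined[OF assms, of p' l'] by simp
qed (use assms in \<open>auto simp: vanishing_set_def\<close>)

lemma topspace_zariski [simp]: "topspace zariski = UNIV"
proof -
  have "x \<in> topspace zariski" for x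
  proof -
    obtain p l where pl: "p \<noteq> 0" "l \<noteq> 0" "x = (pt p, pt l)"
      by (metis pt_cases surj_pair)
    have "x \<in> {(pt p, pt l) | p l. p \<noteq> 0 \<and> l \<noteq> 0 \<and> (\<lambda>_. 1 :: complex) (p, l) \<noteq> 0}"
      using pl by auto
    then show ?thesis
      unfolding zariski_def topology_generated_by_topspace using bihom_const[of 1] by blast
  qed
  then show ?thesis by auto
qed

lemma closedin_vanishing_set:
  assumes "P \<in> bihom a b"
  shows "closedin zariski (vanishing_set P)"
proof -
  have "UNIV - vanishing_set P = basic_open P"
  proof (rule set_eqI)
    fix x
    obtain p l where pl: "p \<noteq> 0" "l \<noteq> 0" "x = (pt p, pt l)" by (metis pt_cases surj_pair)
    show "x \<in> UNIV - vanishing_set P \<longleftrightarrow> x \<in> basic_open P"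
      using mem_vanishing_set[OF assms pl(1,2)] mem_basic_open[OF assms pl(1,2)] by (simp add: pl(3))
  qed
  moreover have "openin zariski (basic_open P)"
    unfolding zariski_def basic_open_def by (rule topology_generated_by_Basis) (use assms in blast)
  ultimately show ?thesis by (simp add: closedin_def)
qed

lemma mem_zero_locus:
  assumes "s \<in> sections a b" "(p, l) \<in> flag_cone"
  shows "(pt p, pt l) \<in> zero_locus s \<longleftrightarrow> s (p, l) = 0"
proof
  assume "(pt p, pt l) \<in> zero_locus s"
  then obtain p' l' where z: "pt p = pt p'" "pt l = pt l'" "(p', l') \<in> flag_cone" "s (p', l') = 0"
    by (auto simp: zero_locus_def)
  then obtain \<alpha> \<beta> where "\<alpha> \<noteq> 0" "p' = \<alpha> *s p" "\<beta> \<noteq> 0" "l' = \<beta> *s l"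
    using assms(2) pt_eq_iff by (metis flag_cone_iff)
  then show "s (p, l) = 0"
    using sections_scale[OF assms] z by simp
qed (use assms in \<open>auto simp: zero_locus_def\<close>)

lemma fiber_subset_zero_locus_iff:
  assumes "s \<in> sections a b"
  shows "twistor_fiber q \<subseteq> zero_locus s \<longleftrightarrow> vanishes_on_fiber s q"
  unfolding vanishes_on_fiber_def twistor_fiber_def
  using mem_zero_locus[OF assms] by blast

text \<open>Irreducibility is used only through products of bihomogeneous polynomials.\<close>

lemma irreducible_factor:
  assumes s: "s \<in> sections a b" and irr: "irreducible_in zariski (zero_locus s)"
    and P: "P \<in> bihom c d" and Q: "Q \<in> bihom c' d'"
    and PQ: "\<And>z. z \<in> flag_cone \<Longrightarrow> s z = 0 \<Longrightarrow> P z = 0 \<or> Q z = 0"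
  shows "(\<forall>z\<in>flag_cone. s z = 0 \<longrightarrow> P z = 0) \<or> (\<forall>z\<in>flag_cone. s z = 0 \<longrightarrow> Q z = 0)"
proof -
  have nz: "p \<noteq> 0 \<and> l \<noteq> 0" if "(p, l) \<in> flag_cone" for p l using that by (simp add: flag_cone_iff)
  have "zero_locus s \<subseteq> vanishing_set P \<union> vanishing_set Q"
    using PQ nz unfolding zero_locus_def vanishing_set_def by blast
  then have "zero_locus s \<subseteq> vanishing_set P \<or> zero_locus s \<subseteq> vanishing_set Q"
    using irr closedin_vanishing_set[OF P] closedin_vanishing_set[OF Q] unfolding irreducible_in_def by blast
  moreover have "\<forall>z\<in>flag_cone. s z = 0 \<longrightarrow> R z = 0" if "zero_locus s \<subseteq> vanishing_set R" "R \<in> bihom e f" for R e f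
  proof (intro ballI impI)
    fix z assume z: "z \<in> flag_cone" "s z = 0"
    obtain p l where pl: "z = (p, l)" by force
    then have "(pt p, pt l) \<in> vanishing_set R" using that(1) z by (auto simp: zero_locus_def)
    then show "R z = 0" using mem_vanishing_set[OF that(2)] nz z pl by blast
  qed
  ultimately show ?thesis using P Q by blast
qed

text \<open>The vanishing over \<open>x\<^sub>3 = 0\<close> says that \<open>(X, Y, Z)\<close> is proportional to \<open>x\<close> there, by a linear factor
  \<open>A\<^sub>3 x\<^sub>1 + A\<^sub>4 x\<^sub>2\<close>. That part of the section equals \<open>(A\<^sub>3 x\<^sub>1 + A\<^sub>4 x\<^sub>2) (y\<^sub>1 x\<^sub>1 + y\<^sub>2 x\<^sub>2) = - (A\<^sub>3 x\<^sub>1 + A\<^sub>4 x\<^sub>2) y\<^sub>3 x\<^sub>3\<close>.\<close>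

lemma normal_form_divisible:
  assumes "\<And>z. z \<in> flag_cone \<Longrightarrow> f z = normal_form A B C z"
    and "\<And>y x. (y, x) \<in> flag_cone \<Longrightarrow> x $ 3 = 0 \<Longrightarrow> f (y, x) = 0"
    and yx: "(y, x) \<in> flag_cone"
  shows "f (y, x) = x$3 * (y$1 * (A 0 * x$3 + A 1 * x$1 + A 2 * x$2) + y$2 * (B 0 * x$3 + B 1 * x$1 + B 2 * x$2)
      - y$3 * (A 3 * x$1 + A 4 * x$2))"
proof -
  have v: "normal_form A B C (vec3 y1 y2 y3, vec3 x1 x2 0) = 0" 
    if "y1 \<noteq> 0 \<or> y2 \<noteq> 0 \<or> y3 \<noteq> 0" "x1 \<noteq> 0 \<or> x2 \<noteq> 0" "y1 * x1 + y2 * x2 = 0" for y1 y2 y3 x1 x2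
    using assms(1)[of "(vec3 y1 y2 y3, vec3 x1 x2 0)"] assms(2)[of "vec3 y1 y2 y3" "vec3 x1 x2 0"] that
    by (simp add: flag_cone_iff vec3_eq_0_iff)
  have "C 0 = 0" "C 2 = 0" using v[of 0 0 1 1 0] v[of 0 0 1 0 1] by (simp_all add: normal_form_def)
  moreover have "C 0 + C 1 + C 2 = 0" using v[of 0 0 1 1 1] by (simp add: normal_form_def)
  ultimately have C: "C 0 = 0" "C 1 = 0" "C 2 = 0" by simp_all
  have AB: "B 3 = 0" "A 5 = 0" using v[of 0 1 0 1 0] v[of 1 0 0 0 1] by (simp_all add: normal_form_def)
  have "(A 3 + A 4) - (B 4 + B 5) = 0" "(A 3 - A 4) + (B 5 - B 4) * 1 = 0"
    using v[of 1 "-1" 0 1 1] v[of 1 1 0 1 "-1"] AB by (simp_all add: normal_form_def algebra_simps)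
  then have AB': "B 4 = A 3" "B 5 = A 4" by algebra+
  have "y$1*x$1+y$2*x$2+y$3*x$3 = 0" using yx by (simp add: flag_cone_iff)
  then show ?thesis
    unfolding assms(1)[OF yx] normal_form_def prod.case AB AB' C by algebra
qed

lemma unrot_bihom:
  "(\<lambda>z. fst (unrot U z) $ i) \<in> bihom 1 0" "(\<lambda>z. snd (unrot U z) $ i) \<in> bihom 0 1"
  unfolding unrot_def case_prod_unfold fst_conv snd_conv
  by (rule bihom_fst_linear bihom_snd_linear)+

text \<open>Write the section as \<open>x\<^sub>3 R\<close>. The surface is not contained in \<open>x\<^sub>3 = 0\<close>, so irreducibility makes \<open>R\<close> vanish on it, in
  particular on its part over \<open>x\<^sub>3 = 0\<close>. Then \<open>R = x\<^sub>3 m\<close> with \<open>m\<close> linear in \<open>p\<close>, and by the same argument \<open>m\<close> vanishes over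
  \<open>x\<^sub>3 = 0\<close>, which forces \<open>m = 0\<close>.\<close>

lemma not_irreducible_if_contains_preimage_of_line:
  assumes s: "s \<in> linear_system 1 2" and irr: "irreducible_in zariski (zero_locus s)"
    and U: "unitary U"
    and van: "\<And>y x. (y, x) \<in> flag_cone \<Longrightarrow> x $ 3 = 0 \<Longrightarrow> s (rot U (y, x)) = 0"
  shows False
proof -
  have sec: "s \<in> sections 1 2" and "s \<noteq> 0" using s by (auto simp: linear_system_def)
  define f where "f z = s (rot U z)" for z
  obtain A B C where nf: "\<And>z. z \<in> flag_cone \<Longrightarrow> f z = normal_form A B C z"
    using regular_normal_form[OF regular_rot[OF sections_regular[OF sec] U]] unfolding f_def by blast
  define R where "R = (\<lambda>(y :: cvec, x :: cvec). y$1 * (A 0 * x$3 + A 1 * x$1 + A 2 * x$2) + y$2 * (B 0 * x$3 + B 1 * x$1 + B 2 * x$2)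
      + (- y$3) * (A 3 * x$1 + A 4 * x$2))"
  define m where "m = (\<lambda>(y :: cvec, x :: cvec). A 0 * y$1 + B 0 * y$2 + (- A 1) * y$3)"
  have fR: "f (y, x) = x$3 * R (y, x)" if "(y, x) \<in> flag_cone" for y x
    using normal_form_divisible[OF nf, of y x] van that by (simp add: f_def R_def)
  have bx: "(\<lambda>z. snd (unrot U z) $ 3) \<in> bihom 0 1" by (rule unrot_bihom)
  have "(\<lambda>z. R (unrot U z)) \<in> bihom (1 + 0) (0 + 1)"
  proof -
    note lin = unrot_bihom[of U]
    have ny3: "(\<lambda>z. - (fst (unrot U z) $ 3)) \<in> bihom 1 0"
      using bihom_scale[OF lin(1)[of 3], of "-1"] by simp
    show ?thesis unfolding R_def case_prod_unfold
      by (intro bihom_add bihom_mult bihom_scale lin ny3)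
  qed
  note bR = this
  have bm: "(\<lambda>z. m (unrot U z)) \<in> bihom 1 0"
    unfolding m_def case_prod_unfold by (intro bihom_add bihom_scale unrot_bihom)
  have unrot_f: "s z = f (unrot U z)" "z \<in> flag_cone \<longleftrightarrow> unrot U z \<in> flag_cone" for z 
    using U by (simp_all add: f_def)
  have factor: "(\<forall>z\<in>flag_cone. f z = 0 \<longrightarrow> P z = 0)"
    if "(\<lambda>z. P (unrot U z)) \<in> bihom c d" "\<And>y x. (y, x) \<in> flag_cone \<Longrightarrow> f (y, x) = 0 \<Longrightarrow> x $ 3 = 0 \<or> P (y, x) = 0" for P c d
  proof -
    have "(\<forall>z\<in>flag_cone. s z = 0 \<longrightarrow> snd (unrot U z) $ 3 = 0) \<or> (\<forall>z\<in>flag_cone. s z = 0 \<longrightarrow> P (unrot U z) = 0)"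
    proof (rule irreducible_factor[OF sec irr bx that(1)])
      fix z assume "z \<in> flag_cone" "s z = 0"
      then show "snd (unrot U z) $ 3 = 0 \<or> P (unrot U z) = 0"
        using that(2)[of "fst (unrot U z)" "snd (unrot U z)"] unrot_f by simp
    qed
    \<comment> \<open>Over \<open>x = (0, 0, 1)\<close> the section is the linear form \<open>A\<^sub>0 y\<^sub>1 + B\<^sub>0 y\<^sub>2\<close>, which has a zero.\<close>
    moreover obtain z where "z \<in> flag_cone" "f z = 0" "snd z $ 3 \<noteq> 0"
    proof
      define y where "y = (if A 0 = 0 \<and> B 0 = 0 then vec3 1 0 0 else vec3 (- B 0) (A 0) 0)"
      have y: "y \<noteq> 0" "y $ 3 = 0" "A 0 * y$1 + B 0 * y$2 = 0" by (auto simp: y_def vec3_eq_0_iff)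
      show "(y, vec3 0 0 1) \<in> flag_cone" using y by (simp add: flag_cone_iff vec3_eq_0_iff)
      then show "f (y, vec3 0 0 1) = 0" using fR y by (simp add: R_def mult.commute)
    qed simp
    then have "rot U z \<in> flag_cone" "s (rot U z) = 0" "snd (unrot U (rot U z)) $ 3 \<noteq> 0"
      using U by (simp_all add: f_def)
    ultimately have *: "\<forall>z\<in>flag_cone. s z = 0 \<longrightarrow> P (unrot U z) = 0" by blast
    show ?thesis
    proof (intro ballI impI)
      fix z assume "z \<in> flag_cone" "f z = 0"
      then show "P z = 0" using *[rule_format, of "rot U z"] U by (simp add: f_def)
    qed
  qed
  have fR0: "f z = 0 \<longrightarrow> R z = 0" if "z \<in> flag_cone" for z
    using factor[OF bR] fR that by auto
  have R0: "R (y, x) = 0" if "(y, x) \<in> flag_cone" "x $ 3 = 0" for y x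
    using fR0[OF that(1)] fR[OF that(1)] that by simp
  have v: "R (vec3 y1 y2 y3, vec3 x1 x2 0) = 0" 
    if "y1 \<noteq> 0 \<or> y2 \<noteq> 0 \<or> y3 \<noteq> 0" "x1 \<noteq> 0 \<or> x2 \<noteq> 0" "y1 * x1 + y2 * x2 = 0" for y1 y2 y3 x1 x2
    using R0[of "vec3 y1 y2 y3" "vec3 x1 x2 0"] that by (simp add: flag_cone_iff vec3_eq_0_iff)
  have A34: "A 3 = 0" "A 4 = 0" using v[of 0 0 1 1 0] v[of 0 0 1 0 1] by (simp_all add: R_def)
  have B1: "B 1 = 0" "A 2 = 0" using v[of 0 1 0 1 0] v[of 1 0 0 0 1] by (simp_all add: R_def)
  have B2: "B 2 = A 1" using v[of 1 "-1" 0 1 1] B1 by (simp add: R_def)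
  have Rm: "R (y, x) = x$3 * m (y, x)" if "(y, x) \<in> flag_cone" for y x
  proof -
    have "y$1*x$1+y$2*x$2+y$3*x$3 = 0" using that by (simp add: flag_cone_iff)
    then show ?thesis unfolding R_def m_def prod.case A34 B1 B2 by algebra
  qed
  have fm0: "f z = 0 \<longrightarrow> m z = 0" if "z \<in> flag_cone" for z
    using factor[OF bm] fR Rm that by auto
  have m0: "m (y, x) = 0" if "(y, x) \<in> flag_cone" "x $ 3 = 0" for y x
    using fm0[OF that(1)] fR[OF that(1)] that by simp
  have "A 0 = 0" "B 0 = 0" "A 1 = 0"
    using m0[of "vec3 1 0 0" "vec3 0 1 0"] m0[of "vec3 0 1 0" "vec3 1 0 0"] m0[of "vec3 0 0 1" "vec3 1 0 0"]
    by (simp_all add: flag_cone_iff vec3_eq_0_iff m_def)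
  then have "f z = 0" if "z \<in> flag_cone" for z
    using fR Rm that by (cases z) (simp add: m_def)
  then have "s z = 0" if "z \<in> flag_cone" for z
    using unrot_f that by simp
  moreover have "s z = 0" if "z \<notin> flag_cone" for z
    using sec that by (cases z) (auto simp: sections_def)
  ultimately have "s = 0" by (auto simp: fun_eq_iff)
  with \<open>s \<noteq> 0\<close> show False by simp
qed

section \<open>Four fibers over points that are not collinear\<close>

lemma binary_quadratic_zero:
  fixes c0 c1 c2 :: complex
  assumes "c0 * b1\<^sup>2 - c1 * a1 * b1 + c2 * a1\<^sup>2 = 0" "c0 * b2\<^sup>2 - c1 * a2 * b2 + c2 * a2\<^sup>2 = 0"
    "c0 * b3\<^sup>2 - c1 * a3 * b3 + c2 * a3\<^sup>2 = 0"
    and "a1 * b2 - a2 * b1 \<noteq> 0" "a1 * b3 - a3 * b1 \<noteq> 0" "a2 * b3 - a3 * b2 \<noteq> 0"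
  shows "c0 = 0 \<and> c1 = 0 \<and> c2 = 0"
proof -
  define d where "d = (a1 * b2 - a2 * b1) * (a1 * b3 - a3 * b1) * (a2 * b3 - a3 * b2)"
  have "c0 * d = 0" "c1 * d = 0" "c2 * d = 0"
    using assms(1-3) unfolding d_def by algebra+
  then show ?thesis using assms(4-) by (simp add: d_def)
qed

text \<open>Here \<open>q = (0, 0, 1)\<close>. Over the line \<open>x\<^sub>3 = 0\<close> its fiber is \<open>y\<^sub>3 = 0\<close>, so the section restricts to \<open>y\<^sub>3 Z(x\<^sub>1, x\<^sub>2)\<close>.
  The fiber of \<open>(a, b, c)\<close> meets the preimage of this line in a point with \<open>x = (- b, a, 0)\<close> and \<open>y\<^sub>3 \<noteq> 0\<close>,
  which is a zero of \<open>Z\<close>. The assumption on determinants makes the three zeros different.\<close>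

lemma four_fibers_contain_preimage_of_line:
  assumes s: "regular_on_cone s" and e: "vanishes_on_fiber s (vec3 0 0 1)"
    and v: "vanishes_on_fiber s (vec3 a1 b1 c1)" "vanishes_on_fiber s (vec3 a2 b2 c2)" "vanishes_on_fiber s (vec3 a3 b3 c3)"
    and d: "a1 * b2 - a2 * b1 \<noteq> 0" "a1 * b3 - a3 * b1 \<noteq> 0" "a2 * b3 - a3 * b2 \<noteq> 0"
    and yx: "(y, x) \<in> flag_cone" "x $ 3 = 0"
  shows "s (y, x) = 0"
proof -
  obtain A B C where nf: "\<And>z. z \<in> flag_cone \<Longrightarrow> s z = normal_form A B C z"
    using regular_normal_form[OF s] by blast
  have E: "- x2 * (A 3 * x1\<^sup>2 + A 4 * x1 * x2 + A 5 * x2\<^sup>2) + x1 * (B 3 * x1\<^sup>2 + B 4 * x1 * x2 + B 5 * x2\<^sup>2) = 0"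
    if "x1 \<noteq> 0 \<or> x2 \<noteq> 0" for x1 x2
  proof -
    have cone: "(vec3 (- x2) x1 0, vec3 x1 x2 0) \<in> flag_cone"
      using that by (auto simp: flag_cone_iff vec3_eq_0_iff)
    have "s (vec3 (- x2) x1 0, vec3 x1 x2 0) = 0"
      using e cone unfolding vanishes_on_fiber_def by (simp add: pairing3)
    then show ?thesis using nf[OF cone] by (simp add: normal_form_def)
  qed
  have AB: "B 3 = 0" "A 5 = 0" using E[of 1 0] E[of 0 1] by simp_all
  have "(B 4 + B 5) - (A 3 + A 4) = 0" "(A 3 - A 4) + (B 5 - B 4) = 0"
    using E[of 1 1] E[of 1 "-1"] AB by (simp_all add: algebra_simps)
  then have AB': "B 4 = A 3" "B 5 = A 4" by algebra+
  have nf3: "s (y, x) = y$3 * (C 0 * (x$1)\<^sup>2 + C 1 * x$1 * x$2 + C 2 * (x$2)\<^sup>2)"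
    if "(y, x) \<in> flag_cone" "x $ 3 = 0" for y x
  proof -
    have "y$1*x$1+y$2*x$2 = 0" using that by (simp add: flag_cone_iff)
    then show ?thesis using that(2) unfolding nf[OF that(1)] normal_form_def prod.case AB AB' by algebra
  qed
  have Z: "C 0 * b\<^sup>2 - C 1 * a * b + C 2 * a\<^sup>2 = 0" if v: "vanishes_on_fiber s (vec3 a b c)" and "a \<noteq> 0 \<or> b \<noteq> 0" for a b c
  proof -
    define y where "y = vec3 (cnj c * a) (cnj c * b) (- (a * cnj a + b * cnj b))"
    have y3: "y $ 3 \<noteq> 0"
      unfolding y_def vec3_nth neg_equal_0_iff_equal by (rule hermitian_norm_nonzero[OF that(2)])
    then have cone: "(y, vec3 (- b) a 0) \<in> flag_cone"
      using that(2) by (auto simp: flag_cone_iff vec3_eq_0_iff cvec_eq_iff[of y] y_def)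
    then have "s (y, vec3 (- b) a 0) = 0"
      using v unfolding vanishes_on_fiber_def by (simp add: pairing3 y_def algebra_simps)
    then show ?thesis using nf3[OF cone] y3 by (simp add: ac_simps)
  qed
  have "C 0 = 0 \<and> C 1 = 0 \<and> C 2 = 0"
    by (rule binary_quadratic_zero[OF Z[OF v(1)] Z[OF v(2)] Z[OF v(3)] d]) (use d in auto)
  then show ?thesis using nf3[OF yx] by simp
qed

definition det3 :: "cvec \<Rightarrow> cvec \<Rightarrow> cvec \<Rightarrow> complex" where
  "det3 u v w = u$1 * (v$2 * w$3 - v$3 * w$2) - u$2 * (v$1 * w$3 - v$3 * w$1) + u$3 * (v$1 * w$2 - v$2 * w$1)"

lemma det3_mult: "det3 (M *v u) (M *v v) (M *v w) = 
    det3 (M *v vec3 1 0 0) (M *v vec3 0 1 0) (M *v vec3 0 0 1) * det3 u v w"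
  by (simp add: det3_def matrix_vector_mult_def sum_3) algebra

text \<open>The determinants express that the lines from \<open>q\<close> to the other three points are different.\<close>

lemma not_irreducible_if_three_lines_through_point:
  assumes s: "s \<in> linear_system 1 2" and irr: "irreducible_in zariski (zero_locus s)"
    and v: "vanishes_on_fiber s q" "vanishes_on_fiber s q1" "vanishes_on_fiber s q2" "vanishes_on_fiber s q3"
    and d: "det3 q q1 q2 \<noteq> 0" "det3 q q1 q3 \<noteq> 0" "det3 q q2 q3 \<noteq> 0"
  shows False
proof -
  have "q \<noteq> 0" using d(1) by (auto simp: det3_def)
  then obtain U a where U: "unitary U" "a \<noteq> 0" "q = U *v vec3 0 0 a" using unitary_frame_point by blast
  define t where "t i = transpose (conj_mat U) *v i" for i
  have t: "U *v t i = i" for i by (simp add: t_def unitary_inverse[OF U(1)] del: transpose_matrix_vector)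
  define f where "f = (\<lambda>z. s (rot U z))"
  have vf: "vanishes_on_fiber s i \<Longrightarrow> vanishes_on_fiber f (t i)" for i
    using vanishes_on_fiber_rot[OF U(1), of s "t i"] unfolding f_def t by simp
  have detn: "(t i) $ 1 * (t j) $ 2 - (t j) $ 1 * (t i) $ 2 \<noteq> 0" if "det3 q i j \<noteq> 0" for i j
    using that det3_mult[of U "vec3 0 0 a" "t i" "t j"] unfolding t U(3)[symmetric] by (auto simp: det3_def)
  have "vec3 0 0 a = a *s vec3 0 0 1" by (simp add: scale_vec3)
  then have e: "vanishes_on_fiber f (vec3 0 0 1)"
    using v(1) vanishes_on_fiber_rot[OF U(1), of s "vec3 0 0 a"] vanishes_on_fiber_scale[OF U(2), of f] U(3)
    by (simp add: f_def)
  have reg: "regular_on_cone f"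
    unfolding f_def using s U by (intro regular_rot sections_regular) (auto simp: linear_system_def)
  have "f (y, x) = 0" if "(y, x) \<in> flag_cone" "x $ 3 = 0" for y x
    by (rule four_fibers_contain_preimage_of_line[OF reg e,
          of "t q1 $ 1" "t q1 $ 2" "t q1 $ 3" "t q2 $ 1" "t q2 $ 2" "t q2 $ 3" "t q3 $ 1" "t q3 $ 2" "t q3 $ 3"])
      (use vf v detn d that in \<open>auto simp: vec3_eta\<close>)
  then show False
    using not_irreducible_if_contains_preimage_of_line[OF s irr U(1)] by (auto simp: f_def)
qed

definition non_proportional :: "cvec \<Rightarrow> cvec \<Rightarrow> bool" where
  "non_proportional u v \<longleftrightarrow> u \<noteq> 0 \<and> v \<noteq> 0 \<and> (\<forall>c. v \<noteq> c *s u)"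

text \<open>If \<open>q\<^sub>1, q\<^sub>2, q\<^sub>3\<close> are a basis, at least two coordinates of \<open>q\<^sub>4\<close> are nonzero. The basis vector of the remaining
  coordinate is then a point whose lines to the other three points are different.\<close>

lemma four_fibers_over_collinear_points:
  assumes s: "s \<in> linear_system 1 2" and irr: "irreducible_in zariski (zero_locus s)"
    and v: "vanishes_on_fiber s q1" "vanishes_on_fiber s q2" "vanishes_on_fiber s q3" "vanishes_on_fiber s q4"
    and np: "non_proportional q1 q4" "non_proportional q2 q4" "non_proportional q3 q4"
  shows "det3 q1 q2 q3 = 0"
proof (rule ccontr)
  assume D: "det3 q1 q2 q3 \<noteq> 0"
  define \<alpha> where "\<alpha> = det3 q4 q2 q3 / det3 q1 q2 q3"
  define \<beta> where "\<beta> = det3 q1 q4 q3 / det3 q1 q2 q3"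
  define \<gamma> where "\<gamma> = det3 q1 q2 q4 / det3 q1 q2 q3"
  have "det3 q1 q2 q3 *s q4 = det3 q4 q2 q3 *s q1 + det3 q1 q4 q3 *s q2 + det3 q1 q2 q4 *s q3"
    by (simp add: cvec_eq_iff det3_def) algebra
  then have "(1 / det3 q1 q2 q3) *s (det3 q1 q2 q3 *s q4) = \<alpha> *s q1 + \<beta> *s q2 + \<gamma> *s q3"
    by (simp add: \<alpha>_def \<beta>_def \<gamma>_def vector_add_ldistrib vector_smult_assoc)
  then have q4: "q4 = \<alpha> *s q1 + \<beta> *s q2 + \<gamma> *s q3" using D by (simp add: vector_smult_assoc)
  have ab: "\<not> (\<alpha> = 0 \<and> \<beta> = 0)" "\<not> (\<alpha> = 0 \<and> \<gamma> = 0)" "\<not> (\<beta> = 0 \<and> \<gamma> = 0)"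
    using np q4 by (auto simp: non_proportional_def)
  have swap: "det3 v u w = - det3 u v w" and swap': "det3 u w v = - det3 u v w" and cyc: "det3 w u v = det3 u v w" for u v w
    by (simp_all add: det3_def algebra_simps)
  have dets: "det3 q1 q2 q4 = \<gamma> * det3 q1 q2 q3" "det3 q1 q3 q4 = - (\<beta> * det3 q1 q2 q3)" "det3 q2 q3 q4 = \<alpha> * det3 q1 q2 q3"
    using D swap'[of q1 q4 q3] cyc[of q4 q2 q3] by (simp_all add: \<alpha>_def \<beta>_def \<gamma>_def)
  consider "\<alpha> \<noteq> 0" "\<beta> \<noteq> 0" | "\<alpha> \<noteq> 0" "\<gamma> \<noteq> 0" | "\<beta> \<noteq> 0" "\<gamma> \<noteq> 0" using ab by blast
  then show False
  proof cases
    case 1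
    then have "det3 q3 q1 q2 \<noteq> 0" "det3 q3 q1 q4 \<noteq> 0" "det3 q3 q2 q4 \<noteq> 0"
      unfolding cyc[of q3 q1 q2] swap[of q3 q1 q4] swap[of q3 q2 q4] dets using D by simp_all
    then show False
      using not_irreducible_if_three_lines_through_point[OF s irr v(3,1,2,4)] by blast
  next
    case 2
    then have "det3 q2 q1 q3 \<noteq> 0" "det3 q2 q1 q4 \<noteq> 0" "det3 q2 q3 q4 \<noteq> 0"
      unfolding swap[of q2 q1 q3] swap[of q2 q1 q4] dets using D by simp_all
    then show False
      using not_irreducible_if_three_lines_through_point[OF s irr v(2,1,3,4)] by blast
  next
    case 3
    then have "det3 q1 q2 q4 \<noteq> 0" "det3 q1 q3 q4 \<noteq> 0"
      unfolding dets using D by simp_all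
    then show False
      using not_irreducible_if_three_lines_through_point[OF s irr v(1,2,3,4)] D by blast
  qed
qed

section \<open>Geometry of twistor fibers\<close>

lemma pairing_cnj_self_nonzero:
  assumes "q \<noteq> 0"
  shows "pairing q (cnj_vec q) \<noteq> 0"
proof -
  obtain r where "pairing (r *s q) (cnj_vec (r *s q)) = 1" using unit_multiple[OF assms] by blast
  moreover have "pairing (r *s q) (cnj_vec (r *s q)) = r * cnj r * pairing q (cnj_vec q)"
    by (simp add: pairing3 algebra_simps)
  ultimately show ?thesis by auto
qed

definition cross :: "cvec \<Rightarrow> cvec \<Rightarrow> cvec" where
  "cross u v = vec3 (u$2 * v$3 - u$3 * v$2) (u$3 * v$1 - u$1 * v$3) (u$1 * v$2 - u$2 * v$1)"

lemma cross_eq_0_imp_multiple: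
  assumes "cross u v = 0" "u \<noteq> 0"
  obtains c where "v = c *s u"
proof -
  obtain i where i: "u $ i \<noteq> 0" using assms(2) by (auto simp: vec_eq_iff)
  have "v = (v $ i / u $ i) *s u"
    using exhaust_3[of i] i assms(1) by (auto simp: cvec_eq_iff cross_def field_simps)
  then show ?thesis using that by blast
qed

lemma cross_on_fiber:
  assumes "q \<noteq> 0" "l \<noteq> 0" "pairing q l = 0"
  shows "(cross l (cnj_vec q), l) \<in> flag_cone" "pairing (cross l (cnj_vec q)) (cnj_vec q) = 0"
proof -
  have "cross l (cnj_vec q) \<noteq> 0"
  proof
    assume "cross l (cnj_vec q) = 0"
    then obtain c where c: "cnj_vec q = c *s l" using cross_eq_0_imp_multiple assms(2) by blast
    have "pairing q (cnj_vec q) = c * pairing q l" unfolding c by (simp add: pairing3 algebra_simps)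
    then show False using assms pairing_cnj_self_nonzero by simp
  qed
  then show "(cross l (cnj_vec q), l) \<in> flag_cone"
    using assms by (simp add: flag_cone_iff cross_def algebra_simps)
  show "pairing (cross l (cnj_vec q)) (cnj_vec q) = 0"
    by (simp add: pairing3 cross_def algebra_simps)
qed

text \<open>The section of the second projection that parametrizes the fiber of \<open>q\<close> over the line \<open>q \<bullet> l = 0\<close>.\<close>

lemma twistor_fiber_graph:
  assumes "q \<noteq> 0"
  shows "twistor_fiber q = (\<lambda>l. (pt (cross l (cnj_vec q)), pt l)) ` {l. l \<noteq> 0 \<and> pairing q l = 0}"
proof (intro set_eqI iffI)
  fix x assume "x \<in> twistor_fiber q"
  then obtain p l where x: "x = (pt p, pt l)" "(p, l) \<in> flag_cone" "pairing p (cnj_vec q) = 0" "pairing q l = 0"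
    by (auto simp: twistor_fiber_def)
  have l: "l \<noteq> 0" and p: "p \<noteq> 0" and pl: "pairing p l = 0" using x(2) by (auto simp: flag_cone_def)
  have "cross p (cross l (cnj_vec q)) = pairing p (cnj_vec q) *s l - pairing p l *s cnj_vec q"
    by (simp add: cross_def pairing3 cvec_eq_iff algebra_simps)
  then have "cross p (cross l (cnj_vec q)) = 0" using x pl by simp
  then obtain c where c: "cross l (cnj_vec q) = c *s p" using cross_eq_0_imp_multiple p by blast
  have nz: "cross l (cnj_vec q) \<noteq> 0" using cross_on_fiber(1)[OF assms l x(4)] by (simp add: flag_cone_iff)
  then have "c \<noteq> 0" using c by auto
  then have "pt p = pt (cross l (cnj_vec q))" using pt_eq_iff[OF p nz] c by blast
  then show "x \<in> (\<lambda>l. (pt (cross l (cnj_vec q)), pt l)) ` {l. l \<noteq> 0 \<and> pairing q l = 0}"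
    using x l by auto
next
  fix x assume "x \<in> (\<lambda>l. (pt (cross l (cnj_vec q)), pt l)) ` {l. l \<noteq> 0 \<and> pairing q l = 0}"
  then show "x \<in> twistor_fiber q" using cross_on_fiber[OF assms] by (auto simp: twistor_fiber_def)
qed

lemma continuous_on_vec3:
  assumes "continuous_on S a" "continuous_on S b" "continuous_on S c"
  shows "continuous_on S (\<lambda>t. vec3 (a t) (b t) (c t))"
proof -
  have "continuous_on S (\<lambda>t. if i = 1 then a t else if i = 2 then b t else c t)" for i :: 3
    using assms by (cases "i = 1"; cases "i = 2") simp_all
  then show ?thesis unfolding vec3_def by (rule continuous_on_vec_lambda)
qed

text \<open>Two points of a projective line are joined by the image of a segment between independent representatives,
  and bihomogeneous polynomials are continuous, so the segment is also connected in the Zariski topology.\<close>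

lemma connectedin_twistor_fiber:
  assumes "q \<noteq> 0"
  shows "connectedin zariski (twistor_fiber q)"
proof -
  define \<phi> where "\<phi> l = (pt (cross l (cnj_vec q)), pt l)" for l
  define K where "K = {l. l \<noteq> 0 \<and> pairing q l = 0}"
  have T: "twistor_fiber q = \<phi> ` K" using twistor_fiber_graph[OF assms] by (simp add: \<phi>_def[abs_def] K_def)
  have cone: "cross l (cnj_vec q) \<noteq> 0" if "l \<in> K" for l
    using cross_on_fiber(1)[OF assms] that by (auto simp: K_def flag_cone_iff)
  have K_scale: "\<phi> (c *s l) = \<phi> l" if "l \<in> K" "c \<noteq> 0" for c l
  proof -
    have "cross (c *s l) (cnj_vec q) = c *s cross l (cnj_vec q)" by (simp add: cross_def cvec_eq_iff algebra_simps)
    moreover have "pt (c *s v) = pt v" if "v \<noteq> 0" for v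
      using that \<open>c \<noteq> 0\<close> pt_eq_iff[of v "c *s v"] by auto
    ultimately show ?thesis using that cone by (simp add: \<phi>_def K_def)
  qed
  have join: "\<exists>S\<subseteq>\<phi> ` K. connectedin zariski S \<and> \<phi> l0 \<in> S \<and> \<phi> l1 \<in> S" if l01: "l0 \<in> K" "l1 \<in> K" for l0 l1
  proof (cases "\<exists>c. l1 = c *s l0")
    case True
    then obtain c where "l1 = c *s l0" by blast
    moreover from this have "c \<noteq> 0" using l01 by (auto simp: K_def)
    ultimately have "\<phi> l1 = \<phi> l0" using K_scale l01 by simp
    then show ?thesis using l01 by (intro exI[of _ "{\<phi> l0}"]) (auto simp: connectedin_sing)
  next
    case False
    define l where "l t = l0 + complex_of_real t *s (l1 - l0)" for t
    have lK: "l t \<in> K" for t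
    proof -
      have "pairing q (l t) = pairing q l0 + complex_of_real t * (pairing q l1 - pairing q l0)"
        by (simp add: l_def pairing3 algebra_simps)
      moreover have "l t \<noteq> 0"
      proof
        assume "l t = 0"
        then have e: "complex_of_real t *s l1 = (complex_of_real t - 1) *s l0"
          by (simp add: l_def cvec_eq_iff algebra_simps)
        show False
        proof (cases "t = 0")
          case True
          then show False using \<open>l t = 0\<close> l01 by (simp add: l_def K_def)
        next
          case False
          have "l1 = (1 / complex_of_real t) *s (complex_of_real t *s l1)"
            using False by (simp add: vector_smult_assoc)
          then have "l1 = ((1 / complex_of_real t) * (complex_of_real t - 1)) *s l0"
            unfolding e vector_smult_assoc .
          then show False using \<open>\<nexists>c. l1 = c *s l0\<close> by blast
        qed
      qed
      ultimately show ?thesis using l01 by (simp add: K_def)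
    qed
    have "continuous_map (top_of_set {0..1}) zariski (\<lambda>t. \<phi> (l t))"
      unfolding zariski_def
    proof (rule continuous_on_generated_topo)
      fix V assume "V \<in> {{(pt p, pt l) | p l. p \<noteq> 0 \<and> l \<noteq> 0 \<and> P (p, l) \<noteq> 0} | P a b. P \<in> bihom a b}"
      then obtain P a b where P: "P \<in> bihom a b" and V: "V = {(pt p, pt l) | p l. p \<noteq> 0 \<and> l \<noteq> 0 \<and> P (p, l) \<noteq> 0}"
        by blast
      have mem: "\<phi> (l t) \<in> V \<longleftrightarrow> P (cross (l t) (cnj_vec q), l t) \<noteq> 0" for t
        unfolding V \<phi>_def using bihom_zero_well_defined[OF P] cone[OF lK[of t]] lK[of t]
        by (auto simp: K_def)
      have "continuous_on {0..1} (\<lambda>t. (cross (l t) (cnj_vec q), l t))"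
      proof -
        have cont: "continuous_on {0..1} (\<lambda>t. l t $ i)" for i
          unfolding l_def by (simp, intro continuous_intros)
        have minor: "continuous_on {0..1} (\<lambda>t. l t $ i * cnj_vec q $ j - l t $ i' * cnj_vec q $ j')" for i j i' j'
          by (rule continuous_on_diff; rule continuous_on_mult; (rule cont | rule continuous_on_const))
        have "continuous_on {0..1} (\<lambda>t. cross (l t) (cnj_vec q))"
          unfolding cross_def by (rule continuous_on_vec3; rule minor)
        moreover have "continuous_on {0..1} (\<lambda>t. vec3 (l t $ 1) (l t $ 2) (l t $ 3))"
          by (rule continuous_on_vec3; rule cont)
        ultimately show ?thesis by (intro continuous_on_Pair) (simp_all add: vec3_eta)
      qed
      then have "continuous_on {0..1} (\<lambda>t. P (cross (l t) (cnj_vec q), l t))"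
        by (rule continuous_on_compose2[OF bihom_continuous[OF P, of UNIV]]) auto
      then have "openin (top_of_set {0..1}) ({0..1} \<inter> (\<lambda>t. P (cross (l t) (cnj_vec q), l t)) -` (- {0}))"
        by (intro continuous_openin_preimage_gen) auto
      moreover have "{0..1} \<inter> (\<lambda>t. P (cross (l t) (cnj_vec q), l t)) -` (- {0}) = (\<lambda>t. \<phi> (l t)) -` V \<inter> topspace (top_of_set {0..1})"
        by (intro set_eqI) (unfold Int_iff vimage_eq Compl_iff singleton_iff mem topspace_euclidean_subtopology, blast)
      ultimately show "openin (top_of_set {0..1}) ((\<lambda>t. \<phi> (l t)) -` V \<inter> topspace (top_of_set {0..1}))" by simp
    next
      show "(\<lambda>t. \<phi> (l t)) ` topspace (top_of_set {0..1}) \<subseteq>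
         \<Union> {{(pt p, pt l) | p l. p \<noteq> 0 \<and> l \<noteq> 0 \<and> P (p, l) \<noteq> 0} | P a b. P \<in> bihom a b}"
        using topspace_zariski unfolding zariski_def topology_generated_by_topspace by simp
    qed
    then have "connectedin zariski ((\<lambda>t. \<phi> (l t)) ` {0..1})"
      by (rule connectedin_continuous_map_image) (simp add: connectedin_subtopology)
    moreover have "l 0 = l0" "l 1 = l1" by (simp_all add: l_def)
    then have "\<phi> l0 \<in> (\<lambda>t. \<phi> (l t)) ` {0..1}" "\<phi> l1 \<in> (\<lambda>t. \<phi> (l t)) ` {0..1}"
      by (metis atLeastAtMost_iff imageI order_refl zero_le_one)+
    ultimately show ?thesis using lK by (intro exI[of _ "(\<lambda>t. \<phi> (l t)) ` {0..1}"]) blast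
  qed
  show ?thesis
  proof (cases "K = {}")
    case False
    then obtain l0 where l0: "l0 \<in> K" by blast
    define \<S> where "\<S> = {S. S \<subseteq> \<phi> ` K \<and> connectedin zariski S \<and> \<phi> l0 \<in> S}"
    have "connectedin zariski (\<Union>\<S>)"
      by (rule connectedin_Union) (auto simp: \<S>_def)
    moreover have "\<Union>\<S> = \<phi> ` K"
    proof
      show "\<phi> ` K \<subseteq> \<Union>\<S>"
      proof
        fix x assume "x \<in> \<phi> ` K"
        then obtain l1 where "l1 \<in> K" "x = \<phi> l1" by blast
        then show "x \<in> \<Union>\<S>" using join[OF l0 \<open>l1 \<in> K\<close>] unfolding \<S>_def by blast
      qed
    qed (auto simp: \<S>_def)
    ultimately show ?thesis by (simp add: T)
  qed (simp add: T)
qed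

lemma twistor_fiber_scale: "c \<noteq> 0 \<Longrightarrow> twistor_fiber (c *s q) = twistor_fiber q"
proof -
  assume c: "c \<noteq> 0"
  have "pairing p (cnj_vec (c *s q)) = cnj c * pairing p (cnj_vec q)" "pairing (c *s q) l = c * pairing q l" for p l
    by (simp_all add: pairing3 algebra_simps)
  then show ?thesis using c by (simp add: twistor_fiber_def)
qed

lemma twistor_fiber_snd:
  assumes "(pt p, pt l) \<in> twistor_fiber q" "l \<noteq> 0"
  shows "pairing q l = 0"
proof -
  obtain p' l' where "pt l = pt l'" "(p', l') \<in> flag_cone" "pairing q l' = 0"
    using assms(1) by (auto simp: twistor_fiber_def)
  moreover then obtain c where "c \<noteq> 0" "l' = c *s l" 
    using assms(2) pt_eq_iff by (metis flag_cone_iff)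
  ultimately have "c * pairing q l = 0" by (simp add: pairing3 algebra_simps)
  then show ?thesis using \<open>c \<noteq> 0\<close> by simp
qed

text \<open>The fiber of \<open>q\<close> projects onto the line \<open>q \<bullet> l = 0\<close>, which determines the point \<open>q\<close>.\<close>

lemma twistor_fiber_neq:
  assumes "non_proportional q q'"
  shows "twistor_fiber q \<noteq> twistor_fiber q'"
proof
  assume eq: "twistor_fiber q = twistor_fiber q'"
  have q: "q \<noteq> 0" using assms by (simp add: non_proportional_def)
  have l: "pairing q' l = 0" if ql: "pairing q l = 0" for l
  proof (cases "l = 0")
    case False
    have "(pt (cross l (cnj_vec q)), pt l) \<in> twistor_fiber q'"
      unfolding eq[symmetric] twistor_fiber_graph[OF q] using False ql by blast
    then show ?thesis using twistor_fiber_snd False by blast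
  qed (simp add: pairing3)
  have "cross q q' = 0"
    using l[of "vec3 (q$2) (- q$1) 0"] l[of "vec3 (q$3) 0 (- q$1)"] l[of "vec3 0 (q$3) (- q$2)"]
    by (simp add: pairing3 cross_def vec3_eq_0_iff algebra_simps)
  then obtain c where "q' = c *s q" using cross_eq_0_imp_multiple q by blast
  then show False using assms by (simp add: non_proportional_def)
qed

lemma non_proportional_if_fiber_neq:
  assumes "twistor_fiber q \<noteq> twistor_fiber q'" "q \<noteq> 0" "q' \<noteq> 0"
  shows "non_proportional q q'"
proof -
  have "q' \<noteq> c *s q" for c
  proof
    assume "q' = c *s q"
    moreover from this have "c \<noteq> 0" using assms by auto
    ultimately show False using twistor_fiber_scale assms by metis
  qed
  then show ?thesis using assms by (simp add: non_proportional_def)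
qed

section \<open>Sections that vanish on fibers over collinear points\<close>

text \<open>The fiber of \<open>(1, 0, 0)\<close> consists of \<open>y = (0, - t, u)\<close>, \<open>x = (0, u, t)\<close>, and that of \<open>(t, 1, 0)\<close> of
  \<open>y = (v, - v cnj t, u (1 + t cnj t))\<close>, \<open>x = (- u, t u, v)\<close>. The section restricts to cubic forms in the parameters. The coefficients of
  these cubic forms are the conditions; two fibers besides that of \<open>(1, 0, 0)\<close> make seven coefficients vanish, and two conditions per fiber remain.\<close>

lemma collinear_normal_form:
  assumes nf: "\<And>z. z \<in> flag_cone \<Longrightarrow> f z = normal_form A B C z"
    and v: "vanishes_on_fiber f (vec3 1 0 0)" "\<And>t. t \<in> {a, b} \<Longrightarrow> vanishes_on_fiber f (vec3 t 1 0)" "a \<noteq> b"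
  shows "A 0 = 0 \<and> B 0 = 0 \<and> B 2 = 0 \<and> B 5 = 0 \<and> C 0 = 0 \<and> C 1 = 0 \<and> C 2 = 0"
    and "vanishes_on_fiber f (vec3 t 1 0) \<longleftrightarrow>
      A 2 * t + B 1 * cnj t = A 1 \<and> A 3 - A 4 * t + A 5 * t\<^sup>2 = cnj t * (B 3 - B 4 * t)"
proof -
  have infinity: "- t * (B 0 * t\<^sup>2 + B 2 * u * t + B 5 * u\<^sup>2) + u * (C 2 * u\<^sup>2) = 0" if "t \<noteq> 0 \<or> u \<noteq> 0" for t u
  proof -
    have cone: "(vec3 0 (- t) u, vec3 0 u t) \<in> flag_cone"
      using that by (auto simp: flag_cone_iff vec3_eq_0_iff)
    then have "f (vec3 0 (- t) u, vec3 0 u t) = 0"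
      using v(1) unfolding vanishes_on_fiber_def by (simp add: pairing3)
    then show ?thesis using nf[OF cone] by (simp add: normal_form_def)
  qed
  have B: "B 0 = 0" "C 2 = 0" using infinity[of 1 0] infinity[of 0 1] by simp_all
  moreover have "B 2 + B 5 = 0" "B 5 - B 2 = 0" using infinity[of 1 1] infinity[of 1 "-1"] B by simp_all
  ultimately have B': "B 2 = 0" "B 5 = 0" by (auto simp: add_eq_0_iff)
  have N: "1 + t * cnj t \<noteq> 0" for t
    using hermitian_norm_nonzero[of 1 t] by simp
  have finite: "x3 * (A 0 * x3\<^sup>2 + (A 2 * t - A 1 + B 1 * cnj t) * x1 * x3 
      + (A 3 - A 4 * t + A 5 * t\<^sup>2 - cnj t * (B 3 - B 4 * t)) * x1\<^sup>2) + x1 * (1 + t * cnj t) * (C 0 - C 1 * t) * x1\<^sup>2 = 0"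
    if "vanishes_on_fiber f (vec3 t 1 0)" "x1 \<noteq> 0 \<or> x3 \<noteq> 0" for t x1 x3
  proof -
    have cone: "(vec3 x3 (- cnj t * x3) (x1 * (1 + t * cnj t)), vec3 (- x1) (t * x1) x3) \<in> flag_cone"
    proof -
      have "x3 * (- x1) + (- cnj t * x3) * (t * x1) + (x1 * (1 + t * cnj t)) * x3 = 0"
        by (simp add: algebra_simps)
      then show ?thesis using that N[of t] by (auto simp: flag_cone_iff vec3_eq_0_iff)
    qed
    then have "f (vec3 x3 (- cnj t * x3) (x1 * (1 + t * cnj t)), vec3 (- x1) (t * x1) x3) = 0"
      using that(1) unfolding vanishes_on_fiber_def by (simp add: pairing3)
    then have "normal_form A B C (vec3 x3 (- cnj t * x3) (x1 * (1 + t * cnj t)), vec3 (- x1) (t * x1) x3) = 0"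
      using nf[OF cone] by simp
    then show ?thesis unfolding normal_form_def prod.case vec3_nth B B' by algebra
  qed
  have A0: "A 0 = 0" using finite[of a 0 1] v(2) by simp
  have C: "C 0 = C 1 * t" if "t \<in> {a, b}" for t
    using finite[of t 1 0] v(2)[OF that] N[of t] by simp
  have C1: "C 1 = 0" using C[of a] C[of b] v(3) by auto
  then have C0: "C 0 = 0" using C[of a] by simp
  show "A 0 = 0 \<and> B 0 = 0 \<and> B 2 = 0 \<and> B 5 = 0 \<and> C 0 = 0 \<and> C 1 = 0 \<and> C 2 = 0"
    using A0 B B' C0 C1 by simp
  show "vanishes_on_fiber f (vec3 t 1 0) \<longleftrightarrow>
      A 2 * t + B 1 * cnj t = A 1 \<and> A 3 - A 4 * t + A 5 * t\<^sup>2 = cnj t * (B 3 - B 4 * t)"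
  proof
    assume L: "vanishes_on_fiber f (vec3 t 1 0)"
    show "A 2 * t + B 1 * cnj t = A 1 \<and> A 3 - A 4 * t + A 5 * t\<^sup>2 = cnj t * (B 3 - B 4 * t)"
      using finite[OF L, of 1 1] finite[OF L, of "-1" 1] unfolding A0 C0 C1 by (simp, algebra)
  next
    assume R: "A 2 * t + B 1 * cnj t = A 1 \<and> A 3 - A 4 * t + A 5 * t\<^sup>2 = cnj t * (B 3 - B 4 * t)"
    show "vanishes_on_fiber f (vec3 t 1 0)"
      unfolding vanishes_on_fiber_def
    proof (intro allI impI)
      fix y x assume cone: "(y, x) \<in> flag_cone" and "pairing y (cnj_vec (vec3 t 1 0)) = 0" "pairing (vec3 t 1 0) x = 0"
      then have y2: "y$2 = - cnj t * y$1" and x2: "x$2 = - t * x$1"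
        by (simp_all add: pairing3 add_eq_0_iff mult.commute)
      have A13: "A 1 = A 2 * t + B 1 * cnj t" "A 3 = A 4 * t - A 5 * t\<^sup>2 + cnj t * (B 3 - B 4 * t)"
        using R by (simp_all add: algebra_simps)
      show "f (y, x) = 0"
        unfolding nf[OF cone] normal_form_def prod.case A0 B B' C0 C1 y2 x2 A13
        by (simp add: algebra_simps power2_eq_square)
    qed
  qed
qed

lemma quadratic_three_zeros:
  fixes c0 c1 c2 :: complex
  assumes "\<And>t. t \<in> {a, b, c} \<Longrightarrow> c0 + c1 * t + c2 * t\<^sup>2 = 0" "a \<noteq> b" "a \<noteq> c" "b \<noteq> c"
  shows "c0 = 0 \<and> c1 = 0 \<and> c2 = 0"
  using binary_quadratic_zero[of c0 1 "- c1" a c2 1 b 1 c] assms by (simp add: algebra_simps)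

text \<open>Newton interpolation; the sign of \<open>c1\<close> is the one that the second component of \<open>x = (- u, t u, v)\<close> produces.\<close>

lemma quadratic_interpolation:
  fixes v :: "complex \<Rightarrow> complex"
  assumes "a \<noteq> b" "a \<noteq> c" "b \<noteq> c"
  obtains c0 c1 c2 where "\<And>t. t \<in> {a, b, c} \<Longrightarrow> c0 - c1 * t + c2 * t\<^sup>2 = v t"
proof -
  define d where "d = (v b - v a) / (b - a)"
  define e where "e = ((v c - v a) / (c - a) - d) / (c - b)"
  have d: "d * (b - a) = v b - v a" using assms by (simp add: d_def)
  have "e * (c - b) = (v c - v a) / (c - a) - d" using assms by (simp add: e_def)
  then have "e * (c - b) * (c - a) = v c - v a - d * (c - a)" using assms by (simp add: field_simps)
  then have "v a + d * (t - a) + e * (t - a) * (t - b) = v t" if "t \<in> {a, b, c}" for t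
    using that d by (auto simp: algebra_simps)
  then have "(v a - d * a + e * a * b) - (e * (a + b) - d) * t + e * t\<^sup>2 = v t" if "t \<in> {a, b, c}" for t
    using that by (force simp: algebra_simps power2_eq_square)
  then show ?thesis using that by blast
qed

text \<open>On the real line through \<open>a, b, c\<close> one has \<open>cnj t = \<kappa> t + \<tau>\<close>. After this substitution the two conditions
  of \<open>collinear_normal_form\<close> are polynomial equations in \<open>t\<close> of degree at most 2 with the solutions \<open>a, b, c\<close>, so they are identities.\<close>

lemma fibers_along_circle:
  assumes f: "regular_on_cone f"
    and v: "vanishes_on_fiber f (vec3 1 0 0)" "\<And>t. t \<in> {a, b, c} \<Longrightarrow> vanishes_on_fiber f (vec3 t 1 0)"
    and ne: "a \<noteq> b" "a \<noteq> c" "b \<noteq> c" and real: "(c - a) / (b - a) \<in> \<real>"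
  shows "vanishes_on_fiber f (vec3 (a + of_real r * (b - a)) 1 0)"
proof -
  obtain A B C where nf: "\<And>z. z \<in> flag_cone \<Longrightarrow> f z = normal_form A B C z"
    using regular_normal_form[OF f] by blast
  have iff: "vanishes_on_fiber f (vec3 t 1 0) \<longleftrightarrow>
      A 2 * t + B 1 * cnj t = A 1 \<and> A 3 - A 4 * t + A 5 * t\<^sup>2 = cnj t * (B 3 - B 4 * t)" for t
    by (rule collinear_normal_form(2)[OF nf v(1), of a b t]) (use v ne in auto)
  define \<kappa> where "\<kappa> = cnj (b - a) / (b - a)"
  define \<tau> where "\<tau> = cnj a - \<kappa> * a"
  have \<kappa>: "\<kappa> * (b - a) = cnj (b - a)" using ne by (simp add: \<kappa>_def)
  have line: "cnj (a + of_real r * (b - a)) = \<kappa> * (a + of_real r * (b - a)) + \<tau>" for r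
  proof -
    have "\<kappa> * (a + of_real r * (b - a)) + \<tau> = of_real r * (\<kappa> * (b - a)) + cnj a"
      by (simp add: \<tau>_def algebra_simps)
    then show ?thesis unfolding \<kappa> by simp
  qed
  obtain r0 where "(c - a) / (b - a) = of_real r0" using real by (auto elim: Reals_cases)
  then have c: "c = a + of_real r0 * (b - a)" using ne by (simp add: field_simps)
  have cnj: "cnj t = \<kappa> * t + \<tau>" if "t \<in> {a, b, c}" for t
    using that line[of 0] line[of 1] line[of r0] c by auto
  have "(B 1 * \<tau> - A 1) + (A 2 + B 1 * \<kappa>) * t + 0 * t\<^sup>2 = 0" if "t \<in> {a, b, c}" for t
    using iff[of t] v(2)[OF that] cnj[OF that] by (simp add: algebra_simps)
  from quadratic_three_zeros[OF this ne] have 1: "B 1 * \<tau> = A 1" "A 2 + B 1 * \<kappa> = 0" by auto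
  have "(A 3 - \<tau> * B 3) + (\<tau> * B 4 - A 4 - \<kappa> * B 3) * t + (A 5 + \<kappa> * B 4) * t\<^sup>2 = 0" if "t \<in> {a, b, c}" for t
  proof -
    have "A 3 - A 4 * t + A 5 * t\<^sup>2 = (\<kappa> * t + \<tau>) * (B 3 - B 4 * t)"
      using iff[of t] v(2)[OF that] cnj[OF that] by simp
    then show ?thesis by algebra
  qed
  from quadratic_three_zeros[OF this ne] have 2: "A 3 = \<tau> * B 3" "A 4 = \<tau> * B 4 - \<kappa> * B 3" "A 5 + \<kappa> * B 4 = 0" 
    by (auto simp: algebra_simps)
  have A12: "A 1 = B 1 * \<tau>" "A 2 = - (B 1 * \<kappa>)"
    and A345: "A 3 = \<tau> * B 3" "A 4 = \<tau> * B 4 - \<kappa> * B 3" "A 5 = - (\<kappa> * B 4)"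
    using 1 2 by (simp_all add: eq_neg_iff_add_eq_0)
  have "A 2 * t + B 1 * (\<kappa> * t + \<tau>) = A 1" for t
    using A12 by (simp add: algebra_simps)
  moreover have "A 3 - A 4 * t + A 5 * t\<^sup>2 = (\<kappa> * t + \<tau>) * (B 3 - B 4 * t)" for t
    unfolding A345 by (simp add: algebra_simps power2_eq_square)
  ultimately show ?thesis unfolding iff line by blast
qed

text \<open>Subtracting the conditions \<open>A\<^sub>2 t + B\<^sub>1 cnj t = A\<^sub>1\<close> at \<open>a, b, c\<close> gives two linear equations for \<open>A\<^sub>2\<close> and \<open>B\<^sub>1\<close>. Their
  determinant is a multiple of the imaginary part of \<open>(c - a) / (b - a)\<close>.\<close>

lemma collinear_noncircular_normal_form:
  assumes nf: "\<And>z. z \<in> flag_cone \<Longrightarrow> f z = normal_form A B C z"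
    and v: "vanishes_on_fiber f (vec3 1 0 0)" "\<And>t. t \<in> {a, b, c} \<Longrightarrow> vanishes_on_fiber f (vec3 t 1 0)"
    and ne: "a \<noteq> b" "a \<noteq> c" "b \<noteq> c" and real: "(c - a) / (b - a) \<notin> \<real>"
  shows "\<And>y x. (y, x) \<in> flag_cone \<Longrightarrow> 
      f (y, x) = y$1 * (A 3 * (x$1)\<^sup>2 + A 4 * (x$1 * x$2) + A 5 * (x$2)\<^sup>2) + y$2 * (B 3 * (x$1)\<^sup>2 + B 4 * (x$1 * x$2))"
    and "\<And>t. t \<in> {a, b, c} \<Longrightarrow> A 3 - A 4 * t + A 5 * t\<^sup>2 = cnj t * (B 3 - B 4 * t)"
proof -
  have zero: "A 0 = 0 \<and> B 0 = 0 \<and> B 2 = 0 \<and> B 5 = 0 \<and> C 0 = 0 \<and> C 1 = 0 \<and> C 2 = 0"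
    by (rule collinear_normal_form(1)[OF nf v(1), of a b]) (use v ne in auto)
  have iff: "vanishes_on_fiber f (vec3 t 1 0) \<longleftrightarrow>
      A 2 * t + B 1 * cnj t = A 1 \<and> A 3 - A 4 * t + A 5 * t\<^sup>2 = cnj t * (B 3 - B 4 * t)" for t
    by (rule collinear_normal_form(2)[OF nf v(1), of a b t]) (use v ne in auto)
  show "\<And>t. t \<in> {a, b, c} \<Longrightarrow> A 3 - A 4 * t + A 5 * t\<^sup>2 = cnj t * (B 3 - B 4 * t)"
    using iff v(2) by blast
  have M: "A 2 * t + B 1 * cnj t = A 1" if "t \<in> {a, b, c}" for t using iff v(2) that by blast
  define \<rho> where "\<rho> = (c - a) / (b - a)"
  have \<rho>: "c - a = \<rho> * (b - a)" using ne by (simp add: \<rho>_def)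
  have cd: "cnj c - cnj a = cnj \<rho> * (cnj b - cnj a)" using arg_cong[OF \<rho>, of cnj] by simp
  have "A 2 * (b - a) + B 1 * (cnj b - cnj a) = 0" "A 2 * (c - a) + B 1 * (cnj c - cnj a) = 0"
    using M[of a] M[of b] M[of c] by (simp_all add: algebra_simps)
  then have "B 1 * (cnj b - cnj a) * (\<rho> - cnj \<rho>) = 0" 
    using \<rho> cd by algebra
  moreover have "\<rho> - cnj \<rho> \<noteq> 0" using real by (simp add: \<rho>_def[symmetric] Reals_cnj_iff)
  moreover have "cnj b - cnj a \<noteq> 0" using ne by simp
  ultimately have B1: "B 1 = 0" by simp
  then have "A 2 * (b - a) = 0" using M[of a] M[of b] by (simp add: algebra_simps)
  then have A2: "A 2 = 0" using ne by simp
  then have A1: "A 1 = 0" using M[of a] B1 by simp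
  show "f (y, x) = y$1 * (A 3 * (x$1)\<^sup>2 + A 4 * (x$1 * x$2) + A 5 * (x$2)\<^sup>2) + y$2 * (B 3 * (x$1)\<^sup>2 + B 4 * (x$1 * x$2))"
    if "(y, x) \<in> flag_cone" for y x
    unfolding nf[OF that] normal_form_def using zero B1 A1 A2 by (simp add: mult.assoc)
qed

section \<open>The pencil of surfaces through four fibers\<close>

lemma bihom_section:
  assumes "P \<in> bihom a b"
  shows "(\<lambda>z. if z \<in> flag_cone then P z else 0) \<in> sections a b"
  unfolding sections_def
proof (intro CollectI conjI allI ballI impI)
  fix x assume "x \<in> flag_cone"
  show "\<exists>c d. \<exists>Pa\<in>bihom (a + c) (b + d). \<exists>Q\<in>bihom c d. Q x \<noteq> 0 \<and>
     (\<forall>y\<in>flag_cone. Q y \<noteq> 0 \<longrightarrow> (if y \<in> flag_cone then P y else 0) = Pa y / Q y)"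
    by (rule exI[of _ 0], rule exI[of _ 0], rule bexI[of _ P], rule bexI[of _ "\<lambda>_. 1"])
      (use assms bihom_const in auto)
qed auto

lemma sections_eqI:
  assumes "s \<in> sections a b" "t \<in> sections a b" "\<And>z. z \<in> flag_cone \<Longrightarrow> s z = t z"
  shows "s = t"
proof
  fix z
  have "s z = 0" "t z = 0" if "z \<notin> flag_cone"
    using assms(1,2) that unfolding sections_def by blast+
  then show "s z = t z" using assms(3) by (cases "z \<in> flag_cone") simp_all
qed

text \<open>What is left of the normal form for four collinear points that are not on a circle.\<close>

definition pencil_form :: "complex \<Rightarrow> complex \<Rightarrow> complex \<Rightarrow> complex \<Rightarrow> complex \<Rightarrow> cvec \<times> cvec \<Rightarrow> complex" where
  "pencil_form a3 a4 a5 b3 b4 = (\<lambda>(y, x).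
     y$1 * (a3 * (x$1)\<^sup>2 + a4 * (x$1 * x$2) + a5 * (x$2)\<^sup>2) + y$2 * (b3 * (x$1)\<^sup>2 + b4 * (x$1 * x$2)))"

lemma pencil_form_bihom: "(\<lambda>z. pencil_form a3 a4 a5 b3 b4 (unrot U z)) \<in> bihom 1 2"
proof -
  have quad: "(\<lambda>z. snd (unrot U z) $ i * snd (unrot U z) $ j) \<in> bihom 0 2" for i j
    using bihom_mult[OF unrot_bihom(2) unrot_bihom(2), of U i U j] by (simp add: numeral_2_eq_2)
  have lin: "(\<lambda>z. fst (unrot U z) $ i * Q z) \<in> bihom 1 2" if "Q \<in> bihom 0 2" for i Q
    using bihom_mult[OF unrot_bihom(1) that, of U i] by (simp add: numeral_2_eq_2)
  show ?thesis
    unfolding pencil_form_def case_prod_unfold power2_eq_square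
    by (intro bihom_add lin bihom_scale quad)
qed

lemma section_rot_normal_form:
  assumes "t \<in> sections 1 2" "unitary U"
  obtains A B C where "\<And>z. z \<in> flag_cone \<Longrightarrow> t (rot U z) = normal_form A B C z"
  using regular_normal_form[OF regular_rot[OF sections_regular[OF assms(1)] assms(2)]] by blast

definition pencil_section :: "complex ^ 3 ^ 3 \<Rightarrow> complex \<Rightarrow> complex \<Rightarrow> complex \<Rightarrow> complex \<Rightarrow> complex \<Rightarrow> cvec \<times> cvec \<Rightarrow> complex" where
  "pencil_section U a3 a4 a5 b3 b4 = (\<lambda>z. if z \<in> flag_cone then pencil_form a3 a4 a5 b3 b4 (unrot U z) else 0)"

lemma pencil_section_mem: "pencil_section U a3 a4 a5 b3 b4 \<in> sections 1 2"
  unfolding pencil_section_def by (rule bihom_section) (rule pencil_form_bihom)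

lemma pencil_section_vanishes_at_infinity:
  assumes U: "unitary U"
  shows "vanishes_on_fiber (pencil_section U a3 a4 a5 b3 b4) (U *v vec3 1 0 0)"
  unfolding vanishes_on_fiber_rot[OF U]
  by (auto simp: vanishes_on_fiber_def pencil_section_def U pencil_form_def pairing3)

lemma pencil_section_vanishes:
  assumes U: "unitary U" and *: "a3 - a4 * t + a5 * t\<^sup>2 = cnj t * (b3 - b4 * t)"
  shows "vanishes_on_fiber (pencil_section U a3 a4 a5 b3 b4) (U *v vec3 t 1 0)"
proof -
  have "pencil_section U a3 a4 a5 b3 b4 (rot U (y, x)) = 0"
    if "pairing y (cnj_vec (vec3 t 1 0)) = 0" "pairing (vec3 t 1 0) x = 0" for y x
  proof -
    have y2: "y$2 = - cnj t * y$1" and x2: "x$2 = - t * x$1"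
      using that by (simp_all add: pairing3 add_eq_0_iff mult.commute)
    have a3: "a3 = a4 * t - a5 * t\<^sup>2 + cnj t * (b3 - b4 * t)" using * by (simp add: algebra_simps)
    have "pencil_form a3 a4 a5 b3 b4 (y, x) = 0"
      unfolding pencil_form_def prod.case y2 x2 a3 by (simp add: algebra_simps power2_eq_square)
    then show ?thesis
      by (simp add: pencil_section_def U)
  qed
  then show ?thesis
    unfolding vanishes_on_fiber_rot[OF U] by (simp add: vanishes_on_fiber_def)
qed

lemma section_in_pencil:
  assumes t: "t \<in> sections 1 2" and U: "unitary U"
    and v: "vanishes_on_fiber t (U *v vec3 1 0 0)" "\<And>r. r \<in> {a, b, c} \<Longrightarrow> vanishes_on_fiber t (U *v vec3 r 1 0)"
    and ne: "a \<noteq> b" "a \<noteq> c" "b \<noteq> c" and real: "(c - a) / (b - a) \<notin> \<real>"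
  obtains a3 a4 a5 b3 b4 where "t = pencil_section U a3 a4 a5 b3 b4"
    "\<And>r. r \<in> {a, b, c} \<Longrightarrow> a3 - a4 * r + a5 * r\<^sup>2 = cnj r * (b3 - b4 * r)"
proof -
  obtain A B C where nf: "\<And>z. z \<in> flag_cone \<Longrightarrow> t (rot U z) = normal_form A B C z"
    using section_rot_normal_form[OF t U] by blast
  have v': "vanishes_on_fiber (\<lambda>z. t (rot U z)) (vec3 1 0 0)"
    "\<And>r. r \<in> {a, b, c} \<Longrightarrow> vanishes_on_fiber (\<lambda>z. t (rot U z)) (vec3 r 1 0)"
    using v vanishes_on_fiber_rot[OF U] by blast+
  have N: "t (rot U (y, x)) = y$1 * (A 3 * (x$1)\<^sup>2 + A 4 * (x$1 * x$2) + A 5 * (x$2)\<^sup>2) + y$2 * (B 3 * (x$1)\<^sup>2 + B 4 * (x$1 * x$2))"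
    if "(y, x) \<in> flag_cone" for y x
    by (rule collinear_noncircular_normal_form(1)[where f="\<lambda>z. t (rot U z)", OF _ v'(1) _ ne real that]) (use nf v' in auto)
  have N2: "A 3 - A 4 * r + A 5 * r\<^sup>2 = cnj r * (B 3 - B 4 * r)" if "r \<in> {a, b, c}" for r
    by (rule collinear_noncircular_normal_form(2)[where f="\<lambda>z. t (rot U z)", OF _ v'(1) _ ne real that]) (use nf v' in auto)
  have "t = pencil_section U (A 3) (A 4) (A 5) (B 3) (B 4)"
  proof (rule sections_eqI[OF t pencil_section_mem])
    fix z assume z: "z \<in> flag_cone"
    obtain y x where yx: "unrot U z = (y, x)" by force
    then have "(y, x) \<in> flag_cone" using z U by (metis unrot_flag_cone)
    from N[OF this] have "t (rot U (unrot U z)) = pencil_form (A 3) (A 4) (A 5) (B 3) (B 4) (unrot U z)"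
      unfolding yx pencil_form_def by simp
    then show "t z = pencil_section U (A 3) (A 4) (A 5) (B 3) (B 4) z"
      using U z by (simp add: pencil_section_def)
  qed
  then show ?thesis using that N2 by blast
qed

text \<open>The coefficients \<open>b\<^sub>3, b\<^sub>4\<close> are free and the others are determined by interpolation. The basis corresponds to
  \<open>(b\<^sub>3, b\<^sub>4) = (1, 0)\<close> and \<open>(0, 1)\<close>.\<close>

lemma dim_pencil:
  assumes U: "unitary U" and ne: "a \<noteq> b" "a \<noteq> c" "b \<noteq> c" and real: "(c - a) / (b - a) \<notin> \<real>"
  shows "cfun.dim {t \<in> sections 1 2. vanishes_on_fiber t (U *v vec3 1 0 0) \<and> 
     (\<forall>r\<in>{a, b, c}. vanishes_on_fiber t (U *v vec3 r 1 0))} = 2" (is "cfun.dim ?V = 2")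
proof -
  obtain i3 i4 i5 where I: "\<And>r. r \<in> {a, b, c} \<Longrightarrow> i3 - i4 * r + i5 * r\<^sup>2 = cnj r"
    using quadratic_interpolation[OF ne, of cnj] by blast
  obtain j3 j4 j5 where J: "\<And>r. r \<in> {a, b, c} \<Longrightarrow> j3 - j4 * r + j5 * r\<^sup>2 = - cnj r * r"
    using quadratic_interpolation[OF ne, of "\<lambda>r. - cnj r * r"] by blast
  define E where "E = pencil_section U i3 i4 i5 1 0"
  define F where "F = pencil_section U j3 j4 j5 0 1"
  have EF: "E \<in> ?V" "F \<in> ?V"
    unfolding E_def F_def using pencil_section_vanishes_at_infinity[OF U] pencil_section_vanishes[OF U] pencil_section_mem I J by auto
  have val: "E (rot U (y, x)) = pencil_form i3 i4 i5 1 0 (y, x)" "F (rot U (y, x)) = pencil_form j3 j4 j5 0 1 (y, x)"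
    if "(y, x) \<in> flag_cone" for y x using that U by (simp_all add: E_def F_def pencil_section_def)
  have E1: "E (rot U (vec3 0 1 0, vec3 1 0 0)) = 1" "F (rot U (vec3 0 1 0, vec3 1 0 0)) = 0"
    and F1: "F (rot U (vec3 0 1 (-1), vec3 1 1 1)) = 1"
    by (subst val; simp add: flag_cone_iff vec3_eq_0_iff pencil_form_def)+
  have span: "?V \<subseteq> cfun.span {E, F}"
  proof
    fix t assume t: "t \<in> ?V"
    obtain a3 a4 a5 b3 b4 where p: "t = pencil_section U a3 a4 a5 b3 b4"
      "\<And>r. r \<in> {a, b, c} \<Longrightarrow> a3 - a4 * r + a5 * r\<^sup>2 = cnj r * (b3 - b4 * r)"
      using section_in_pencil[of t U a b c] t U ne real by blast
    have "(a3 - b3 * i3 - b4 * j3) + (b3 * i4 + b4 * j4 - a4) * r + (a5 - b3 * i5 - b4 * j5) * r\<^sup>2 = 0"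
      if "r \<in> {a, b, c}" for r
    proof -
      have "(a3 - b3 * i3 - b4 * j3) + (b3 * i4 + b4 * j4 - a4) * r + (a5 - b3 * i5 - b4 * j5) * r\<^sup>2 =
        (a3 - a4 * r + a5 * r\<^sup>2) - b3 * (i3 - i4 * r + i5 * r\<^sup>2) - b4 * (j3 - j4 * r + j5 * r\<^sup>2)"
        by (simp add: algebra_simps)
      then show ?thesis unfolding p(2)[OF that] I[OF that] J[OF that] by (simp add: algebra_simps)
    qed
    from quadratic_three_zeros[OF this ne] have 
      "a3 = b3 * i3 + b4 * j3" "a4 = b3 * i4 + b4 * j4" "a5 = b3 * i5 + b4 * j5" by (auto simp: algebra_simps)
    then have "t = (\<lambda>z. b3 * E z) + (\<lambda>z. b4 * F z)"
      unfolding p(1) E_def F_def by (auto simp: fun_eq_iff pencil_section_def pencil_form_def case_prod_unfold algebra_simps)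
    then show "t \<in> cfun.span {E, F}"
      by (auto intro!: cfun.span_add cfun.span_scale intro: cfun.span_base)
  qed
  have "E \<noteq> F" using E1 by auto
  have "cfun.independent {E, F}"
  proof -
    have "F \<noteq> 0" using F1 by (auto simp: zero_fun_def)
    moreover have "E \<notin> cfun.span {F}"
    proof
      assume "E \<in> cfun.span {F}"
      then obtain k where "E = (\<lambda>z. k * F z)" unfolding cfun.span_singleton by blast
      then show False using E1 by simp
    qed
    ultimately show ?thesis using \<open>E \<noteq> F\<close> by (simp add: cfun.independent_insert)
  qed
  then show ?thesis
    using \<open>E \<noteq> F\<close> EF span by (intro cfun.dim_unique[of "{E, F}"]) auto
qed

lemma has_derivative_product_of_zeros:
  fixes f g h :: "'a :: real_normed_vector \<Rightarrow> complex"
  assumes "f differentiable at z within S" "g differentiable at z within S" "h differentiable at z within S"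
    and "f z = 0" "g z = 0"
  shows "((\<lambda>w. h w * (f w * g w)) has_derivative (\<lambda>_. 0)) (at z within S)"
proof -
  obtain f' g' h' where "(f has_derivative f') (at z within S)" "(g has_derivative g') (at z within S)" 
    "(h has_derivative h') (at z within S)"
    using assms by (auto simp: differentiable_def)
  then have "((\<lambda>w. h w * (f w * g w)) has_derivative (\<lambda>d. h z * (f z * g' d + f' d * g z) + h' d * (f z * g z))) (at z within S)"
    by (intro has_derivative_mult)
  then show ?thesis using assms by simp
qed

lemma differentiable_linear:
  fixes M :: "complex ^ 3 ^ 3"
  shows "(\<lambda>z :: cvec \<times> cvec. (M *v fst z) $ i) differentiable F" "(\<lambda>z :: cvec \<times> cvec. (M *v snd z) $ i) differentiable F"
proof -
  have "bounded_linear (\<lambda>z :: cvec \<times> cvec. fst z $ j)" "bounded_linear (\<lambda>z :: cvec \<times> cvec. snd z $ j)" for j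
    by (intro bounded_linear_compose[OF bounded_linear_vec_nth] bounded_linear_fst bounded_linear_snd)+
  then have "bounded_linear (\<lambda>z :: cvec \<times> cvec. (M *v fst z) $ i)" "bounded_linear (\<lambda>z :: cvec \<times> cvec. (M *v snd z) $ i)"
    unfolding matrix_vector_mult_def vec_lambda_beta
    by (auto intro!: bounded_linear_sum bounded_linear_const_mult)
  then show "(\<lambda>z :: cvec \<times> cvec. (M *v fst z) $ i) differentiable F" "(\<lambda>z :: cvec \<times> cvec. (M *v snd z) $ i) differentiable F"
    by (simp_all add: bounded_linear_imp_differentiable)
qed

text \<open>Each term of \<open>pencil_form\<close> has two factors from \<open>{x\<^sub>1, x\<^sub>2}\<close>, and both vanish along this curve.\<close>

lemma pencil_section_singular:
  assumes U: "unitary U" and m: "l0 = conj_mat U *v vec3 0 0 1"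
  shows "{x \<in> flag. snd x = pt l0} \<subseteq> singular_locus (pencil_section U a3 a4 a5 b3 b4)"
proof
  fix z assume "z \<in> {x \<in> flag. snd x = pt l0}"
  then obtain p l where z: "z = (pt p, pt l)" "(p, l) \<in> flag_cone" "pt l = pt l0"
    by (auto simp: flag_def)
  have "l0 \<noteq> 0" unfolding m unitary_mult_eq_0[OF U] by (simp add: vec3_eq_0_iff)
  then obtain c where c: "c \<noteq> 0" "l = c *s l0" using pt_eq_iff[of l0 l] z by (auto simp: flag_cone_iff)
  have "snd (unrot U (p, l)) = c *s vec3 0 0 1"
    unfolding unrot_def prod.case snd_conv c(2) m vector_scalar_commute unitary_inverse(3)[OF U] by (rule refl)
  then have x: "snd (unrot U (p, l)) $ 1 = 0" "snd (unrot U (p, l)) $ 2 = 0" by (simp_all)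
  have d: "(\<lambda>z. fst (unrot U z) $ i) differentiable F" "(\<lambda>z. snd (unrot U z) $ i) differentiable F" for i F
    unfolding unrot_def case_prod_unfold fst_conv snd_conv by (rule differentiable_linear)+
  have d2: "((\<lambda>z. k * (fst (unrot U z) $ j * (snd (unrot U z) $ i * snd (unrot U z) $ i'))) has_derivative (\<lambda>_. 0)) (at (p, l) within flag_cone)"
    if "i \<in> {1, 2}" "i' \<in> {1, 2}" for i i' j k
  proof -
    have "((\<lambda>z. fst (unrot U z) $ j * (snd (unrot U z) $ i * snd (unrot U z) $ i')) has_derivative (\<lambda>_. 0)) (at (p, l) within flag_cone)"
      by (rule has_derivative_product_of_zeros) (use d x that in auto)
    from has_derivative_mult_right[OF this, of k] show ?thesis by simp
  qed
  define G where "G z = a3 * (fst (unrot U z) $ 1 * (snd (unrot U z) $ 1 * snd (unrot U z) $ 1))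
     + a4 * (fst (unrot U z) $ 1 * (snd (unrot U z) $ 1 * snd (unrot U z) $ 2))
     + a5 * (fst (unrot U z) $ 1 * (snd (unrot U z) $ 2 * snd (unrot U z) $ 2))
     + b3 * (fst (unrot U z) $ 2 * (snd (unrot U z) $ 1 * snd (unrot U z) $ 1))
     + b4 * (fst (unrot U z) $ 2 * (snd (unrot U z) $ 1 * snd (unrot U z) $ 2))" for z
  have G: "pencil_form a3 a4 a5 b3 b4 (unrot U z) = G z" for z
    by (simp add: G_def pencil_form_def case_prod_unfold power2_eq_square algebra_simps)
  have "(G has_derivative (\<lambda>_. 0 + 0 + 0 + 0 + 0)) (at (p, l) within flag_cone)"
    unfolding G_def[abs_def] by (intro has_derivative_add d2) auto
  then have "(G has_derivative (\<lambda>_. 0)) (at (p, l) within flag_cone)" by simp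
  then have "(pencil_section U a3 a4 a5 b3 b4 has_derivative (\<lambda>_. 0)) (at (p, l) within flag_cone)"
    by (rule has_derivative_transform[rotated 2]) (use z(2) G in \<open>auto simp: pencil_section_def\<close>)
  moreover have "pencil_section U a3 a4 a5 b3 b4 (p, l) = 0"
    using x by (simp add: pencil_section_def G G_def)
  ultimately show "z \<in> singular_locus (pencil_section U a3 a4 a5 b3 b4)"
    using z unfolding singular_locus_def by blast
qed

lemma union_subset_zero_locus_iff:
  assumes "t \<in> sections a b"
  shows "\<Union>(twistor_fiber ` Q) \<subseteq> zero_locus t \<longleftrightarrow> (\<forall>q\<in>Q. vanishes_on_fiber t q)"
  using fiber_subset_zero_locus_iff[OF assms] by blast

lemma pencil_through_four_fibers:
  assumes U: "unitary U" and ne: "a \<noteq> b" "a \<noteq> c" "b \<noteq> c" and real: "(c - a) / (b - a) \<notin> \<real>"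
    and l0: "l0 = conj_mat U *v vec3 0 0 1" 
    and A: "A = \<Union>(twistor_fiber ` {U *v vec3 1 0 0, U *v vec3 a 1 0, U *v vec3 b 1 0, U *v vec3 c 1 0})"
  shows "h0_ideal A 1 2 = 2"
    and "t \<in> linear_system_containing A 1 2 \<Longrightarrow> {x \<in> flag. snd x = pt l0} \<subseteq> singular_locus t"
proof -
  have ideal: "ideal_sections A 1 2 = {t \<in> sections 1 2. vanishes_on_fiber t (U *v vec3 1 0 0) \<and> 
     (\<forall>r\<in>{a, b, c}. vanishes_on_fiber t (U *v vec3 r 1 0))}"
  proof -
    have "A \<subseteq> zero_locus t \<longleftrightarrow> vanishes_on_fiber t (U *v vec3 1 0 0) \<and> 
      (\<forall>r\<in>{a, b, c}. vanishes_on_fiber t (U *v vec3 r 1 0))" if "t \<in> sections 1 2" for t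
      unfolding A union_subset_zero_locus_iff[OF that] by simp
    then show ?thesis unfolding ideal_sections_def by blast
  qed
  show "h0_ideal A 1 2 = 2"
    unfolding h0_ideal_def ideal by (rule dim_pencil[OF U ne real])
  assume "t \<in> linear_system_containing A 1 2"
  then have "t \<in> ideal_sections A 1 2" unfolding linear_system_containing_def by blast
  then have t: "t \<in> sections 1 2" "vanishes_on_fiber t (U *v vec3 1 0 0)"
     "\<And>r. r \<in> {a, b, c} \<Longrightarrow> vanishes_on_fiber t (U *v vec3 r 1 0)"
    unfolding ideal by blast+
  obtain a3 a4 a5 b3 b4 where "t = pencil_section U a3 a4 a5 b3 b4"
    by (rule section_in_pencil[OF t(1) U t(2,3) ne real])
  then show "{x \<in> flag. snd x = pt l0} \<subseteq> singular_locus t"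
    using pencil_section_singular[OF U l0] by simp
qed

lemma unitary_det3_nonzero:
  assumes "unitary U"
  shows "det3 (U *v vec3 1 0 0) (U *v vec3 0 1 0) (U *v vec3 0 0 1) \<noteq> 0"
proof
  assume "det3 (U *v vec3 1 0 0) (U *v vec3 0 1 0) (U *v vec3 0 0 1) = 0"
  then have "det3 (U *v u) (U *v v) (U *v w) = 0" for u v w using det3_mult[of U u v w] by simp
  from this[of "transpose (conj_mat U) *v vec3 1 0 0" "transpose (conj_mat U) *v vec3 0 1 0" "transpose (conj_mat U) *v vec3 0 0 1"]
  show False unfolding unitary_inverse(1)[OF assms] by (simp add: det3_def)
qed

text \<open>In the frame with \<open>q\<^sub>1 = (1, 0, 0)\<close> a further point of the line has second coordinate different from 0.\<close>

lemma collinear_point_normalized: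
  assumes U: "unitary U" and q1: "q1 = U *v vec3 a0 0 0" and q2: "q2 = U *v vec3 b0 c0 0" and "a0 \<noteq> 0" "c0 \<noteq> 0"
    and d: "det3 q1 q2 q = 0" and np: "non_proportional q1 q"
  obtains t where "twistor_fiber q = twistor_fiber (U *v vec3 t 1 0)"
proof -
  define w where "w = transpose (conj_mat U) *v q"
  have q: "q = U *v w" unfolding w_def by (rule unitary_inverse(1)[OF U, symmetric])
  have "det3 (vec3 a0 0 0) (vec3 b0 c0 0) w = 0"
    using d det3_mult[of U "vec3 a0 0 0" "vec3 b0 c0 0" w] unitary_det3_nonzero[OF U] unfolding q q1 q2 by simp
  then have w3: "w $ 3 = 0" using assms by (simp add: det3_def)
  have w2: "w $ 2 \<noteq> 0"
  proof
    assume "w $ 2 = 0"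
    then have "w = (w $ 1 / a0) *s vec3 a0 0 0" using w3 \<open>a0 \<noteq> 0\<close> by (simp add: cvec_eq_iff)
    then have "q = (w $ 1 / a0) *s q1" unfolding q q1 by (metis vector_scalar_commute)
    then show False using np by (simp add: non_proportional_def)
  qed
  have "w = (w $ 2) *s vec3 (w $ 1 / w $ 2) 1 0" using w2 w3 by (simp add: cvec_eq_iff)
  then have "q = (w $ 2) *s (U *v vec3 (w $ 1 / w $ 2) 1 0)" unfolding q by (metis vector_scalar_commute)
  then show ?thesis using that twistor_fiber_scale[OF w2] by metis
qed

lemma unitary_non_proportional:
  assumes "unitary U" "t \<noteq> t'"
  shows "non_proportional (U *v vec3 t 1 0) (U *v vec3 t' 1 0)"
  unfolding non_proportional_def
proof (intro conjI allI)
  have inj: "U *v u = U *v v \<Longrightarrow> u = v" for u v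
    using unitary_inverse(4)[OF assms(1)] by metis
  show "U *v vec3 t 1 0 \<noteq> 0" "U *v vec3 t' 1 0 \<noteq> 0" 
    using inj[of "vec3 t 1 0" 0] inj[of "vec3 t' 1 0" 0] by (auto simp: vec3_eq_0_iff)
  show "U *v vec3 t' 1 0 \<noteq> c *s (U *v vec3 t 1 0)" for c
    using inj[of "vec3 t' 1 0" "c *s vec3 t 1 0"] assms(2) by (auto simp: vector_scalar_commute cvec_eq_iff)
qed

text \<open>The four points are brought to the form \<open>(1, 0, 0)\<close>, \<open>(a, 1, 0)\<close>, \<open>(b, 1, 0)\<close>, \<open>(c, 1, 0)\<close>. If they were on a circle, the
  surface would contain the infinitely many fibers along it.\<close>

lemma irreducible_with_four_fibers_collinear:
  assumes s: "s \<in> linear_system 1 2" and irr: "irreducible_in zariski (zero_locus s)"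
    and card: "card {T \<in> twistor_fibers. T \<subseteq> zero_locus s} = 4"
  obtains U a b c where "unitary U" "a \<noteq> b" "a \<noteq> c" "b \<noteq> c" "(c - a) / (b - a) \<notin> \<real>"
    "{T \<in> twistor_fibers. T \<subseteq> zero_locus s} = twistor_fiber ` {U *v vec3 1 0 0, U *v vec3 a 1 0, U *v vec3 b 1 0, U *v vec3 c 1 0}"
proof -
  have sec: "s \<in> sections 1 2" using s by (simp add: linear_system_def)
  define F where "F = {T \<in> twistor_fibers. T \<subseteq> zero_locus s}"
  have fin: "finite F" using card unfolding F_def by (metis card.infinite zero_neq_numeral)
  obtain T1 T2 T3 T4 where F: "F = {T1, T2, T3, T4}" and T: "T1 \<noteq> T2" "T1 \<noteq> T3" "T1 \<noteq> T4" "T2 \<noteq> T3" "T2 \<noteq> T4" "T3 \<noteq> T4"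
    using card unfolding F_def[symmetric] by (auto simp: numeral_eq_Suc card_Suc_eq)
  have "\<exists>q. T = twistor_fiber q \<and> q \<noteq> 0 \<and> vanishes_on_fiber s q" if "T \<in> F" for T
    using that fiber_subset_zero_locus_iff[OF sec] unfolding F_def twistor_fibers_def by blast
  then obtain q1 q2 q3 q4 where q: "T1 = twistor_fiber q1" "T2 = twistor_fiber q2" "T3 = twistor_fiber q3" "T4 = twistor_fiber q4"
    "q1 \<noteq> 0" "q2 \<noteq> 0" "q3 \<noteq> 0" "q4 \<noteq> 0"
    and v: "vanishes_on_fiber s q1" "vanishes_on_fiber s q2" "vanishes_on_fiber s q3" "vanishes_on_fiber s q4"
    unfolding F by (metis insertI1 insertI2)
  have np: "non_proportional q1 q2" "non_proportional q1 q3" "non_proportional q1 q4" "non_proportional q2 q3" "non_proportional q2 q4" "non_proportional q3 q4" "non_proportional q4 q3"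
    by (rule non_proportional_if_fiber_neq; use T q in metis)+
  have d: "det3 q1 q2 q3 = 0" "det3 q1 q2 q4 = 0"
    using four_fibers_over_collinear_points[OF s irr v(1,2,3,4)] four_fibers_over_collinear_points[OF s irr v(1,2,4,3)] np by auto
  obtain U a0 b0 c0 where U: "unitary U" "a0 \<noteq> 0" "c0 \<noteq> 0" "q1 = U *v vec3 a0 0 0" "q2 = U *v vec3 b0 c0 0"
    using unitary_frame_plane[of q1 q2] np(1) unfolding non_proportional_def by metis
  have d2: "det3 q1 q2 q2 = 0" by (simp add: det3_def)
  obtain a where a: "T2 = twistor_fiber (U *v vec3 a 1 0)" 
    using collinear_point_normalized[OF U(1,4,5,2,3) d2 np(1)] q by metis
  obtain b where b: "T3 = twistor_fiber (U *v vec3 b 1 0)" 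
    using collinear_point_normalized[OF U(1,4,5,2,3) d(1) np(2)] q by metis
  obtain c where c: "T4 = twistor_fiber (U *v vec3 c 1 0)" 
    using collinear_point_normalized[OF U(1,4,5,2,3) d(2) np(3)] q by metis
  have ne: "a \<noteq> b" "a \<noteq> c" "b \<noteq> c" using T a b c by auto
  have "q1 = a0 *s (U *v vec3 1 0 0)" unfolding U(4) vector_scalar_commute[symmetric] scale_vec3 by simp
  then have T1: "T1 = twistor_fiber (U *v vec3 1 0 0)" using q twistor_fiber_scale[OF U(2)] by simp
  have FU: "F = twistor_fiber ` {U *v vec3 1 0 0, U *v vec3 a 1 0, U *v vec3 b 1 0, U *v vec3 c 1 0}"
    unfolding F T1 a b c by simp
  have v': "vanishes_on_fiber (\<lambda>z. s (rot U z)) (vec3 1 0 0)"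
    "\<And>r. r \<in> {a, b, c} \<Longrightarrow> vanishes_on_fiber (\<lambda>z. s (rot U z)) (vec3 r 1 0)"
  proof -
    have V: "vanishes_on_fiber s q" if "twistor_fiber q \<in> F" for q
      using that fiber_subset_zero_locus_iff[OF sec] by (simp add: F_def)
    show "vanishes_on_fiber (\<lambda>z. s (rot U z)) (vec3 1 0 0)"
      by (rule vanishes_on_fiber_rot[OF U(1), THEN iffD1], rule V) (simp add: FU)
    show "vanishes_on_fiber (\<lambda>z. s (rot U z)) (vec3 r 1 0)" if "r \<in> {a, b, c}" for r
      by (rule vanishes_on_fiber_rot[OF U(1), THEN iffD1], rule V) (use that in \<open>auto simp: FU\<close>)
  qed
  have "(c - a) / (b - a) \<notin> \<real>"
  proof
    assume R: "(c - a) / (b - a) \<in> \<real>"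
    define h where "h r = twistor_fiber (U *v vec3 (a + complex_of_real r * (b - a)) 1 0)" for r
    have "h r \<in> F" for r
    proof -
      have "vanishes_on_fiber s (U *v vec3 (a + complex_of_real r * (b - a)) 1 0)"
        unfolding vanishes_on_fiber_rot[OF U(1)]
        by (rule fibers_along_circle[OF regular_rot[OF sections_regular[OF sec] U(1)] v' ne R])
      moreover have "U *v vec3 (a + complex_of_real r * (b - a)) 1 0 \<noteq> 0" 
        using unitary_non_proportional[OF U(1), of "a + complex_of_real r * (b - a)" "a + complex_of_real r * (b - a) + 1"] by (simp add: non_proportional_def)
      ultimately show ?thesis 
        using fiber_subset_zero_locus_iff[OF sec] unfolding F_def twistor_fibers_def h_def by blast
    qed
    moreover have "inj h"
    proof (rule injI, rule ccontr)
      fix r r' assume "h r = h r'" "r \<noteq> r'"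
      then show False using twistor_fiber_neq[OF unitary_non_proportional[OF U(1)]] ne unfolding h_def by force
    qed
    ultimately have "finite (UNIV :: real set)"
      using finite_imageD[of h UNIV] finite_subset[OF _ fin, of "range h"] by auto
    then show False by (simp add: infinite_UNIV_char_0)
  qed
  then show ?thesis using that U(1) ne FU unfolding F_def by blast
qed

text \<open>The union \<open>A\<close> has to consist of the four fibers in the surface. Each of them is connected, so a component of \<open>A\<close> contains a
  fiber, and it suffices that the curve over \<open>l\<^sub>0\<close> meets all fibers; this holds because \<open>l\<^sub>0\<close> is dual to the line of the four points.\<close>

lemma line_through_four_fibers:
  assumes s: "irreducible_with_four_fibers s" and A: "A \<in> disjoint_twistor_unions 4" "A \<subseteq> zero_locus s"
  shows "\<exists>L\<in>curves_1_0.
          (\<forall>C\<in>connected_components_of (subtopology zariski A). L \<inter> C \<noteq> {}) \<and>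
          h0_ideal A 1 2 = 2 \<and>
          (\<forall>t\<in>linear_system_containing A 1 2. L \<subseteq> singular_locus t)"
proof -
  have card: "card {T \<in> twistor_fibers. T \<subseteq> zero_locus s} = 4"
    using s by (simp add: irreducible_with_four_fibers_def)
  obtain U a b c where U: "unitary U" "a \<noteq> b" "a \<noteq> c" "b \<noteq> c" "(c - a) / (b - a) \<notin> \<real>"
    and F: "{T \<in> twistor_fibers. T \<subseteq> zero_locus s} = twistor_fiber ` {U *v vec3 1 0 0, U *v vec3 a 1 0, U *v vec3 b 1 0, U *v vec3 c 1 0}"
    by (rule irreducible_with_four_fibers_collinear[of s])
      (use s in \<open>simp_all add: irreducible_with_four_fibers_def\<close>)
  obtain \<F> where \<F>: "A = \<Union>\<F>" "\<F> \<subseteq> twistor_fibers" "card \<F> = 4"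
    using A(1) by (auto simp: disjoint_twistor_unions_def)
  have "\<F> = {T \<in> twistor_fibers. T \<subseteq> zero_locus s}"
  proof (rule card_subset_eq)
    show "finite {T \<in> twistor_fibers. T \<subseteq> zero_locus s}" using card by (metis card.infinite zero_neq_numeral)
    show "\<F> \<subseteq> {T \<in> twistor_fibers. T \<subseteq> zero_locus s}" using \<F> A(2) by auto
  qed (use \<F> card in simp)
  with F \<F>(1) have A': "A = \<Union>(twistor_fiber ` {U *v vec3 1 0 0, U *v vec3 a 1 0, U *v vec3 b 1 0, U *v vec3 c 1 0})"
    by simp
  define Q where "Q = {U *v vec3 1 0 0, U *v vec3 a 1 0, U *v vec3 b 1 0, U *v vec3 c 1 0}"
  define l0 where "l0 = conj_mat U *v vec3 0 0 1"
  define L where "L = {x \<in> flag. snd x = pt l0}"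
  have Q: "q \<noteq> 0" "pairing q l0 = 0" if "q \<in> Q" for q
    using that unitary_mult_eq_0(1)[OF U(1)] unitary_pairing[OF U(1)] unfolding Q_def l0_def
    by (auto simp: vec3_eq_0_iff pairing3)
  have l0: "l0 \<noteq> 0" unfolding l0_def unitary_mult_eq_0[OF U(1)] by (simp add: vec3_eq_0_iff)
  have meet: "L \<inter> twistor_fiber q \<noteq> {}" if "q \<in> Q" for q
  proof -
    have "(cross l0 (cnj_vec q), l0) \<in> flag_cone" by (rule cross_on_fiber(1)) (use Q[OF that] l0 in auto)
    then have "(pt (cross l0 (cnj_vec q)), pt l0) \<in> L" by (auto simp: L_def flag_def)
    moreover have "(pt (cross l0 (cnj_vec q)), pt l0) \<in> twistor_fiber q" 
      unfolding twistor_fiber_graph[OF Q(1)[OF that]] using Q[OF that] l0 by auto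
    ultimately show ?thesis by blast
  qed
  have "L \<inter> C \<noteq> {}" if C: "C \<in> connected_components_of (subtopology zariski A)" for C
  proof -
    have "C \<noteq> {}" "C \<subseteq> A" 
      using nonempty_connected_components_of[OF C] connected_components_of_subset[OF C] by auto
    then obtain x q where x: "x \<in> C" "q \<in> Q" "x \<in> twistor_fiber q" unfolding A' Q_def by blast
    have "connectedin (subtopology zariski A) (twistor_fiber q)"
      using connectedin_twistor_fiber[OF Q(1)[OF x(2)]] x(2) unfolding A' Q_def by (auto simp: connectedin_subtopology)
    then have "twistor_fiber q \<subseteq> C"
      using connected_components_of_maximal[OF C, of "twistor_fiber q"] x by (auto simp: disjnt_def)
    then show ?thesis using meet[OF x(2)] by blast
  qed
  moreover have "L \<in> curves_1_0" by (auto simp: L_def curves_1_0_def)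
  moreover note pencil_through_four_fibers[OF U l0_def A']
  ultimately show ?thesis unfolding L_def by blast
qed

section \<open>A surface with exactly four twistor fibers\<close>

lemma basic_open_Int:
  assumes "P \<in> bihom a b" "Q \<in> bihom c d"
  shows "basic_open (\<lambda>z. P z * Q z) = basic_open P \<inter> basic_open Q"
proof (rule set_eqI)
  fix x
  obtain p l where pl: "p \<noteq> 0" "l \<noteq> 0" "x = (pt p, pt l)" by (metis pt_cases surj_pair)
  show "x \<in> basic_open (\<lambda>z. P z * Q z) \<longleftrightarrow> x \<in> basic_open P \<inter> basic_open Q"
    unfolding pl(3) Int_iff mem_basic_open[OF bihom_mult[OF assms] pl(1,2)] mem_basic_open[OF assms(1) pl(1,2)]
      mem_basic_open[OF assms(2) pl(1,2)] by simp
qed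

text \<open>The generating sets are closed under intersection, since \<open>bihom\<close> is closed under products.\<close>

lemma zariski_basis:
  assumes "openin zariski W" "x \<in> W"
  obtains P a b where "P \<in> bihom a b" "x \<in> basic_open P" "basic_open P \<subseteq> W"
proof -
  have "generate_topology_on {basic_open P | P a b. P \<in> bihom a b} W"
    using assms(1) unfolding zariski_def openin_topology_generated_by_iff basic_open_def .
  then have "\<forall>x\<in>W. \<exists>P a b. P \<in> bihom a b \<and> x \<in> basic_open P \<and> basic_open P \<subseteq> W"
  proof (induction rule: generate_topology_on.induct)
    case (Int V W)
    show ?case
    proof
      fix x assume x: "x \<in> V \<inter> W"
      obtain P a b where P: "P \<in> bihom a b" "x \<in> basic_open P" "basic_open P \<subseteq> V"
        using Int.IH(1) x by blast
      obtain Q c d where Q: "Q \<in> bihom c d" "x \<in> basic_open Q" "basic_open Q \<subseteq> W"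
        using Int.IH(2) x by blast
      have "x \<in> basic_open (\<lambda>z. P z * Q z)" "basic_open (\<lambda>z. P z * Q z) \<subseteq> V \<inter> W"
        unfolding basic_open_Int[OF P(1) Q(1)] using P Q by auto
      then show "\<exists>P a b. P \<in> bihom a b \<and> x \<in> basic_open P \<and> basic_open P \<subseteq> V \<inter> W"
        using bihom_mult[OF P(1) Q(1)] by blast
    qed
  next
    case (UN K)
    show ?case
    proof
      fix x assume "x \<in> \<Union>K"
      then obtain V where V: "V \<in> K" "x \<in> V" by blast
      then obtain P a b where "P \<in> bihom a b" "x \<in> basic_open P" "basic_open P \<subseteq> V" using UN.IH by blast
      then show "\<exists>P a b. P \<in> bihom a b \<and> x \<in> basic_open P \<and> basic_open P \<subseteq> \<Union>K" using V by blast
    qed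
  qed auto
  then show ?thesis using assms(2) that by blast
qed

text \<open>With these coefficients the condition imposed by the fiber of \<open>(t, 1, 0)\<close> reads \<open>1/4 + t\<^sup>2 = cnj t\<close>.\<close>

definition example :: "cvec \<times> cvec \<Rightarrow> complex" where
  "example = pencil_section (mat 1) (1/4) 0 1 1 0"

lemma unitary_mat_1: "unitary (mat 1)"
  by (simp add: unitary_def)

lemma example_eq: "(p, l) \<in> flag_cone \<Longrightarrow> example (p, l) = p$1 * ((l$1)\<^sup>2 / 4 + (l$2)\<^sup>2) + p$2 * (l$1)\<^sup>2"
  by (simp add: example_def pencil_section_def pencil_form_def unrot_def)

lemma example_section: "example \<in> sections 1 2"
  unfolding example_def by (rule pencil_section_mem)

text \<open>Each condition comes from one point of the fiber: \<open>l = (0, q\<^sub>3, - q\<^sub>2)\<close> shows \<open>q\<^sub>3 = 0\<close>, and \<open>l = (- q\<^sub>2, q\<^sub>1, 1)\<close> gives the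
  equation.\<close>

lemma example_vanishing:
  assumes v: "vanishes_on_fiber example q" and "q \<noteq> 0"
  shows "q $ 3 = 0" and "q $ 2 \<noteq> 0 \<Longrightarrow> 1 / 4 + (q$1 / q$2)\<^sup>2 = cnj (q$1 / q$2)"
proof -
  have van: "(cross l (cnj_vec q)) $ 1 * ((l$1)\<^sup>2 / 4 + (l$2)\<^sup>2) + (cross l (cnj_vec q)) $ 2 * (l$1)\<^sup>2 = 0" 
    if "l \<noteq> 0" "pairing q l = 0" for l
    using v cross_on_fiber[OF \<open>q \<noteq> 0\<close> that] example_eq that unfolding vanishes_on_fiber_def by metis
  show q3: "q $ 3 = 0"
  proof (rule ccontr)
    assume c: "q $ 3 \<noteq> 0"
    have "(q$2 * cnj (q$2) + q$3 * cnj (q$3)) * (q$3)\<^sup>2 = 0"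
      using van[of "vec3 0 (q$3) (- q$2)"] c by (simp add: vec3_eq_0_iff pairing3 cross_def algebra_simps)
    then show False using hermitian_norm_nonzero[of "q$2" "q$3"] c by simp
  qed
  assume b: "q $ 2 \<noteq> 0"
  have "- cnj (q$2) * ((q$2)\<^sup>2 / 4 + (q$1)\<^sup>2) + cnj (q$1) * (q$2)\<^sup>2 = 0"
    using van[of "vec3 (- q$2) (q$1) 1"] by (simp add: vec3_eq_0_iff pairing3 cross_def q3)
  then show "1 / 4 + (q$1 / q$2)\<^sup>2 = cnj (q$1 / q$2)"
    using b by (simp add: field_simps power2_eq_square)
qed

text \<open>For real \<open>t\<close> the equation is \<open>(t - 1/2)\<^sup>2 = 0\<close>, for other \<open>t\<close> the imaginary part gives \<open>Re t = - 1/2\<close>.\<close>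

lemma conjugate_quadratic_solutions:
  "1 / 4 + t\<^sup>2 = cnj t \<longleftrightarrow> t \<in> {1 / 2, Complex (- 1 / 2) 1, Complex (- 1 / 2) (- 1)}"
proof
  assume "1 / 4 + t\<^sup>2 = cnj t"
  then have re: "1 / 4 + (Re t)\<^sup>2 - (Im t)\<^sup>2 = Re t" and im: "2 * Re t * Im t = - Im t"
    by (simp_all add: complex_eq_iff power2_eq_square mult.commute)
  show "t \<in> {1 / 2, Complex (- 1 / 2) 1, Complex (- 1 / 2) (- 1)}"
  proof (cases "Im t = 0")
    case True
    then have "(Re t - 1 / 2)\<^sup>2 = 0" using re by (simp add: power2_eq_square algebra_simps)
    then show ?thesis using True by (simp add: complex_eq_iff)
  next
    case False
    have "(2 * Re t + 1) * Im t = 0" using im by (simp add: algebra_simps)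
    then have r: "Re t = - 1 / 2" using False by simp
    then have "(Im t)\<^sup>2 = 1" using re by (simp add: power2_eq_square)
    then have "Im t = 1 \<or> Im t = - 1" by (simp add: power2_eq_1_iff)
    then show ?thesis using r by (auto simp: complex_eq_iff)
  qed
next
  assume "t \<in> {1 / 2, Complex (- 1 / 2) 1, Complex (- 1 / 2) (- 1)}"
  then show "1 / 4 + t\<^sup>2 = cnj t"
    by (elim insertE emptyE; hypsubst) (simp_all add: complex_eq_iff power2_eq_square)
qed

definition example_points :: "cvec set" where
  "example_points = {vec3 1 0 0, vec3 (1 / 2) 1 0, vec3 (Complex (- 1 / 2) 1) 1 0, vec3 (Complex (- 1 / 2) (- 1)) 1 0}"

lemma example_vanishes_on_points: "q \<in> example_points \<Longrightarrow> vanishes_on_fiber example q"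
proof -
  have "vanishes_on_fiber example (vec3 1 0 0)"
    using pencil_section_vanishes_at_infinity[OF unitary_mat_1] by (simp add: example_def)
  moreover have "vanishes_on_fiber example (vec3 t 1 0)" if "1 / 4 + t\<^sup>2 = cnj t" for t
    using pencil_section_vanishes[OF unitary_mat_1, of "1/4" 0 t 1 1 0] that by (simp add: example_def)
  ultimately show "q \<in> example_points \<Longrightarrow> vanishes_on_fiber example q"
    using conjugate_quadratic_solutions unfolding example_points_def by blast
qed

lemma example_fibers: "{T \<in> twistor_fibers. T \<subseteq> zero_locus example} = twistor_fiber ` example_points"
proof (intro set_eqI iffI)
  fix T assume "T \<in> {T \<in> twistor_fibers. T \<subseteq> zero_locus example}"
  then obtain q where q: "T = twistor_fiber q" "q \<noteq> 0" "vanishes_on_fiber example q"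
    using fiber_subset_zero_locus_iff[OF example_section] by (auto simp: twistor_fibers_def)
  note ev = example_vanishing[OF q(3,2)]
  show "T \<in> twistor_fiber ` example_points"
  proof (cases "q $ 2 = 0")
    case True
    then have "q = (q$1) *s vec3 1 0 0" "q$1 \<noteq> 0" using ev(1) q(2) by (auto simp: cvec_eq_iff)
    then have "T = twistor_fiber (vec3 1 0 0)" using q(1) twistor_fiber_scale by metis
    then show ?thesis by (simp add: example_points_def)
  next
    case False
    then have "q = (q$2) *s vec3 (q$1 / q$2) 1 0" using ev(1) by (simp add: cvec_eq_iff)
    then have "T = twistor_fiber (vec3 (q$1 / q$2) 1 0)" using q(1) twistor_fiber_scale False by metis
    moreover have "vec3 (q$1 / q$2) 1 0 \<in> example_points"
    proof -
      have "vec3 t 1 0 \<in> example_points" if "1 / 4 + t\<^sup>2 = cnj t" for t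
        using that unfolding conjugate_quadratic_solutions
        by (elim insertE emptyE; hypsubst; unfold example_points_def; blast)
      then show ?thesis using ev(2)[OF False] .
    qed
    ultimately show ?thesis by blast
  qed
next
  fix T assume "T \<in> twistor_fiber ` example_points"
  then obtain q where q: "T = twistor_fiber q" "q \<in> example_points" by blast
  moreover have "q \<noteq> 0" using q(2) by (auto simp: example_points_def vec3_eq_0_iff)
  ultimately show "T \<in> {T \<in> twistor_fibers. T \<subseteq> zero_locus example}"
    using fiber_subset_zero_locus_iff[OF example_section] example_vanishes_on_points 
    by (auto simp: twistor_fibers_def)
qed

lemma card_example_fibers: "card {T \<in> twistor_fibers. T \<subseteq> zero_locus example} = 4"
proof -
  have 1: "twistor_fiber (vec3 t 1 0) \<noteq> twistor_fiber (vec3 t' 1 0)" if "t \<noteq> t'" for t t'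
    using twistor_fiber_neq[OF unitary_non_proportional[OF unitary_mat_1 that]] by simp
  have 2: "twistor_fiber (vec3 1 0 0) \<noteq> twistor_fiber (vec3 t 1 0)" for t
    by (rule twistor_fiber_neq) (auto simp: non_proportional_def cvec_eq_iff)
  show ?thesis
    unfolding example_fibers example_points_def
    by (simp add: card_insert_if 1 2 complex_eq_iff)
qed

lemma polynomial_fun_divide: "polynomial_fun f \<Longrightarrow> polynomial_fun (\<lambda>t. f t / c)"
  unfolding divide_inverse by (intro polynomial_fun_mult polynomial_fun_const)

text \<open>The equation \<open>p\<^sub>1 (m\<^sup>2 / 4 + n\<^sup>2) + p\<^sub>2 m\<^sup>2 = 0\<close> determines \<open>(p\<^sub>1, p\<^sub>2)\<close> up to a factor if \<open>(m, n) \<noteq> 0\<close>, which is written as \<open>k z\<close> with \<open>z = l\<^sub>3\<close>. Then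
  \<open>p \<bullet> l = 0\<close> can be solved for \<open>p\<^sub>3\<close> without denominators.\<close>

definition param :: "complex \<Rightarrow> complex \<Rightarrow> complex \<Rightarrow> complex \<Rightarrow> cvec \<times> cvec" where
  "param m n k z = (vec3 (- (k * z * m\<^sup>2)) (k * z * (m\<^sup>2 / 4 + n\<^sup>2)) (k * (m^3 - m\<^sup>2 * n / 4 - n^3)), vec3 m n z)"

lemma param_zero:
  assumes "fst (param m n k z) \<noteq> 0" "snd (param m n k z) \<noteq> 0"
  shows "param m n k z \<in> flag_cone" "example (param m n k z) = 0"
proof -
  have "(- (k * z * m\<^sup>2)) * m + (k * z * (m\<^sup>2 / 4 + n\<^sup>2)) * n + (k * (m^3 - m\<^sup>2 * n / 4 - n^3)) * z = 0"
    by (simp add: algebra_simps power2_eq_square power3_eq_cube)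
  then show cone: "param m n k z \<in> flag_cone"
    using assms by (simp add: param_def flag_cone_iff)
  show "example (param m n k z) = 0"
    using example_eq[OF cone[unfolded param_def]] by (simp add: param_def)
qed

lemma tendsto_vec3:
  assumes "(a \<longlongrightarrow> a0) F" "(b \<longlongrightarrow> b0) F" "(c \<longlongrightarrow> c0) F"
  shows "((\<lambda>t. vec3 (a t) (b t) (c t)) \<longlongrightarrow> vec3 a0 b0 c0) F"
proof (rule vec_tendstoI)
  fix i :: 3
  show "((\<lambda>t. vec3 (a t) (b t) (c t) $ i) \<longlongrightarrow> vec3 a0 b0 c0 $ i) F"
    using assms by (cases "i = 1"; cases "i = 2") (simp_all add: vec3_def)
qed

text \<open>If \<open>(l\<^sub>1, l\<^sub>2) \<noteq> 0\<close>, write \<open>(p\<^sub>1, p\<^sub>2) = \<kappa> (- Y, X)\<close>. With the cubic form \<open>c = l\<^sub>1 Y - l\<^sub>2 X\<close> incidence says \<open>p\<^sub>3 l\<^sub>3 = \<kappa> c\<close>. If \<open>l\<^sub>3 \<noteq> 0\<close> or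
  \<open>c \<noteq> 0\<close>, the point is in the image of \<open>param\<close>. The remaining points lie on the lines that the second projection contracts, and each is
  approached along a curve in the image.\<close>

lemma param_dense:
  assumes cone: "(p, l) \<in> flag_cone" and zero: "example (p, l) = 0"
  obtains m n k z where "((\<lambda>d. param (m d) (n d) (k d) (z d)) \<longlongrightarrow> (p, l)) (at (0 :: complex))"
proof -
  define X where "X = (l$1)\<^sup>2 / 4 + (l$2)\<^sup>2"
  define Y where "Y = (l$1)\<^sup>2"
  define c where "c m n = m^3 - m\<^sup>2 * n / 4 - n^3" for m n :: complex
  have s: "p$1 * X + p$2 * Y = 0" using zero example_eq[OF cone] by (simp add: X_def Y_def)
  have pl: "p$1 * l$1 + p$2 * l$2 + p$3 * l$3 = 0" and nz: "p \<noteq> 0" "l \<noteq> 0" using cone by (simp_all add: flag_cone_iff)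
  have eta: "(p, l) = (vec3 (p$1) (p$2) (p$3), vec3 (l$1) (l$2) (l$3))" by (simp add: vec3_eta)
  show thesis
  proof (cases "l$1 = 0 \<and> l$2 = 0")
    case True
    then have l3: "l$3 \<noteq> 0" and p3: "p$3 = 0" using nz pl by (auto simp: cvec_eq_iff)
    \<comment> \<open>\<open>X\<close> and \<open>Y\<close> have degree 2, so \<open>d\<^sup>2\<close> cancels against the factor \<open>1 / d\<^sup>2\<close> in \<open>(p\<^sub>1, p\<^sub>2)\<close>, while \<open>p\<^sub>3\<close> is cubic and tends to 0.\<close>
    define v where "v = csqrt (- p$1)"
    define w where "w = csqrt (p$2 - v\<^sup>2 / 4)"
    have v: "v\<^sup>2 = - p$1" and w: "w\<^sup>2 = p$2 - v\<^sup>2 / 4" by (simp_all only: v_def w_def power2_csqrt)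
    have "((\<lambda>d. (vec3 (p$1) (p$2) (d * c v w / l$3), vec3 (d * v) (d * w) (l$3))) \<longlongrightarrow>
        (vec3 (p$1) (p$2) (0 * c v w / l$3), vec3 (0 * v) (0 * w) (l$3))) (at 0)"
      by (intro tendsto_Pair tendsto_vec3 tendsto_intros l3)
    then have "((\<lambda>d. (vec3 (p$1) (p$2) (d * c v w / l$3), vec3 (d * v) (d * w) (l$3))) \<longlongrightarrow> (p, l)) (at 0)"
    proof -
      have "(p, l) = (vec3 (p$1) (p$2) 0, vec3 0 0 (l$3))" using True p3 by (simp add: cvec_eq_iff)
      then show ?thesis using \<open>((\<lambda>d. (vec3 (p$1) (p$2) (d * c v w / l$3), vec3 (d * v) (d * w) (l$3))) \<longlongrightarrow>
        (vec3 (p$1) (p$2) (0 * c v w / l$3), vec3 (0 * v) (0 * w) (l$3))) (at 0)\<close> by simp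
    qed
    moreover have "eventually (\<lambda>d. (vec3 (p$1) (p$2) (d * c v w / l$3), vec3 (d * v) (d * w) (l$3)) = 
        param (d * v) (d * w) (1 / (d\<^sup>2 * l$3)) (l$3)) (at 0)"
      unfolding eventually_at_topological
    proof (intro exI[of _ UNIV] conjI ballI impI)
      fix d :: complex assume d: "d \<noteq> 0"
      have "- (1 / (d\<^sup>2 * l$3) * l$3 * (d * v)\<^sup>2) = - v\<^sup>2" using d l3 by (simp add: field_simps power2_eq_square)
      moreover have "1 / (d\<^sup>2 * l$3) * l$3 * ((d * v)\<^sup>2 / 4 + (d * w)\<^sup>2) = v\<^sup>2 / 4 + w\<^sup>2" 
        using d l3 by (simp add: field_simps power2_eq_square)
      moreover have "1 / (d\<^sup>2 * l$3) * ((d * v)^3 - (d * v)\<^sup>2 * (d * w) / 4 - (d * w)^3) = d * c v w / l$3" 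
        using d l3 by (simp add: c_def field_simps power2_eq_square power3_eq_cube)
      ultimately show "(vec3 (p$1) (p$2) (d * c v w / l$3), vec3 (d * v) (d * w) (l$3)) = 
        param (d * v) (d * w) (1 / (d\<^sup>2 * l$3)) (l$3)"
        unfolding param_def using v w by simp
    qed auto
    ultimately have "((\<lambda>d. param (d * v) (d * w) (1 / (d\<^sup>2 * l$3)) (l$3)) \<longlongrightarrow> (p, l)) (at 0)"
        by (rule Lim_transform_eventually)
      then show ?thesis by (rule that[of "\<lambda>d. d * v" "\<lambda>d. d * w" "\<lambda>d. 1 / (d\<^sup>2 * l$3)" "\<lambda>d. l$3"])
  next
    case False
    obtain \<kappa> where \<kappa>: "p$1 = - (\<kappa> * Y)" "p$2 = \<kappa> * X"
    proof (cases "Y = 0")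
      case True
      then have "l$1 = 0" by (simp add: Y_def)
      then have "X \<noteq> 0" using False by (simp add: X_def)
      moreover from this have "p$1 = 0" using s True by simp
      ultimately show ?thesis using that[of "p$2 / X"] True by simp
    next
      case False
      have "p$2 * Y = - p$1 * X" using s by (simp add: add_eq_0_iff)
      then have "p$2 = - p$1 / Y * X" using False by (simp add: field_simps)
      then show ?thesis using that[of "- p$1 / Y"] False by simp
    qed
    have p3: "p$3 * l$3 = \<kappa> * c (l$1) (l$2)"
      using pl \<kappa> by (simp add: c_def X_def Y_def power2_eq_square power3_eq_cube algebra_simps add_eq_0_iff)
    consider "l$3 \<noteq> 0" | "l$3 = 0" "c (l$1) (l$2) \<noteq> 0" | "l$3 = 0" "c (l$1) (l$2) = 0" "p$3 = 0"
      | "l$3 = 0" "c (l$1) (l$2) = 0" "p$3 \<noteq> 0" by blast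
    then show ?thesis
    proof cases
      case 1
      have "p$3 = \<kappa> / l$3 * c (l$1) (l$2)" using p3 1 by (simp add: field_simps)
      then have "param (l$1) (l$2) (\<kappa> / l$3) (l$3) = (p, l)"
        unfolding eta param_def c_def using \<kappa> 1 by (simp add: X_def Y_def cvec_eq_iff)
      then show ?thesis using that[of "\<lambda>_. l$1" "\<lambda>_. l$2" "\<lambda>_. \<kappa> / l$3" "\<lambda>_. l$3"] by simp
    next
      case 2
      then have "\<kappa> = 0" using p3 by simp
      then have "param (l$1) (l$2) (p$3 / c (l$1) (l$2)) (l$3) = (p, l)"
        unfolding eta param_def using \<kappa> 2 by (simp add: c_def cvec_eq_iff)
      then show ?thesis using that[of "\<lambda>_. l$1" "\<lambda>_. l$2" "\<lambda>_. p$3 / c (l$1) (l$2)" "\<lambda>_. l$3"] by simp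
    next
      case 3
      have "((\<lambda>d. (p, vec3 (l$1) (l$2) d)) \<longlongrightarrow> (p, vec3 (l$1) (l$2) 0)) (at 0)"
        by (intro tendsto_Pair tendsto_vec3 tendsto_intros)
      then have "((\<lambda>d. (p, vec3 (l$1) (l$2) d)) \<longlongrightarrow> (p, l)) (at 0)"
        using 3 by (metis vec3_eta)
      moreover have "eventually (\<lambda>d. (p, vec3 (l$1) (l$2) d) = param (l$1) (l$2) (\<kappa> / d) d) (at 0)"
        unfolding eventually_at_topological
      proof (intro exI[of _ UNIV] conjI ballI impI)
        fix d :: complex assume d: "d \<noteq> 0"
        have "\<kappa> / d * ((l$1)^3 - (l$1)\<^sup>2 * l$2 / 4 - (l$2)^3) = 0" using 3(2) unfolding c_def by simp
        then show "(p, vec3 (l$1) (l$2) d) = param (l$1) (l$2) (\<kappa> / d) d"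
          unfolding param_def using d 3 \<kappa> by (simp add: X_def Y_def cvec_eq_iff)
      qed auto
      ultimately have "((\<lambda>d. param (l$1) (l$2) (\<kappa> / d) (d)) \<longlongrightarrow> (p, l)) (at 0)"
        by (rule Lim_transform_eventually)
      then show ?thesis by (rule that[of "\<lambda>d. l$1" "\<lambda>d. l$2" "\<lambda>d. \<kappa> / d" "\<lambda>d. d"])
    next
      case 4
      \<comment> \<open>The form \<open>c\<close> is monic in its first argument, so \<open>(l\<^sub>1, l\<^sub>2)\<close> is an isolated zero when only \<open>l\<^sub>1\<close> varies.\<close>
      define m where "m d = l$1 + d" for d
      define C where "C d = c (m d) (l$2)" for d
      have "polynomial_fun C" unfolding C_def c_def m_def
        by (intro polynomial_fun_diff polynomial_fun_divide polynomial_fun_mult polynomial_fun_power polynomial_fun_add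
            polynomial_fun_const polynomial_fun_ident)
      moreover obtain d0 where "C d0 \<noteq> 0"
      proof (rule ccontr)
        assume "\<not> thesis"
        then have all: "C d = 0" for d using that by blast
        have "c t (l$2) = 0" for t using all[of "t - l$1"] by (simp add: C_def m_def)
        from this[of 0] this[of 1] this[of 2] show False
          by (simp add: c_def)
      qed
      ultimately have "finite {d. C d = 0}" using polynomial_fun_finite_zeros by blast
      then have "open (- ({d. C d = 0} - {0}))"
        by (intro open_Compl finite_imp_closed finite_Diff)
      then have ev: "eventually (\<lambda>d. C d \<noteq> 0) (at 0)"
        unfolding eventually_at_topological
        by (intro exI[of _ "- ({d. C d = 0} - {0})"]) auto
      have C0: "C 0 = 0" using 4 by (simp add: C_def m_def)
      have "((\<lambda>d. (vec3 (- (\<kappa> * (m d)\<^sup>2)) (\<kappa> * ((m d)\<^sup>2 / 4 + (l$2)\<^sup>2)) (p$3), vec3 (m d) (l$2) (\<kappa> * C d / p$3))) \<longlongrightarrow>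
          (vec3 (- (\<kappa> * (m 0)\<^sup>2)) (\<kappa> * ((m 0)\<^sup>2 / 4 + (l$2)\<^sup>2)) (p$3), vec3 (m 0) (l$2) (\<kappa> * C 0 / p$3))) (at 0)"
        unfolding C_def c_def m_def
        by (intro tendsto_Pair tendsto_vec3 tendsto_intros 4) auto
      also have "(vec3 (- (\<kappa> * (m 0)\<^sup>2)) (\<kappa> * ((m 0)\<^sup>2 / 4 + (l$2)\<^sup>2)) (p$3), vec3 (m 0) (l$2) (\<kappa> * C 0 / p$3)) = (p, l)"
        using \<kappa> 4 C0 by (simp add: m_def X_def Y_def cvec_eq_iff)
      finally have "((\<lambda>d. (vec3 (- (\<kappa> * (m d)\<^sup>2)) (\<kappa> * ((m d)\<^sup>2 / 4 + (l$2)\<^sup>2)) (p$3), vec3 (m d) (l$2) (\<kappa> * C d / p$3))) \<longlongrightarrow> (p, l)) (at 0)" .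
      moreover have "eventually (\<lambda>d. (vec3 (- (\<kappa> * (m d)\<^sup>2)) (\<kappa> * ((m d)\<^sup>2 / 4 + (l$2)\<^sup>2)) (p$3), vec3 (m d) (l$2) (\<kappa> * C d / p$3)) =
          param (m d) (l$2) (p$3 / C d) (\<kappa> * C d / p$3)) (at 0)"
        using ev
      proof eventually_elim
        case (elim d)
        have "p$3 / C d * (\<kappa> * C d / p$3) = \<kappa>" using elim 4 by simp
        moreover have "p$3 / C d * ((m d)^3 - (m d)\<^sup>2 * l$2 / 4 - (l$2)^3) = p$3" 
          using elim unfolding C_def c_def by simp
        ultimately show ?case unfolding param_def by simp
      qed
      ultimately have "((\<lambda>d. param (m d) (l$2) (p$3 / C d) (\<kappa> * C d / p$3)) \<longlongrightarrow> (p, l)) (at 0)"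
        by (rule Lim_transform_eventually)
      then show ?thesis by (rule that[of "\<lambda>d. m d" "\<lambda>d. l$2" "\<lambda>d. p$3 / C d" "\<lambda>d. \<kappa> * C d / p$3"])
    qed
  qed
qed

lemma param_nonzero:
  assumes "(p, l) \<in> flag_cone" "example (p, l) = 0" "P \<in> bihom a b" "P (p, l) \<noteq> 0"
  obtains m n k z where "P (param m n k z) \<noteq> 0" "fst (param m n k z) \<noteq> 0" "snd (param m n k z) \<noteq> 0"
proof -
  obtain m n k z where lim: "((\<lambda>d. param (m d) (n d) (k d) (z d)) \<longlongrightarrow> (p, l)) (at (0 :: complex))"
    using param_dense[OF assms(1,2)] .
  have "((\<lambda>d. P (param (m d) (n d) (k d) (z d))) \<longlongrightarrow> P (p, l)) (at (0 :: complex))"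
  proof (rule isCont_tendsto_compose[OF _ lim])
    show "isCont P (p, l)"
      using bihom_continuous[OF assms(3), of UNIV] by (simp add: continuous_on_eq_continuous_at)
  qed
  then have "eventually (\<lambda>d. P (param (m d) (n d) (k d) (z d)) \<noteq> 0) (at (0 :: complex))"
    using assms(4) tendsto_imp_eventually_ne by blast
  moreover have "eventually (\<lambda>d. fst (param (m d) (n d) (k d) (z d)) \<noteq> 0) (at (0 :: complex))"
    using tendsto_imp_eventually_ne[OF tendsto_fst[OF lim], of 0] assms(1) by (simp add: flag_cone_iff)
  moreover have "eventually (\<lambda>d. snd (param (m d) (n d) (k d) (z d)) \<noteq> 0) (at (0 :: complex))"
    using tendsto_imp_eventually_ne[OF tendsto_snd[OF lim], of 0] assms(1) by (simp add: flag_cone_iff)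
  ultimately have "eventually (\<lambda>d. P (param (m d) (n d) (k d) (z d)) \<noteq> 0 \<and> fst (param (m d) (n d) (k d) (z d)) \<noteq> 0 \<and>
    snd (param (m d) (n d) (k d) (z d)) \<noteq> 0) (at (0 :: complex))"
    by eventually_elim simp
  then have "\<exists>d. P (param (m d) (n d) (k d) (z d)) \<noteq> 0 \<and> fst (param (m d) (n d) (k d) (z d)) \<noteq> 0 \<and>
    snd (param (m d) (n d) (k d) (z d)) \<noteq> 0"
    by (rule eventually_happens'[OF at_neq_bot])
  then show ?thesis using that by blast
qed

lemma polynomial_fun_param:
  assumes "polynomial_fun m" "polynomial_fun n" "polynomial_fun k" "polynomial_fun z"
  shows "polynomial_fun (\<lambda>t. fst (param (m t) (n t) (k t) (z t)) $ i)" "polynomial_fun (\<lambda>t. snd (param (m t) (n t) (k t) (z t)) $ i)"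
proof -
  have "polynomial_fun (\<lambda>t. (m t)\<^sup>2 / 4)" "polynomial_fun (\<lambda>t. (m t)\<^sup>2 * n t / 4)"
    by (intro polynomial_fun_divide polynomial_fun_mult polynomial_fun_power assms)+
  then have "\<forall>i. polynomial_fun (\<lambda>t. fst (param (m t) (n t) (k t) (z t)) $ i)" 
    unfolding param_def forall_3 fst_conv vec3_nth
    by (intro conjI polynomial_fun_uminus polynomial_fun_mult polynomial_fun_power polynomial_fun_add polynomial_fun_diff assms)
  moreover have "\<forall>i. polynomial_fun (\<lambda>t. snd (param (m t) (n t) (k t) (z t)) $ i)"
    using assms by (simp add: param_def forall_3)
  ultimately show "polynomial_fun (\<lambda>t. fst (param (m t) (n t) (k t) (z t)) $ i)" "polynomial_fun (\<lambda>t. snd (param (m t) (n t) (k t) (z t)) $ i)"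
    by blast+
qed

text \<open>If the surface is not contained in the closed sets \<open>C\<close> and \<open>D\<close>, some \<open>P\<close> and \<open>Q\<close> that vanish on them are nonzero at two parameter
  values. On the line between these values both are nonzero polynomials, so they have a common non-zero, which is a point of the surface
  outside \<open>C\<close> and \<open>D\<close>.\<close>

lemma irreducible_example: "irreducible_in zariski (zero_locus example)"
  unfolding irreducible_in_def
proof (intro conjI allI impI)
  have "vec3 1 0 0 \<in> example_points" by (simp add: example_points_def)
  then have "twistor_fiber (vec3 1 0 0) \<subseteq> zero_locus example" using example_fibers by blast
  moreover have "(pt (vec3 0 1 0), pt (vec3 0 0 1)) \<in> twistor_fiber (vec3 1 0 0)"
  proof -
    have "(vec3 0 1 0, vec3 0 0 1) \<in> flag_cone" "pairing (vec3 0 1 0) (cnj_vec (vec3 1 0 0)) = 0" "pairing (vec3 1 0 0) (vec3 0 0 1) = 0"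
      by (simp_all add: flag_cone_iff vec3_eq_0_iff pairing3)
    then show ?thesis unfolding twistor_fiber_def by blast
  qed
  ultimately show "zero_locus example \<noteq> {}" by blast
next
  fix C D assume CD: "closedin zariski C \<and> closedin zariski D \<and> zero_locus example \<subseteq> C \<union> D"
  have nonvanishing: "\<exists>P a b m n k z. P \<in> bihom a b \<and> basic_open P \<inter> C = {} \<and> P (param m n k z) \<noteq> 0 \<and> 
      fst (param m n k z) \<noteq> 0 \<and> snd (param m n k z) \<noteq> 0"
    if closed: "closedin zariski C" and notin: "\<not> zero_locus example \<subseteq> C" for C
  proof -
    obtain p l where pl: "(p, l) \<in> flag_cone" "example (p, l) = 0" "(pt p, pt l) \<notin> C"
      using notin by (auto simp: zero_locus_def)
    have "openin zariski (UNIV - C)" "(pt p, pt l) \<in> UNIV - C" using closed pl by (auto simp: closedin_def)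
    then obtain P a b where P: "P \<in> bihom a b" "(pt p, pt l) \<in> basic_open P" "basic_open P \<subseteq> UNIV - C"
      using zariski_basis by metis
    have "P (p, l) \<noteq> 0" using P(2) mem_basic_open[OF P(1), of p l] pl by (simp add: flag_cone_iff)
    then obtain m n k z where "P (param m n k z) \<noteq> 0" "fst (param m n k z) \<noteq> 0" "snd (param m n k z) \<noteq> 0"
      using param_nonzero[OF pl(1,2) P(1)] by blast
    then show ?thesis using P(1,3) by blast
  qed
  show "zero_locus example \<subseteq> C \<or> zero_locus example \<subseteq> D"
  proof (rule ccontr)
    assume "\<not> (zero_locus example \<subseteq> C \<or> zero_locus example \<subseteq> D)"
    then have nC: "\<not> zero_locus example \<subseteq> C" and nD: "\<not> zero_locus example \<subseteq> D" by blast+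
    obtain P a b m n k z where P: "P \<in> bihom a b" "basic_open P \<inter> C = {}" "P (param m n k z) \<noteq> 0"
      and "fst (param m n k z) \<noteq> 0" "snd (param m n k z) \<noteq> 0"
      using nonvanishing[OF _ nC] CD by blast
    \<comment> \<open>The line may pass through parameters with \<open>p = 0\<close> or \<open>l = 0\<close>, which give no point; two coordinate functions exclude them.\<close>
    then obtain i j where i: "fst (param m n k z) $ i \<noteq> 0" and j: "snd (param m n k z) $ j \<noteq> 0"
      by (metis vec_eq_iff zero_index)
    obtain Q a' b' m' n' k' z' where Q: "Q \<in> bihom a' b'" "basic_open Q \<inter> D = {}" "Q (param m' n' k' z') \<noteq> 0"
      using nonvanishing[OF _ nD] CD by blast
    define \<gamma> where "\<gamma> t = param (m + t * (m' - m)) (n + t * (n' - n)) (k + t * (k' - k)) (z + t * (z' - z))" for t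
    have comp: "polynomial_fun (\<lambda>t. fst (\<gamma> t) $ h)" "polynomial_fun (\<lambda>t. snd (\<gamma> t) $ h)" for h
      unfolding \<gamma>_def by (intro polynomial_fun_param polynomial_fun_add polynomial_fun_mult polynomial_fun_const polynomial_fun_ident)+
    have pol: "polynomial_fun (\<lambda>t. P (\<gamma> t))" "polynomial_fun (\<lambda>t. Q (\<gamma> t))"
      using polynomial_fun_bihom[OF P(1) comp] polynomial_fun_bihom[OF Q(1) comp] by simp_all
    have ends: "\<gamma> 0 = param m n k z" "\<gamma> 1 = param m' n' k' z'" by (simp_all add: \<gamma>_def)
    have "finite {t. P (\<gamma> t) = 0}" "finite {t. Q (\<gamma> t) = 0}" "finite {t. fst (\<gamma> t) $ i = 0}" "finite {t. snd (\<gamma> t) $ j = 0}"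
      using polynomial_fun_finite_zeros[OF pol(1), of 0] polynomial_fun_finite_zeros[OF pol(2), of 1]
        polynomial_fun_finite_zeros[OF comp(1)[of i], of 0] polynomial_fun_finite_zeros[OF comp(2)[of j], of 0] ends P(3) Q(3) i j
      by simp_all
    then have "finite ({t. P (\<gamma> t) = 0} \<union> {t. Q (\<gamma> t) = 0} \<union> {t. fst (\<gamma> t) $ i = 0} \<union> {t. snd (\<gamma> t) $ j = 0})" by simp
    from ex_new_if_finite[OF infinite_UNIV_char_0 this]
    obtain t where "t \<notin> {t. P (\<gamma> t) = 0} \<union> {t. Q (\<gamma> t) = 0} \<union> {t. fst (\<gamma> t) $ i = 0} \<union> {t. snd (\<gamma> t) $ j = 0}" ..
    then have t: "P (\<gamma> t) \<noteq> 0" "Q (\<gamma> t) \<noteq> 0" "fst (\<gamma> t) \<noteq> 0" "snd (\<gamma> t) \<noteq> 0" by auto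
    obtain p l where pl: "\<gamma> t = (p, l)" by force
    have "(p, l) \<in> flag_cone" "example (p, l) = 0"
      unfolding pl[symmetric] \<gamma>_def by (rule param_zero[OF t(3,4)[unfolded \<gamma>_def]])+
    then have "(pt p, pt l) \<in> zero_locus example" by (auto simp: zero_locus_def)
    then have "(pt p, pt l) \<in> C \<union> D" using CD by blast
    moreover have "(pt p, pt l) \<in> basic_open P" "(pt p, pt l) \<in> basic_open Q"
      using t pl by (auto simp: basic_open_def)
    ultimately show False using P(2) Q(2) by blast
  qed
qed auto

lemma example_irreducible_with_four_fibers: "irreducible_with_four_fibers example"
proof -
  have cone: "(vec3 0 1 0, vec3 1 0 0) \<in> flag_cone" by (simp add: flag_cone_iff vec3_eq_0_iff)
  have "example (vec3 0 1 0, vec3 1 0 0) = 1" using example_eq[OF cone] by simp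
  then have "example \<noteq> 0" by auto
  then show ?thesis
    using example_section irreducible_example card_example_fibers
    by (simp add: irreducible_with_four_fibers_def linear_system_def)
qed

theorem theorem4p10:
  shows "(\<exists>s. irreducible_with_four_fibers s) \<and>
    (\<forall>s A. irreducible_with_four_fibers s \<and> A \<in> disjoint_twistor_unions 4 \<and> A \<subseteq> zero_locus s \<longrightarrow>
       (\<exists>L\<in>curves_1_0.
          (\<forall>C\<in>connected_components_of (subtopology zariski A). L \<inter> C \<noteq> {}) \<and>
          h0_ideal A 1 2 = 2 \<and>
          (\<forall>t\<in>linear_system_containing A 1 2. L \<subseteq> singular_locus t)))"
  using example_irreducible_with_four_fibers line_through_four_fibers by blast

end
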